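(* Let $f$ be a monic polynomial of degree $d\ge 2$ with connected Julia set $J(f)$, and let $z\in J(f)$ be a point with infinite forward orbit under $f$. Then there are at most $2^d$ external rays landing at $z$. Moreover, for all $n$ sufficiently large, there are at most $d$ external rays landing at $f^{\circ n}(z)$.
   Context: $K(f)$ is the set of points of $\mathbb{C}$ with bounded forward orbit under $f$, $J(f)=\partial K(f)$, and $\Omega(f)=\mathbb{C}\setminus K(f)$. $\mathbb{D}$ is the open unit disk. When $J(f)$ is connected, the Böttcher map $\phi_f:\Omega(f)\to\mathbb{C}\setminus\overline{\mathbb{D}}$ is the unique conformal isomorphism with $\phi_f(f(z))=\phi_f(z)^d$ and $\phi_f(z)/z\to 1$ as $z\to\infty$. For $t\in\mathbb{R}/\mathbb{Z}$ the external ray with argument $t$ is $R^t_f=\phi_f^{-1}\big((1,\infty)e^{2\pi i t}\big)$. It lands at $z\in J(f)$ if $\phi_f^{-1}(re^{2\pi i t})\to z$ as $r\to 1^+$. *)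

theory Defs
  imports "HOL-Complex_Analysis.Complex_Analysis" "HOL-Computational_Algebra.Polynomial"
begin

definition filled_julia :: "complex poly \<Rightarrow> complex set" where
  "filled_julia f = {z. bounded (range (\<lambda>n. (poly f ^^ n) z))}"

definition julia :: "complex poly \<Rightarrow> complex set" where
  "julia f = frontier (filled_julia f)"

definition basin_infinity :: "complex poly \<Rightarrow> complex set" where
  "basin_infinity f = - filled_julia f"

text \<open>A conformal isomorphism is a holomorphic bijection; its inverse is then holomorphic
  automatically.\<close>

definition is_boettcher_map :: "complex poly \<Rightarrow> (complex \<Rightarrow> complex) \<Rightarrow> bool" where
  "is_boettcher_map f \<phi> \<longleftrightarrow>
     \<phi> holomorphic_on basin_infinity f \<and>
     bij_betw \<phi> (basin_infinity f) (- cball 0 1) \<and>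
     (\<forall>z\<in>basin_infinity f. \<phi> (poly f z) = \<phi> z ^ degree f) \<and>
     ((\<lambda>z. \<phi> z / z) \<longlongrightarrow> 1) at_infinity"

text \<open>For monic polynomials of degree at least 2 with connected Julia set, such a map exists
  and its values on \<^term>\<open>basin_infinity f\<close> are uniquely determined. As functions are total,
  its values on \<^term>\<open>filled_julia f\<close> are arbitrary, hence \<open>SOME\<close> rather than \<open>THE\<close>; they
  are never used below.\<close>

definition boettcher_map :: "complex poly \<Rightarrow> complex \<Rightarrow> complex" where
  "boettcher_map f = (SOME \<phi>. is_boettcher_map f \<phi>)"

definition boettcher_inv :: "complex poly \<Rightarrow> complex \<Rightarrow> complex" where
  "boettcher_inv f = inv_into (basin_infinity f) (boettcher_map f)"

text \<open>Arguments in $\mathbb{R}/\mathbb{Z}$ are represented by real numbers: the two notions below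
  are 1-periodic in \<open>t\<close>.\<close>

definition external_ray :: "complex poly \<Rightarrow> real \<Rightarrow> complex set" where
  "external_ray f t = (\<lambda>r. boettcher_inv f (of_real r * cis (2 * pi * t))) ` {1<..}"

definition external_ray_lands :: "complex poly \<Rightarrow> real \<Rightarrow> complex \<Rightarrow> bool" where
  "external_ray_lands f t z \<longleftrightarrow>
     z \<in> julia f \<and>
     ((\<lambda>r. boettcher_inv f (of_real r * cis (2 * pi * t))) \<longlongrightarrow> z) (at_right 1)"

text \<open>The rays themselves are collected, so representatives of the same argument in
  $\mathbb{R}/\mathbb{Z}$ count once.\<close>

definition rays_landing_at :: "complex poly \<Rightarrow> complex \<Rightarrow> complex set set" where
  "rays_landing_at f z = {external_ray f t |t. external_ray_lands f t z}"

end

theory Submission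
  imports Defs "HOL-Computational_Algebra.Fundamental_Theorem_Algebra"
begin

text \<open>Angles are represented in \<open>[0, 1)\<close>, and \<open>A\<^sub>n\<close> denotes the images under multiplication by \<open>d\<close> of a
  finite set of angles of rays landing at \<open>z\<close>. The sets \<open>A\<^sub>n\<close> are pairwise disjoint and, by the Jordan
  curve theorem, pairwise unlinked. Once the orbit has passed all critical points, multiplication by
  \<open>d\<close> maps consecutive elements of \<open>A\<^sub>n\<close> to consecutive elements of \<open>A\<^bsub>n+1\<^esub>\<close>, so that each gap can be
  followed through time; its length is multiplied by \<open>d\<close> as long as it is below \<open>1 / d\<close>.

  If there are \<open>N \<ge> 3\<close> gaps, then unlinkedness forces arbitrarily short gaps, hence times at which all
  gaps but one are short. At the first such time the \<open>N - 1\<close> short gaps can be traced back to moments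
  when they were born from a gap longer than \<open>1 / d\<close>, that is, from a chord close to one joining two
  points with the same image. These \<open>N - 1\<close> chords are pairwise unlinked and have disjoint images, and
  the same holds for the fibres collapsed at the critical points passed before. There is only room for
  \<open>d - 1\<close> such identifications, counted with multiplicity. Thus \<open>k\<close> identifications on the
  way leave \<open>N \<le> max 2 (d - k)\<close>, and at most \<open>2\<^sup>k N \<le> 2\<^sup>d\<close> rays land at \<open>z\<close>.\<close>


section \<open>Arcs of the circle\<close>

text \<open>A fibre with \<open>q + 1\<close> elements counts as \<open>q\<close> identifications
  and costs a factor \<open>q + 1 \<le> 2 ^ q\<close>; this is the origin of the powers of 2. The
  supply of identifications is limited because unlinked sets inside fibres of multiplication by
  \<open>d\<close> give nested or non-overlapping intervals whose lengths, scaled by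
  \<open>d\<close>, are positive integers, all within an interval shorter than \<open>d\<close>. The
  endpoints of a long gap have different images, so its chord must be shortened before it lies in a
  fibre. The shortening is harmless only if no competing angle is mapped into the image gap, and
  this is what the relation \<open>apart\<close> secures. Two angles are exceptional because pairs
  can be close to each other as parallel chords without being linked. On the analytic side
  \<open>boettcher_map\<close> is defined by \<open>SOME\<close>, so nothing is known about rays
  until a Boettcher map is constructed. Connectedness of the Julia set enters there, as simple
  connectedness of the basin with infinity added.\<close>

definition in_arc :: "real \<Rightarrow> real \<Rightarrow> real \<Rightarrow> bool" where
  "in_arc a c b \<longleftrightarrow> 0 < frac (c - a) \<and> frac (c - a) < frac (b - a)"

definition unlinked :: "real set \<Rightarrow> real set \<Rightarrow> bool" where
  "unlinked X Y \<longleftrightarrow> (\<forall>p\<in>X. \<forall>q\<in>X. \<forall>s\<in>Y. \<forall>t\<in>Y. \<not> (in_arc p s q \<and> in_arc q t p))"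

text \<open>\<open>frac (x - u)\<close> is the position of \<open>x\<close> on the circle seen from
  \<open>u\<close>. Referring all positions to one base point turns cyclic order into linear
  inequalities.\<close>

lemma frac_diff_base:
  "frac (y - x) = (if frac (x - u) \<le> frac (y - u) then frac (y - u) - frac (x - u)
                   else frac (y - u) - frac (x - u) + 1)"
proof -
  let ?v = "if frac (x - u) \<le> frac (y - u) then frac (y - u) - frac (x - u)
                   else frac (y - u) - frac (x - u) + 1"
  have "0 \<le> ?v" "?v < 1"
    using frac_ge_0[of "x-u"] frac_lt_1[of "x-u"] frac_ge_0[of "y-u"] frac_lt_1[of "y-u"]
    by (auto simp del: frac_ge_0)
  moreover have "y - x - ?v \<in> \<int>"
    by (auto simp: frac_def algebra_simps)
  ultimately show ?thesis
    using frac_unique_iff[of "y - x" ?v] by auto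
qed

lemma frac_eq_iff_diff_Ints: "frac x = frac y \<longleftrightarrow> x - y \<in> \<int>" for x y :: real
proof
  assume "frac x = frac y"
  then have "x - y = of_int (floor x - floor y)" by (simp add: frac_def)
  then show "x - y \<in> \<int>" by (metis Ints_of_int)
next
  assume "x - y \<in> \<int>"
  then obtain k where "x = y + of_int k" by (metis Ints_cases add.commute diff_add_cancel)
  then show "frac x = frac y" by (simp add: frac_def)
qed

lemma frac_diff_frac: "frac (frac x - frac y) = frac (x - y)" "frac (frac x - y) = frac (x - y)"
  "frac (x - frac y) = frac (x - y)" for x y :: real
  by (auto simp: frac_eq_iff_diff_Ints) (auto simp: frac_def)

lemma frac_add_frac_diff: "frac (t + frac (u - t)) = frac u" for t u :: real
proof -
  have "t + frac (u - t) - u = of_int (- \<lfloor>u - t\<rfloor>)" by (simp add: frac_def)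
  then show ?thesis unfolding frac_eq_iff_diff_Ints by (metis Ints_of_int)
qed

lemma frac_diff_unit:
  fixes x y :: real
  assumes "x \<in> {0..<1}" "y \<in> {0..<1}"
  shows "frac (y - x) = (if x \<le> y then y - x else y - x + 1)"
  using frac_diff_base[of y x 0] assms by (simp add: frac_eq)

lemma in_arc_unit:
  assumes "a \<in> {0..<1}" "b \<in> {0..<1}" "c \<in> {0..<1}"
  shows "in_arc a c b \<longleftrightarrow> a < c \<and> c < b \<or> c < b \<and> b < a \<or> b < a \<and> a < c"
  unfolding in_arc_def frac_diff_unit[OF assms(1,2)] frac_diff_unit[OF assms(1,3)] using assms
  by auto

lemma in_arc_frac: "in_arc (frac a) (frac c) (frac b) \<longleftrightarrow> in_arc a c b"
  by (simp add: in_arc_def frac_diff_frac)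

lemma in_arc_order:
  "in_arc a c b \<longleftrightarrow> frac a < frac c \<and> frac c < frac b \<or> frac c < frac b \<and> frac b < frac a
     \<or> frac b < frac a \<and> frac a < frac c"
  by (subst in_arc_frac[symmetric], subst in_arc_unit) (auto simp: frac_lt_1)

lemma in_arc_sym:
  assumes "in_arc p s q" "in_arc q t p" shows "in_arc s q t \<and> in_arc t p s"
  using assms unfolding in_arc_order by linarith

lemma unlinked_sym: "unlinked X Y \<Longrightarrow> unlinked Y X"
  unfolding unlinked_def by (metis in_arc_sym)

lemma unlinked_mono: "unlinked X Y \<Longrightarrow> X' \<subseteq> X \<Longrightarrow> Y' \<subseteq> Y \<Longrightarrow> unlinked X' Y'"
  unfolding unlinked_def by blast

section \<open>Counting critical chords\<close>

text \<open>Splitting off the interval with the smallest left endpoint \<open>x\<close>: the family inside it lives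
  in an interval strictly shorter than \<open>R x - x\<close>, so integrality gains one.\<close>

lemma laminar_integral_card:
  fixes R :: "real \<Rightarrow> real"
  assumes "finite X"
    and "\<And>x. x \<in> X \<Longrightarrow> R x - x \<in> \<int> \<and> x < R x \<and> u \<le> x \<and> R x \<le> v"
    and "\<And>x x'. x \<in> X \<Longrightarrow> x' \<in> X \<Longrightarrow> x < x' \<Longrightarrow> R x \<le> x' \<or> R x' \<le> R x"
    and "u \<le> v"
  shows "real (card X) \<le> v - u"
  using assms
proof (induction "card X" arbitrary: X u v rule: less_induct)
  case less
  show ?case
  proof (cases "X = {}")
    case False
    define x where "x = Min X"
    have x: "x \<in> X" "\<And>y. y \<in> X \<Longrightarrow> x \<le> y" using False less.prems(1) by (auto simp: x_def)
    define X1 where "X1 = {y\<in>X. x < y \<and> y < R x}"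
    define X2 where "X2 = {y\<in>X. R x \<le> y}"
    have X: "X = insert x (X1 \<union> X2)" "x \<notin> X1 \<union> X2" "X1 \<inter> X2 = {}" "finite X1" "finite X2"
      using x less.prems(1) less.prems(2)[OF x(1)] unfolding X1_def X2_def
      by (auto simp: not_le) (metis order.order_iff_strict)
    have card: "card X = Suc (card X1 + card X2)"
      using X by (metis card_insert_disjoint card_Un_disjoint finite_Un)
    have 2: "real (card X2) \<le> v - R x"
    proof (rule less.hyps)
      show "card X2 < card X" using card by simp
      show "\<And>y. y \<in> X2 \<Longrightarrow> R y - y \<in> \<int> \<and> y < R y \<and> R x \<le> y \<and> R y \<le> v"
        using less.prems(2) X2_def by auto
      show "\<And>y y'. y \<in> X2 \<Longrightarrow> y' \<in> X2 \<Longrightarrow> y < y' \<Longrightarrow> R y \<le> y' \<or> R y' \<le> R y"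
        using less.prems(3) X2_def by auto
      show "R x \<le> v" using less.prems(2) x by auto
    qed (use X in auto)
    obtain k where k: "R x - x = of_int k" using less.prems(2) x(1) by (auto elim: Ints_cases)
    have k1: "k \<ge> 1" using less.prems(2)[OF x(1)] k by simp
    have 1: "real (card X1) \<le> R x - x - 1"
    proof (cases "X1 = {}")
      case True then show ?thesis using k k1 by simp
    next
      case F: False
      define y where "y = Min X1"
      have y: "y \<in> X1" "\<And>t. t \<in> X1 \<Longrightarrow> y \<le> t" using F X by (auto simp: y_def)
      have "real (card X1) \<le> R x - y"
      proof (rule less.hyps)
        show "card X1 < card X" using card by simp
        show "\<And>t. t \<in> X1 \<Longrightarrow> R t - t \<in> \<int> \<and> t < R t \<and> y \<le> t \<and> R t \<le> R x"
        proof -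
          fix t assume t: "t \<in> X1"
          then have "t \<in> X" "x < t" "t < R x" by (auto simp: X1_def)
          then show "R t - t \<in> \<int> \<and> t < R t \<and> y \<le> t \<and> R t \<le> R x"
            using less.prems(2)[of t] less.prems(3)[of x t] x(1) y(2)[OF t] by linarith
        qed
        show "\<And>y y'. y \<in> X1 \<Longrightarrow> y' \<in> X1 \<Longrightarrow> y < y' \<Longrightarrow> R y \<le> y' \<or> R y' \<le> R y"
          using less.prems(3) X1_def by auto
        show "y \<le> R x" using y X1_def by auto
      qed (use X in auto)
      also have "\<dots> < of_int k" using y k X1_def by auto
      finally have "int (card X1) < k" by linarith
      then show ?thesis using k by linarith
    qed
    have "u \<le> x" using less.prems(2) x by auto
    then show ?thesis using 1 2 card by simp
  qed (use less.prems in auto)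
qed

text \<open>Each set is cut into intervals between consecutive points, one for each non-maximal
  point. Unlinkedness makes intervals of different sets nested or non-overlapping, and after scaling
  by \<open>d\<close> their lengths are integers, so \<open>laminar_integral_card\<close> counts
  them. Strictness comes from all points lying below 1.\<close>

lemma fibre_count:
  fixes Q :: "'i \<Rightarrow> real set" and d :: nat
  assumes "finite I" "d > 0"
    and Q: "\<And>i. i \<in> I \<Longrightarrow> finite (Q i) \<and> Q i \<subseteq> {0..<1}"
    and fib: "\<And>i p q. i \<in> I \<Longrightarrow> p \<in> Q i \<Longrightarrow> q \<in> Q i \<Longrightarrow> frac (real d * p) = frac (real d * q)"
    and dis: "\<And>i j. i \<in> I \<Longrightarrow> j \<in> I \<Longrightarrow> i \<noteq> j \<Longrightarrow> Q i \<inter> Q j = {} \<and> unlinked (Q i) (Q j)"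
  shows "(\<Sum>i\<in>I. card (Q i) - 1) < d"
proof -
  define X where "X = (\<Union>i\<in>I. Q i - {Max (Q i)})"
  \<comment> \<open>Disjointness makes the index unique, so \<open>R x\<close> is the successor of
    \<open>x\<close> within its own set.\<close>
  define R where "R = (\<lambda>x. Min {y. \<exists>i\<in>I. x \<in> Q i \<and> y \<in> Q i \<and> x < y})"
  have finX: "finite X" using assms(1) Q by (auto simp: X_def)
  have card: "card X = (\<Sum>i\<in>I. card (Q i) - 1)"
  proof -
    have "card X = (\<Sum>i\<in>I. card (Q i - {Max (Q i)}))"
      unfolding X_def
    proof (rule card_UN_disjoint)
      show "\<forall>i\<in>I. \<forall>j\<in>I. i \<noteq> j \<longrightarrow> (Q i - {Max (Q i)}) \<inter> (Q j - {Max (Q j)}) = {}"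
        using dis by blast
    qed (use assms(1) Q in auto)
    also have "\<dots> = (\<Sum>i\<in>I. card (Q i) - 1)"
    proof (rule sum.cong)
      fix i assume "i \<in> I"
      then show "card (Q i - {Max (Q i)}) = card (Q i) - 1"
        by (cases "Q i = {}") (use Q in \<open>auto simp: card_Diff_singleton\<close>)
    qed simp
    finally show ?thesis .
  qed
  have R: "\<exists>i\<in>I. x \<in> Q i \<and> R x \<in> Q i \<and> x < R x \<and> (\<forall>y\<in>Q i. x < y \<longrightarrow> R x \<le> y)"
    if xX: "x \<in> X" for x
  proof -
    obtain i where i: "i \<in> I" "x \<in> Q i" "x \<noteq> Max (Q i)" using xX by (auto simp: X_def)
    have eq: "{y. \<exists>i\<in>I. x \<in> Q i \<and> y \<in> Q i \<and> x < y} = {y\<in>Q i. x < y}"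
      using i dis by blast
    have "Max (Q i) \<in> {y\<in>Q i. x < y}" using i Q by (auto simp: order.order_iff_strict intro!: Max_in)
         (metis Max_ge order.order_iff_strict)
    then have "R x \<in> {y\<in>Q i. x < y}" unfolding R_def eq
      using Q i by (intro Min_in) auto
    moreover have "\<forall>y\<in>Q i. x < y \<longrightarrow> R x \<le> y" unfolding R_def eq using Q i by auto
    ultimately show ?thesis using i by blast
  qed
  define X' where "X' = (\<lambda>x. d * x) ` X"
  define R' where "R' = (\<lambda>x. d * R (x / d))"
  have R': "R' (d * x) = d * R x" for x :: real using assms(2) by (simp add: R'_def)
  have c': "card X' = card X" unfolding X'_def using assms(2) by (intro card_image inj_onI) simp
  show ?thesis
  proof (cases "X = {}")
    case False
    define v where "v = Max (R ` X)"
    have vR: "R x \<le> v" if "x \<in> X" for x using that finX by (auto simp: v_def)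
    have "v \<in> R ` X" unfolding v_def using finX False by (intro Max_in) auto
    then obtain x0 where x0: "x0 \<in> X" "v = R x0" by auto
    have v1: "v < 1" "0 \<le> v" using R[OF x0(1)] Q x0(2) by force+
    have "real (card X') \<le> d * v - 0"
    proof (rule laminar_integral_card[where R = R'])
      show "finite X'" using finX X'_def by auto
      show "R' x - x \<in> \<int> \<and> x < R' x \<and> 0 \<le> x \<and> R' x \<le> d * v" if xX: "x \<in> X'" for x
      proof -
        obtain t :: real where t: "t \<in> X" "x = d * t" using xX X'_def by auto
        obtain i where i: "i \<in> I" "t \<in> Q i" "R t \<in> Q i" "t < R t" using R t by blast
        have "frac (d * R t) = frac (d * t)" using fib i by blast
        then have "d * R t - d * t \<in> \<int>" by (simp add: frac_eq_iff_diff_Ints)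
        then show ?thesis using t i Q[OF i(1)] vR[OF t(1)] assms(2) R' by (auto simp: subset_iff)
      qed
      show "R' x \<le> x' \<or> R' x' \<le> R' x" if xx: "x \<in> X'" "x' \<in> X'" "x < x'" for x x'
      proof -
        obtain t t' :: real where t: "t \<in> X" "x = d * t" "t' \<in> X" "x' = d * t'" using xx X'_def by auto
        have tt: "t < t'" using xx t assms(2) by simp
        obtain i where i: "i \<in> I" "t \<in> Q i" "R t \<in> Q i" "t < R t" "\<forall>y\<in>Q i. t < y \<longrightarrow> R t \<le> y" using R t by blast
        obtain j where j: "j \<in> I" "t' \<in> Q j" "R t' \<in> Q j" "t' < R t'" using R t by blast
        have "R t \<le> t' \<or> R t' \<le> R t"
        proof (rule ccontr)
          assume n: "\<not> (R t \<le> t' \<or> R t' \<le> R t)"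
          \<comment> \<open>Crossing intervals cannot come from one set, since \<open>R t\<close> is
            the next point of its set after \<open>t\<close>.\<close>
          have "i \<noteq> j" using i j n tt by auto
          then have u: "unlinked (Q i) (Q j)" using dis i j by auto
          have b: "0 \<le> t" "R t' < 1" using i j Q by force+
          have "frac (t' - t) = t' - t" "frac (R t - t) = R t - t" "frac (R t' - R t) = R t' - R t"
            using n tt b j i by (auto simp: frac_eq)
          moreover have "frac (t - R t) = 1 + t - R t"
            using n tt b j i by (subst frac_unique_iff) (auto simp: )
          ultimately have "in_arc t t' (R t)" "in_arc (R t) (R t') t"
            unfolding in_arc_def using n tt b i j by auto
          then show False using u i j unfolding unlinked_def by blast
        qed
        then show ?thesis using t R' assms(2) by auto
      qed
      show "0 \<le> d * v" using v1 by simp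
    qed
    also have "d * v - 0 < d" using v1 assms(2) by simp
    finally show ?thesis using c' card by linarith
  qed (use card assms(2) in auto)
qed


lemma in_arc_total:
  assumes "x \<in> {0..<1}" "y \<in> {0..<1}" "t \<in> {0..<1}" "x \<noteq> y" "t \<noteq> x" "t \<noteq> y"
  shows "in_arc x t y \<or> in_arc y t x"
  using assms by (auto simp: in_arc_unit)

lemma unlinked_one_side:
  assumes "X \<subseteq> {0..<1}" "Y \<subseteq> {0..<1}" "X \<inter> Y = {}" "unlinked X Y" "x \<in> X" "y \<in> X" "x \<noteq> y"
  shows "(\<forall>t\<in>Y. in_arc x t y) \<or> (\<forall>t\<in>Y. in_arc y t x)"
proof -
  have "in_arc x t y \<or> in_arc y t x" if "t \<in> Y" for t
    using that assms by (intro in_arc_total) auto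
  then show ?thesis using assms unfolding unlinked_def by blast
qed

text \<open>Seen from \<open>p\<close>, the gap of the last point \<open>e\<close> goes around the
  rest of the circle, while the gap after any other point ends no later than \<open>e\<close> and
  stays inside the arc.\<close>

lemma gaps_in_arc:
  assumes "finite X" "X \<noteq> {}" "X \<subseteq> {0..<1}"
    and "\<And>t. t \<in> X \<Longrightarrow> in_arc p t q"
    and "\<And>a. a \<in> X \<Longrightarrow> nx a \<in> X \<and> nx a \<noteq> a"
    and "\<And>a c. a \<in> X \<Longrightarrow> c \<in> X \<Longrightarrow> \<not> in_arc a c (nx a)"
  obtains e where "e \<in> X" "1 - frac (q - p) < frac (nx e - e)"
    "\<And>a. a \<in> X \<Longrightarrow> a \<noteq> e \<Longrightarrow> frac (nx a - a) < frac (q - p)"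
proof -
  obtain e where e: "e \<in> X" "\<And>a. a \<in> X \<Longrightarrow> frac (a - p) \<le> frac (e - p)"
  proof -
    let ?M = "Max ((\<lambda>a. frac (a - p)) ` X)"
    have "?M \<in> (\<lambda>a. frac (a - p)) ` X" using assms(1,2) by (intro Max_in) auto
    then obtain e where "e \<in> X" "?M = frac (e - p)" by auto
    moreover have "frac (a - p) \<le> ?M" if "a \<in> X" for a using assms(1) that by (intro Max_ge) auto
    ultimately show ?thesis using that by metis
  qed
  have ne: "frac (a - p) \<noteq> frac (b - p)" if "a \<in> X" "b \<in> X" "a \<noteq> b" for a b
  proof
    assume "frac (a - p) = frac (b - p)"
    then have "frac (b - a) = 0" by (subst frac_diff_base[of _ _ p]) simp
    moreover have "a \<in> {0..<1}" "b \<in> {0..<1}" using that assms(3) by auto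
    ultimately show False using that(3) by (simp only: frac_diff_unit split: if_splits) auto
  qed
  show thesis
  proof
    show "e \<in> X" by fact
    show "1 - frac (q - p) < frac (nx e - e)"
      using e(2)[of "nx e"] ne[of "nx e" e] assms(4)[of e] assms(4)[of "nx e"] assms(5)[OF e(1)] e(1)
      unfolding in_arc_def frac_diff_base[of "nx e" e p] by (auto simp del: frac_gt_0_iff)
    show "frac (nx a - a) < frac (q - p)" if "a \<in> X" "a \<noteq> e" for a
    proof -
      have "frac (e - a) = frac (e - p) - frac (a - p)" "frac (a - p) \<noteq> frac (e - p)"
        using e(2)[of a] ne[of a e] that e(1) by (auto simp: frac_diff_base[of e a p])
      moreover have "frac (a - p) > 0" "frac (e - p) < frac (q - p)"
        using assms(4)[of a] assms(4)[of e] that e by (auto simp: in_arc_def)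
      moreover have "\<not> (0 < frac (e - a) \<and> frac (e - a) < frac (nx a - a))"
        using assms(6) that e unfolding in_arc_def by blast
      ultimately show ?thesis using e(2)[OF that(1)] by linarith
    qed
  qed
qed

section \<open>Shortening a gap to a chord inside a fibre\<close>

text \<open>The endpoint \<open>y\<close> is moved back to the nearest point with the same image as \<open>x\<close>.\<close>

definition crit_chord :: "nat \<Rightarrow> real \<Rightarrow> real \<Rightarrow> real set" where
  "crit_chord d x y = {x, frac (y - frac (real d * (y - x)) / d)}"

lemma frac_mult_frac: "frac (real d * frac x) = frac (real d * x)"
proof -
  have "real d * frac x - real d * x = of_int (- int d * floor x)" by (simp add: frac_def algebra_simps)
  then show ?thesis unfolding frac_eq_iff_diff_Ints by (metis Ints_of_int)
qed

text \<open>Splitting \<open>d * frac (y - x)\<close> into integer and fractional part shows that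
  the shortened chord spans a whole number of steps \<open>1 / d\<close>, hence collapses under
  multiplication by \<open>d\<close>.\<close>

lemma crit_chord_floor:
  assumes "d > 0"
  shows "frac (frac (y - frac (real d * (y - x)) / d) - x) = of_int \<lfloor>real d * frac (y - x)\<rfloor> / d"
proof -
  have *: "frac (real d * (y - x)) = real d * frac (y - x) - of_int \<lfloor>real d * frac (y - x)\<rfloor>"
    by (subst frac_mult_frac[symmetric]) (simp add: frac_def)
  have "frac (frac (y - frac (real d * (y - x)) / d) - x) = frac ((y - x) - frac (real d * (y - x)) / d)"
    by (simp add: frac_diff_frac algebra_simps)
  also have "\<dots> = frac (frac (y - x) - frac (real d * (y - x)) / d)"
    by (simp add: frac_diff_frac)
  also have "frac (y - x) - frac (real d * (y - x)) / d = of_int \<lfloor>real d * frac (y - x)\<rfloor> / d"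
    using assms unfolding * by (simp add: field_simps)
  also have "frac \<dots> = \<dots>"
  proof (subst frac_eq, safe)
    show "0 \<le> of_int \<lfloor>real d * frac (y - x)\<rfloor> / real d"
      by (simp add: frac_ge_0)
    have "of_int \<lfloor>real d * frac (y - x)\<rfloor> \<le> real d * frac (y - x)" by simp
    also have "\<dots> < d * 1" using assms by (simp add: frac_lt_1)
    finally show "of_int \<lfloor>real d * frac (y - x)\<rfloor> / real d < 1" using assms by (simp add: field_simps)
  qed
  finally show ?thesis .
qed

lemma crit_chord_fibre:
  assumes "d > 0" "t \<in> crit_chord d x y" shows "frac (real d * t) = frac (real d * x)"
proof -
  have "frac (real d * (t - x)) = 0" if "t = frac (y - frac (real d * (y - x)) / d)"
    using assms that crit_chord_floor[OF assms(1), of y x] frac_mult_frac[of d "t - x"] by simp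
  then show ?thesis using assms by (auto simp: crit_chord_def frac_eq_iff_diff_Ints right_diff_distrib)
qed

lemma crit_chord_unit: "x \<in> {0..<1} \<Longrightarrow> crit_chord d x y \<subseteq> {0..<1}"
  by (auto simp: crit_chord_def frac_lt_1)

text \<open>A span above \<open>1 / d\<close> keeps at least one full step after rounding down, so
  the chord is not degenerate.\<close>

lemma card_crit_chord:
  assumes "d > 0" "1 / d < frac (y - x)" shows "card (crit_chord d x y) = 2"
proof -
  have "1 < real d * frac (y - x)" using assms by (simp add: field_simps)
  then have "1 \<le> \<lfloor>real d * frac (y - x)\<rfloor>" by linarith
  then have "frac (frac (y - frac (real d * (y - x)) / d) - x) > 0"
    unfolding crit_chord_floor[OF assms(1)] using assms(1) by simp
  then have "frac (y - frac (real d * (y - x)) / d) \<noteq> x" by (auto simp del: frac_gt_0_iff)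
  then show ?thesis by (auto simp: crit_chord_def)
qed

text \<open>Only points between the new endpoint and \<open>y\<close> change sides when
  \<open>y\<close> is moved back. Their images run from that of \<open>x\<close> to that of
  \<open>y\<close>, and the last hypothesis keeps the images of \<open>S\<close> out of this
  arc.\<close>

lemma crit_chord_unlinked:
  assumes "d > 0" "unlinked {x, y} S"
    and "\<And>s. s \<in> S \<Longrightarrow> in_arc (frac (real d * y)) (frac (real d * s)) (frac (real d * x))"
  shows "unlinked (crit_chord d x y) S"
proof -
  let ?y = "frac (y - frac (real d * (y - x)) / d)"
  let ?k = "\<lfloor>real d * frac (y - x)\<rfloor>"
  note fl = crit_chord_floor[OF assms(1), of y x]
  have xx: "frac (x - x) = 0" by simp
  have main: False if st: "s \<in> S" "t \<in> S" "in_arc x s ?y" "in_arc ?y t x" for s t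
  proof -
    have s: "0 < frac (s - x)" "frac (s - x) < ?k / d" using st(3) fl by (auto simp: in_arc_def)
    have kd: "?k / d \<le> frac (y - x)" using assms(1) by (simp add: field_simps)
    have t: "?k / d < frac (t - x)"
      using st(4) s fl frac_ge_0[of "t - x"] xx unfolding in_arc_def frac_diff_base[of t ?y x] frac_diff_base[of x ?y x]
      by (smt (verit))
    have "frac (y - x) < frac (t - x)"
    proof (rule ccontr)
      assume "\<not> frac (y - x) < frac (t - x)"
      then have le: "real d * frac (t - x) \<le> real d * frac (y - x)" by (simp add: mult_left_mono)
      have gt: "?k < real d * frac (t - x)" using t assms(1) by (simp add: field_simps)
      \<comment> \<open>Between the new endpoint and \<open>y\<close> the integer part is constant,
        so taking images preserves the order.\<close>
      have "\<lfloor>real d * frac (t - x)\<rfloor> = ?k" using le gt by linarith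
      then have "frac (real d * frac (t - x)) \<le> frac (real d * frac (y - x))" using le by (simp add: frac_def)
      then have "frac (real d * t - real d * x) \<le> frac (real d * y - real d * x)"
        by (simp add: frac_mult_frac right_diff_distrib)
      moreover have "in_arc (real d * y) (real d * t) (real d * x)" using assms(3)[OF st(2)] by (simp add: in_arc_frac)
      ultimately show False
        using frac_ge_0[of "real d*t-real d*x"] frac_lt_1[of "real d*y-real d*x"]
        unfolding in_arc_def frac_diff_base[of "real d*t" "real d*y" "real d*x"] frac_diff_base[of "real d*x" "real d*y" "real d*x"]
        by (auto split: if_splits simp del: frac_gt_0_iff frac_ge_0)
    qed
    then have "in_arc x s y" "in_arc y t x"
      using s kd frac_lt_1[of "t - x"] unfolding in_arc_def frac_diff_base[of t y x] frac_diff_base[of x y x]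
      by (auto simp del: frac_gt_0_iff)
    then show False using assms(2) st by (auto simp: unlinked_def)
  qed
  have "\<not> in_arc p s p" for p s by (simp add: in_arc_def not_less del: frac_gt_0_iff)
  then show ?thesis using main unfolding unlinked_def crit_chord_def by blast
qed

text \<open>Neighbouring gaps may share an endpoint. Each chord is strictly shorter than its gap
  because the images of the gap's endpoints differ, so it lies in a half-open arc and the shared
  endpoint belongs to one chord only.\<close>

lemma crit_chords_of_gaps_unlinked:
  assumes "d > 0" "x \<in> {0..<1}" "y \<in> {0..<1}" "x' \<in> {0..<1}" "y' \<in> {0..<1}" "x \<noteq> x'"
    and "\<not> in_arc x x' y" "\<not> in_arc x y' y" "\<not> in_arc x' x y'" "x \<noteq> y" "x' \<noteq> y'" "frac (real d * (y - x)) \<noteq> 0"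
      "frac (real d * (y' - x')) \<noteq> 0"
  shows "crit_chord d x y \<inter> crit_chord d x' y' = {} \<and> unlinked (crit_chord d x y) (crit_chord d x' y')"
proof -
  let ?y = "frac (y - frac (real d * (y - x)) / d)" and ?y' = "frac (y' - frac (real d * (y' - x')) / d)"
  have chord: "frac (frac (y - frac (real d * (y - x)) / d) - x) < frac (y - x)"
    if "frac (real d * (y - x)) \<noteq> 0" for x y
  proof -
    have "frac (real d * frac (y - x)) > 0"
      using that frac_ge_0[of "real d * (y - x)"] by (simp add: frac_mult_frac)
    then show ?thesis unfolding crit_chord_floor[OF assms(1)]
      using assms(1) by (simp add: field_simps frac_def)
  qed
  have 1: "frac (?y - x) < frac (y - x)" and 2: "frac (?y' - x') < frac (y' - x')"
    using chord assms(12,13) by auto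
  have pos: "frac (x' - x) > 0" "frac (y - x) > 0" "frac (y' - x') > 0" 
    using assms by (auto simp: frac_diff_unit)
  have x': "frac (y - x) \<le> frac (x' - x)" using assms(7) pos unfolding in_arc_def by auto
  have y': "frac (y' - x) = 0 \<or> frac (x' - x) < frac (y' - x)"
    using assms(9) frac_ge_0[of "y' - x"] frac_ge_0[of "x' - x"] pos frac_lt_1[of "x' - x"]
    unfolding in_arc_def frac_diff_base[of x x' x] frac_diff_base[of y' x' x]
    by (auto split: if_splits)
  have Y': "frac (x' - x) \<le> frac (?y' - x)"
    using 2 y' pos frac_ge_0[of "?y' - x"] frac_lt_1[of "?y' - x"] frac_lt_1[of "y' - x"]
    unfolding frac_diff_base[of ?y' x' x] frac_diff_base[of y' x' x]
    by (smt (verit))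
  have S: "frac (y - x) \<le> frac (s - x)" if "s \<in> crit_chord d x' y'" for s
    using that x' Y' by (auto simp: crit_chord_def)
  show ?thesis
  proof
    have "unlinked {x, ?y} (crit_chord d x' y')"
    proof -
      have "\<not> in_arc p s p" for p s by (simp add: in_arc_def not_less del: frac_gt_0_iff)
      moreover have "\<not> in_arc x s ?y" if "s \<in> crit_chord d x' y'" for s
        using S[OF that] 1 by (auto simp: in_arc_def)
      ultimately show ?thesis by (auto simp: unlinked_def)
    qed
    then show "unlinked (crit_chord d x y) (crit_chord d x' y')" by (simp add: crit_chord_def)
    have "?y \<noteq> s" "x \<noteq> s" if "s \<in> crit_chord d x' y'" for s
      using S[OF that] 1 pos by (auto simp del: frac_gt_0_iff)
    then show "crit_chord d x y \<inter> crit_chord d x' y' = {}" by (auto simp: crit_chord_def)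
  qed
qed


section \<open>Wandering gaps\<close>

text \<open>Elements of \<open>B\<close> are labels followed through time, \<open>P k a\<close>
  being the position of label \<open>a\<close> at time \<open>k\<close>. As \<open>nx\<close> does
  not depend on \<open>k\<close>, a gap keeps its label.\<close>

locale wandering_gaps =
  fixes d :: nat and P :: "nat \<Rightarrow> real \<Rightarrow> real" and B :: "real set" and nx :: "real \<Rightarrow> real"
  assumes d2: "d \<ge> 2" and fin: "finite B" and card3: "card B \<ge> 3"
    and P_unit: "\<And>k. P k ` B \<subseteq> {0..<1}"
    and P_Suc: "\<And>k a. a \<in> B \<Longrightarrow> P (Suc k) a = frac (real d * P k a)"
    and P_inj: "\<And>k. inj_on (P k) B"
    and nx_in: "\<And>a. a \<in> B \<Longrightarrow> nx a \<in> B"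
    and nx_ne: "\<And>a. a \<in> B \<Longrightarrow> nx a \<noteq> a"
    and nx_gap: "\<And>k a c. a \<in> B \<Longrightarrow> c \<in> B \<Longrightarrow> \<not> in_arc (P k a) (P k c) (P k (nx a))"
    and disj: "\<And>k l. k \<noteq> l \<Longrightarrow> P k ` B \<inter> P l ` B = {}"
    and unl: "\<And>k l. k \<noteq> l \<Longrightarrow> unlinked (P k ` B) (P l ` B)"
begin

definition gap :: "nat \<Rightarrow> real \<Rightarrow> real" where
  "gap k a = frac (P k (nx a) - P k a)"

definition chord :: "nat \<Rightarrow> real \<Rightarrow> real set" where
  "chord k a = crit_chord d (P k a) (P k (nx a))"

definition contains :: "nat \<Rightarrow> real \<Rightarrow> nat \<Rightarrow> bool" where
  "contains k a l \<longleftrightarrow> (\<forall>t\<in>B. in_arc (P k a) (P l t) (P k (nx a)))"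

text \<open>Gaps of one set never overlap, hence the simple form for \<open>k = l\<close>. Otherwise
  both endpoints of each gap lie strictly beyond the other gap, the form in which
  \<open>crit_chord_unlinked\<close> takes its last hypothesis.\<close>

definition apart :: "nat \<Rightarrow> real \<Rightarrow> nat \<Rightarrow> real \<Rightarrow> bool" where
  "apart k a l b \<longleftrightarrow> (if k = l then a \<noteq> b else
     in_arc (P k (nx a)) (P l b) (P k a) \<and> in_arc (P k (nx a)) (P l (nx b)) (P k a) \<and>
     in_arc (P l (nx b)) (P k a) (P l b) \<and> in_arc (P l (nx b)) (P k (nx a)) (P l b))"

definition mostly_short :: "nat \<Rightarrow> real \<Rightarrow> bool" where
  "mostly_short k \<epsilon> \<longleftrightarrow> (\<exists>e\<in>B. \<forall>a\<in>B. a \<noteq> e \<longrightarrow> gap k a < \<epsilon>)"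

lemma d_pos: "d > 0" using d2 by simp

lemma P_in: "a \<in> B \<Longrightarrow> P k a \<in> {0..<1}" using P_unit by blast

lemma P_eq_iff: "a \<in> B \<Longrightarrow> b \<in> B \<Longrightarrow> P k a = P k b \<longleftrightarrow> a = b"
  using P_inj by (auto dest: inj_onD)

lemma frac_P_pos: "a \<in> B \<Longrightarrow> b \<in> B \<Longrightarrow> a \<noteq> b \<Longrightarrow> 0 < frac (P k a - P k b)"
  using P_in[of a k] P_in[of b k] P_eq_iff[of a b k] by (auto simp: frac_diff_unit simp del: frac_gt_0_iff)

lemma gap_pos: "a \<in> B \<Longrightarrow> 0 < gap k a"
  unfolding gap_def using frac_P_pos nx_in nx_ne by metis

lemma gap_le: "a \<in> B \<Longrightarrow> c \<in> B \<Longrightarrow> a \<noteq> c \<Longrightarrow> gap k a \<le> frac (P k c - P k a)"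
  using nx_gap[of a c k] frac_P_pos[of c a k] unfolding in_arc_def gap_def by auto

lemma frac_P_Suc: "a \<in> B \<Longrightarrow> b \<in> B \<Longrightarrow> frac (P (Suc k) b - P (Suc k) a) = frac (real d * frac (P k b - P k a))"
  by (simp add: P_Suc frac_diff_frac frac_mult_frac right_diff_distrib)

lemma gap_Suc: "a \<in> B \<Longrightarrow> gap (Suc k) a = frac (real d * gap k a)"
  unfolding gap_def using frac_P_Suc nx_in by metis

text \<open>A gap of exactly \<open>1 / d\<close> would collapse in the next step, but distinct
  labels never meet.\<close>

lemma gap_ne: "a \<in> B \<Longrightarrow> gap k a \<noteq> 1 / d"
  using gap_pos[of a "Suc k"] gap_Suc[of a k] d_pos by auto

lemma gap_Suc_small:
  assumes "a \<in> B" "gap k a < 1 / d" shows "gap (Suc k) a = d * gap k a"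
proof -
  have "d * gap k a < 1" using assms d_pos by (simp add: field_simps)
  then show ?thesis using gap_Suc[OF assms(1)] gap_pos[OF assms(1), of k] by (simp add: frac_eq)
qed

lemma gap_iterate:
  assumes "a \<in> B" "\<And>j. j < n \<Longrightarrow> gap (k + j) a < 1 / d" shows "gap (k + n) a = d ^ n * gap k a"
  using assms(2)
proof (induction n)
  case (Suc n)
  have "gap (k + Suc n) a = d * gap (k + n) a"
    using gap_Suc_small[OF assms(1), of "k + n"] Suc.prems[of n] by simp
  then show ?case using Suc by simp
qed simp

text \<open>On an arc shorter than \<open>1 / d\<close> multiplication by \<open>d\<close> is
  injective and preserves the order, so nothing leaves the gap.\<close>

lemma contains_Suc:
  assumes "a \<in> B" "contains k a l" "gap k a < 1 / d" shows "contains (Suc k) a (Suc l)"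
  unfolding contains_def
proof
  fix t assume t: "t \<in> B"
  let ?u = "frac (P l t - P k a)"
  have u: "0 < ?u" "?u < gap k a"
    using assms(2) t unfolding contains_def in_arc_def gap_def by auto
  have "frac (P (Suc l) t - P (Suc k) a) = frac (d * ?u)"
    by (simp add: P_Suc assms(1) t frac_diff_frac frac_mult_frac right_diff_distrib)
  also have "\<dots> = d * ?u"
  proof -
    have "d * ?u < d * (1 / d)" using u assms(3) d_pos by (intro mult_strict_left_mono) auto
    then show ?thesis using d_pos by (simp add: frac_eq)
  qed
  finally have "frac (P (Suc l) t - P (Suc k) a) = d * ?u" .
  moreover have "d * ?u < gap (Suc k) a" "0 < d * ?u" using gap_Suc_small[OF assms(1,3)] u d_pos by auto
  ultimately show "in_arc (P (Suc k) a) (P (Suc l) t) (P (Suc k) (nx a))"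
    unfolding in_arc_def gap_def by simp
qed

lemma contains_iterate:
  assumes "a \<in> B" "contains k a l" "\<And>j. j < n \<Longrightarrow> gap (k + j) a < 1 / d"
  shows "contains (k + n) a (l + n)"
  using assms(3)
proof (induction n)
  case (Suc n)
  then show ?case using contains_Suc[OF assms(1), of "k + n" "l + n"] by simp
qed (use assms in simp)

text \<open>One short gap thus makes every set inside it mostly short, whether that set is earlier
  or later.\<close>

lemma contains_short:
  assumes "a \<in> B" "contains k a l"
  shows "\<exists>e\<in>B. 1 - gap k a < gap l e \<and> (\<forall>c\<in>B. c \<noteq> e \<longrightarrow> gap l c < gap k a)"
proof -
  define iv where "iv = the_inv_into B (P l)"
  have iv: "iv (P l c) = c" if "c \<in> B" for c unfolding iv_def using the_inv_into_f_f[OF P_inj that] .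
  obtain e where e: "e \<in> P l ` B" "1 - frac (P k (nx a) - P k a) < frac (P l (nx (iv e)) - e)"
    "\<And>c. c \<in> P l ` B \<Longrightarrow> c \<noteq> e \<Longrightarrow> frac (P l (nx (iv c)) - c) < frac (P k (nx a) - P k a)"
  proof (rule gaps_in_arc[of "P l ` B" "P k a" "P k (nx a)" "\<lambda>x. P l (nx (iv x))"])
    show "\<And>t. t \<in> P l ` B \<Longrightarrow> in_arc (P k a) t (P k (nx a))" using assms by (auto simp: contains_def)
    show "P l (nx (iv c)) \<in> P l ` B \<and> P l (nx (iv c)) \<noteq> c" if "c \<in> P l ` B" for c
      using that iv nx_in nx_ne P_eq_iff by auto
    show "\<not> in_arc b c (P l (nx (iv b)))" if "b \<in> P l ` B" "c \<in> P l ` B" for b c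
      using that iv nx_gap by auto
  qed (use fin P_unit assms in auto)
  from e(1) obtain e' where e': "e' \<in> B" "e = P l e'" by auto
  have "1 - gap k a < gap l e'" using e(2) e' iv by (simp add: gap_def)
  moreover have "gap l c < gap k a" if "c \<in> B" "c \<noteq> e'" for c
    using e(3)[of "P l c"] that e' iv P_eq_iff by (auto simp: gap_def)
  ultimately show ?thesis using e'(1) by blast
qed

text \<open>By unlinkedness each set lies entirely inside or entirely beyond a gap of the other. If
  neither gap contains the other set, both sets lie beyond.\<close>

lemma contains_or_apart:
  assumes "a \<in> B" "b \<in> B" "k = l \<Longrightarrow> a \<noteq> b"
  shows "apart k a l b \<or> k \<noteq> l \<and> (contains k a l \<or> contains l b k)"
proof (cases "k = l")
  case True
  then show ?thesis using assms by (simp add: apart_def)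
next
  case False
  have ne: "P k a \<noteq> P k (nx a)" "P l b \<noteq> P l (nx b)" using assms nx_in nx_ne P_eq_iff by metis+
  have "(\<forall>t\<in>P l ` B. in_arc (P k a) t (P k (nx a))) \<or> (\<forall>t\<in>P l ` B. in_arc (P k (nx a)) t (P k a))"
    using assms ne P_unit nx_in disj[OF False] unl[OF False] by (intro unlinked_one_side[of "P k ` B"]) auto
  moreover have "(\<forall>t\<in>P k ` B. in_arc (P l b) t (P l (nx b))) \<or> (\<forall>t\<in>P k ` B. in_arc (P l (nx b)) t (P l b))"
    using assms ne P_unit nx_in disj[of l k] unl[of l k] False by (intro unlinked_one_side[of "P l ` B"]) auto
  ultimately show ?thesis
    using False assms(1,2) nx_in by (auto simp: contains_def apart_def)
qed

lemma finite_chord: "finite (chord k a)"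
  by (simp add: chord_def crit_chord_def)

lemma chord_facts:
  assumes "a \<in> B" "1 / d < gap k a"
  shows "card (chord k a) = 2" "chord k a \<subseteq> {0..<1}"
    "\<And>t. t \<in> chord k a \<Longrightarrow> frac (real d * t) = P (Suc k) a"
  using assms card_crit_chord[OF d_pos] crit_chord_unit[OF P_in[OF assms(1)]] crit_chord_fibre[OF d_pos]
  unfolding chord_def gap_def by (simp_all add: P_Suc)

lemma chord_unlinked:
  assumes "a \<in> B" "unlinked (P k ` B) S"
    and "\<And>s. s \<in> S \<Longrightarrow> in_arc (P (Suc k) (nx a)) (frac (real d * s)) (P (Suc k) a)"
  shows "unlinked (chord k a) S"
  unfolding chord_def
proof (rule crit_chord_unlinked[OF d_pos])
  show "unlinked {P k a, P k (nx a)} S" using assms nx_in by (auto intro: unlinked_mono)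
  show "in_arc (frac (real d * P k (nx a))) (frac (real d * s)) (frac (real d * P k a))" if "s \<in> S" for s
    using assms(3)[OF that] assms(1) nx_in by (simp add: P_Suc)
qed

text \<open>The hypothesis concerns the gaps one step later, because the images decide whether
  shortening is harmless.\<close>

lemma chords_apart:
  assumes "a \<in> B" "b \<in> B" "1 / d < gap k a" "1 / d < gap l b" "apart (Suc k) a (Suc l) b"
  shows "chord k a \<inter> chord l b = {} \<and> unlinked (chord k a) (chord l b)"
proof (cases "k = l")
  case True
  have fr: "frac (real d * (P k (nx c) - P k c)) \<noteq> 0" if "c \<in> B" for c
    using gap_pos[OF that, of "Suc k"] gap_Suc[OF that, of k] unfolding gap_def by (simp add: frac_mult_frac)
  have "a \<noteq> b" using assms(5) True by (simp add: apart_def)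
  then show ?thesis unfolding chord_def True[symmetric]
    using assms P_in nx_in nx_ne nx_ne[symmetric] nx_gap P_eq_iff fr
    by (intro crit_chords_of_gaps_unlinked[OF d_pos]) auto
next
  case False
  then have ap: "in_arc (P (Suc k) (nx a)) (P (Suc l) b) (P (Suc k) a)"
    "in_arc (P (Suc k) (nx a)) (P (Suc l) (nx b)) (P (Suc k) a)"
    "in_arc (P (Suc l) (nx b)) (P (Suc k) a) (P (Suc l) b)"
    using assms(5) by (auto simp: apart_def)
  \<comment> \<open>The chords are shortened one at a time: the first against the full endpoints of
    the second gap, then the second against the finished first chord, both points of which have the
    image \<open>P (Suc k) a\<close>.\<close>
  have "unlinked (chord l b) (chord k a)" unfolding chord_def[of l]
  proof (rule crit_chord_unlinked[OF d_pos unlinked_sym])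
    have "unlinked {P l b, P l (nx b)} {P k a, P k (nx a)}"
      using unl[of l k] False assms nx_in by (auto intro: unlinked_mono)
    then show "unlinked (chord k a) {P l b, P l (nx b)}" unfolding chord_def
      using ap assms nx_in by (intro crit_chord_unlinked[OF d_pos unlinked_sym]) (auto simp: P_Suc)
    show "in_arc (frac (real d * P l (nx b))) (frac (real d * s)) (frac (real d * P l b))"
      if "s \<in> chord k a" for s
      using ap(3) assms nx_in by (simp add: P_Suc[symmetric] chord_facts(3)[OF assms(1,3) that])
  qed
  \<comment> \<open>Each chord has a single image point, and the two image points belong to
    different times.\<close>
  moreover have "P (Suc k) a \<noteq> P (Suc l) b" using disj[of "Suc k" "Suc l"] False assms by auto
  then have "chord k a \<inter> chord l b = {}"
    using chord_facts(3)[OF assms(1,3)] chord_facts(3)[OF assms(2,4)] by fastforce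
  ultimately show ?thesis using unlinked_sym by blast
qed

text \<open>Every long gap contributes its shortened chord, a two-element fibre and hence one
  identification; \<open>fibre_count\<close> is applied to these chords together with the sets
  \<open>Q\<close>. A chord misses \<open>Q j\<close> because its image is an endpoint of the image
  gap, while the images of \<open>Q j\<close> lie strictly beyond.\<close>

theorem event_count:
  assumes I: "finite I" "\<And>i. i \<in> I \<Longrightarrow> a i \<in> B \<and> 1 / d < gap (k i) (a i)"
    and ap: "\<And>i j. i \<in> I \<Longrightarrow> j \<in> I \<Longrightarrow> i \<noteq> j \<Longrightarrow> apart (Suc (k i)) (a i) (Suc (k j)) (a j)"
    and J: "finite J" "\<And>j. j \<in> J \<Longrightarrow> finite (Q j) \<and> Q j \<subseteq> {0..<1}"
    and fib: "\<And>j p q. j \<in> J \<Longrightarrow> p \<in> Q j \<Longrightarrow> q \<in> Q j \<Longrightarrow> frac (real d * p) = frac (real d * q)"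
    and dis: "\<And>i j. i \<in> J \<Longrightarrow> j \<in> J \<Longrightarrow> i \<noteq> j \<Longrightarrow> Q i \<inter> Q j = {} \<and> unlinked (Q i) (Q j)"
    and IJ: "\<And>i j. i \<in> I \<Longrightarrow> j \<in> J \<Longrightarrow> unlinked (P (k i) ` B) (Q j)"
      "\<And>i j s. i \<in> I \<Longrightarrow> j \<in> J \<Longrightarrow> s \<in> Q j \<Longrightarrow>
         in_arc (P (Suc (k i)) (nx (a i))) (frac (real d * s)) (P (Suc (k i)) (a i))"
  shows "card I + (\<Sum>j\<in>J. card (Q j) - 1) < d"
proof -
  define R where "R = case_sum (\<lambda>i. chord (k i) (a i)) Q"
  have mixed: "chord (k i) (a i) \<inter> Q j = {} \<and> unlinked (chord (k i) (a i)) (Q j)" if "i \<in> I" "j \<in> J" for i j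
  proof
    show "unlinked (chord (k i) (a i)) (Q j)" using chord_unlinked IJ I that by blast
    have "\<not> in_arc y x x" for x y by (simp add: in_arc_def)
    then show "chord (k i) (a i) \<inter> Q j = {}"
      using IJ(2)[OF that] I(2)[OF that(1)] chord_facts(3)[of "a i" "k i"] by fastforce
  qed
  have "(\<Sum>i\<in>I <+> J. card (R i) - 1) < d"
  proof (rule fibre_count[OF _ d_pos])
    show "finite (I <+> J)" using I J by simp
    show "finite (R i) \<and> R i \<subseteq> {0..<1}" if "i \<in> I <+> J" for i
    proof (cases i)
      case (Inl i')
      then show ?thesis using that I(2)[of i'] chord_facts(2) finite_chord by (auto simp: R_def)
    qed (use that J(2) in \<open>auto simp: R_def\<close>)
    show "frac (real d * p) = frac (real d * q)" if "i \<in> I <+> J" "p \<in> R i" "q \<in> R i" for i p q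
    proof (cases i)
      case (Inl x)
      then have "p \<in> chord (k x) (a x)" "q \<in> chord (k x) (a x)" "x \<in> I" using that by (auto simp: R_def)
      then show ?thesis using chord_facts(3)[of "a x" "k x"] I(2)[of x] by simp
    next
      case (Inr x)
      then have "p \<in> Q x" "q \<in> Q x" "x \<in> J" using that by (auto simp: R_def)
      then show ?thesis by (intro fib)
    qed
    show "R i \<inter> R j = {} \<and> unlinked (R i) (R j)" if "i \<in> I <+> J" "j \<in> I <+> J" "i \<noteq> j" for i j
    proof (cases i; cases j)
      fix x y assume xy: "i = Inl x" "j = Inl y"
      then have "x \<in> I" "y \<in> I" "x \<noteq> y" using that by auto
      then have "chord (k x) (a x) \<inter> chord (k y) (a y) = {} \<and> unlinked (chord (k x) (a x)) (chord (k y) (a y))"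
        using chords_apart I(2) ap by blast
      then show ?thesis by (simp add: R_def xy)
    next
      fix x y assume "i = Inl x" "j = Inr y"
      then show ?thesis using that mixed by (auto simp: R_def)
    next
      fix x y assume "i = Inr x" "j = Inl y"
      then show ?thesis using that mixed[of y x] unlinked_sym by (auto simp: R_def)
    next
      fix x y assume "i = Inr x" "j = Inr y"
      then show ?thesis using that dis[of x y] by (auto simp: R_def)
    qed
  qed
  moreover have "(\<Sum>i\<in>I <+> J. card (R i) - 1) = card I + (\<Sum>j\<in>J. card (Q j) - 1)"
    using I J by (simp add: sum.Plus R_def chord_facts(1))
  ultimately show ?thesis by simp
qed

end


section \<open>Existence of short gaps\<close>

text \<open>\<open>q1\<close> falls just after or just before \<open>p1\<close>. In the first case
  the chord from \<open>p1\<close> to \<open>p2\<close> separates \<open>q1\<close> from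
  \<open>q3\<close>, in the second the chord from \<open>p3\<close> to \<open>p1\<close> separates
  \<open>q1\<close> from \<open>q2\<close>. The bounds \<open>1 - \<epsilon>\<close> express
  separation across the point 0 of the circle.\<close>

lemma close_triples_linked:
  fixes p1 p2 p3 q1 q2 q3 :: real
  assumes U: "p1 \<in> {0..<1}" "p2 \<in> {0..<1}" "p3 \<in> {0..<1}" "q1 \<in> {0..<1}" "q2 \<in> {0..<1}" "q3 \<in> {0..<1}"
    and c: "\<bar>p1 - q1\<bar> < \<delta>" "\<bar>p2 - q2\<bar> < \<delta>" "\<bar>p3 - q3\<bar> < \<delta>" and d: "0 < \<delta>" "4 * \<delta> \<le> \<epsilon>"
    and s12: "\<epsilon> \<le> \<bar>p1 - p2\<bar>" "\<bar>p1 - p2\<bar> \<le> 1 - \<epsilon>"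
    and s13: "\<epsilon> \<le> \<bar>p1 - p3\<bar>" "\<bar>p1 - p3\<bar> \<le> 1 - \<epsilon>"
    and s23: "\<epsilon> \<le> \<bar>p2 - p3\<bar>" "\<bar>p2 - p3\<bar> \<le> 1 - \<epsilon>" and nz: "q1 \<noteq> p1"
    and arc: "\<not> in_arc p1 p3 p2"
  shows "in_arc p1 q1 p2 \<or> in_arc p3 q1 p1" "in_arc p2 q3 p1" "in_arc p1 q2 p3"
proof -
  have un: "0 \<le> p1" "0 \<le> p2" "0 \<le> p3" "0 \<le> q1" "0 \<le> q2" "0 \<le> q3" "p1 < 1" "p2 < 1" "p3 < 1"
    "q1 < 1" "q2 < 1" "q3 < 1" using U by auto
  have o: "p1 < p2 \<and> p2 < p3 \<or> p2 < p3 \<and> p3 < p1 \<or> p3 < p1 \<and> p1 < p2"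
    using arc s12 s13 s23 d unfolding in_arc_unit[OF U(1,2,3)] by (smt (verit))
  show "in_arc p1 q1 p2 \<or> in_arc p3 q1 p1"
    unfolding in_arc_unit[OF U(1,2,4)] in_arc_unit[OF U(3,1,4)] using o nz c(1) d s12 s13 by (smt (verit))
  show "in_arc p2 q3 p1"
    unfolding in_arc_unit[OF U(2,1,6)] using o un c(3) d s23 s13 by (smt (verit))
  show "in_arc p1 q2 p3"
    unfolding in_arc_unit[OF U(1,3,5)] using o un c(2) d s23 s12 by (smt (verit))
qed

context wandering_gaps begin

lemma B_ne: "B \<noteq> {}" using card3 by auto

text \<open>If all gaps stayed large, two of the infinitely many disjoint sets would be close to each
  other, and then they would be linked.\<close>

lemma gaps_not_bounded_below:
  assumes "\<epsilon> > 0"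
  shows "\<exists>k. \<exists>a\<in>B. gap k a < \<epsilon>"
proof (rule ccontr)
  assume "\<not> (\<exists>k. \<exists>a\<in>B. gap k a < \<epsilon>)"
  then have ge: "\<epsilon> \<le> gap k a" if "a \<in> B" for k a using that by (meson not_le)
  obtain a1 where a1: "a1 \<in> B" using B_ne by blast
  define a2 where "a2 = nx a1"
  have a2: "a2 \<in> B" "a2 \<noteq> a1" using a1 nx_in nx_ne by (auto simp: a2_def)
  have "card {a1, a2} \<le> 2" by (simp add: card_insert_if)
  then have "\<not> B \<subseteq> {a1, a2}" using card3 card_mono[of "{a1, a2}" B] by force
  then obtain a3 where a3: "a3 \<in> B" "a3 \<noteq> a1" "a3 \<noteq> a2" by blast
  have sep: "\<epsilon> \<le> frac (P k c - P k a)" if "a \<in> B" "c \<in> B" "a \<noteq> c" for k a c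
    using ge[of a k] gap_le[of a c k] that by linarith
  define \<delta> where "\<delta> = min (\<epsilon> / 4) (1/2)"
  have \<delta>: "\<delta> > 0" "4 * \<delta> \<le> \<epsilon>" using assms by (auto simp: \<delta>_def)
  \<comment> \<open>Pigeonhole on a grid of mesh \<open>\<delta>\<close>: at two times all three
    points lie in the same cells.\<close>
  define h where "h = (\<lambda>k. (\<lfloor>P k a1 / \<delta>\<rfloor>, \<lfloor>P k a2 / \<delta>\<rfloor>, \<lfloor>P k a3 / \<delta>\<rfloor>))"
  let ?M = "{0..\<lfloor>1 / \<delta>\<rfloor>}"
  have "\<lfloor>P k a / \<delta>\<rfloor> \<in> ?M" if "a \<in> B" for k a
    using P_in[OF that, of k] \<delta> by (auto intro!: floor_mono divide_right_mono)
  then have "range h \<subseteq> ?M \<times> ?M \<times> ?M" using a1 a2 a3 by (auto simp: h_def)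
  then have "finite (range h)" by (rule finite_subset) simp
  then have "\<not> inj h" using finite_imageD infinite_UNIV_nat by blast
  then obtain k l where kl: "k \<noteq> l" "h k = h l" by (auto simp: inj_def)
  have close: "\<bar>P k a - P l a\<bar> < \<delta>" if "\<lfloor>P k a / \<delta>\<rfloor> = \<lfloor>P l a / \<delta>\<rfloor>" for a
  proof -
    have "\<bar>P k a / \<delta> - P l a / \<delta>\<bar> < 1" using that by linarith
    then have "\<bar>P k a - P l a\<bar> / \<delta> < 1" using \<delta> by (simp add: diff_divide_distrib[symmetric] abs_divide)
    then show ?thesis using \<delta> by simp
  qed
  note close = close[of a1] close[of a2] close[of a3]
  have cl: "\<bar>P k a1 - P l a1\<bar> < \<delta>" "\<bar>P k a2 - P l a2\<bar> < \<delta>" "\<bar>P k a3 - P l a3\<bar> < \<delta>"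
    using kl close by (auto simp: h_def)
  have u: "\<not> (in_arc p s q \<and> in_arc q t p)"
    if "p \<in> {P k a1, P k a2, P k a3}" "q \<in> {P k a1, P k a2, P k a3}" "s \<in> {P l a1, P l a2, P l a3}"
      "t \<in> {P l a1, P l a2, P l a3}" for p q s t
    using unl[OF kl(1)] that a1 a2 a3 unfolding unlinked_def by blast
  have ne: "P k x \<noteq> P l y" if "x \<in> B" "y \<in> B" for x y using disj[OF kl(1)] that by auto
  note units = P_in[OF a1, of k] P_in[OF a2(1), of k] P_in[OF a3(1), of k]
    P_in[OF a1, of l] P_in[OF a2(1), of l] P_in[OF a3(1), of l]
  have sk: "\<epsilon> \<le> \<bar>P k x - P k y\<bar> \<and> \<bar>P k x - P k y\<bar> \<le> 1 - \<epsilon>" if "x \<in> B" "y \<in> B" "x \<noteq> y" for x y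
    using sep[of x y k] sep[of y x k] that P_in[of x k] P_in[of y k] P_eq_iff[of x y k]
    by (auto simp: frac_diff_unit split: if_splits)
  let ?p1 = "P k a1" and ?p2 = "P k a2" and ?p3 = "P k a3"
  let ?q1 = "P l a1" and ?q2 = "P l a2" and ?q3 = "P l a3"
  have gp: "\<not> in_arc ?p1 ?p3 ?p2" using nx_gap[OF a1 a3(1), of k] by (simp add: a2_def)
  have s: "\<epsilon> \<le> \<bar>?p1 - ?p2\<bar>" "\<bar>?p1 - ?p2\<bar> \<le> 1 - \<epsilon>" "\<epsilon> \<le> \<bar>?p1 - ?p3\<bar>" "\<bar>?p1 - ?p3\<bar> \<le> 1 - \<epsilon>"
    "\<epsilon> \<le> \<bar>?p2 - ?p3\<bar>" "\<bar>?p2 - ?p3\<bar> \<le> 1 - \<epsilon>"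
    using sk[OF a1 a2(1)] sk[OF a1 a3(1)] sk[OF a2(1) a3(1)] a2(2) a3(2,3) by metis+
  have "?q1 \<noteq> ?p1" using ne[OF a1 a1] by metis
  note L = close_triples_linked[OF units cl \<delta> s this gp]
  have "\<not> (in_arc ?p1 ?q1 ?p2 \<and> in_arc ?p2 ?q3 ?p1)" by (rule u) auto
  moreover have "\<not> (in_arc ?p3 ?q1 ?p1 \<and> in_arc ?p1 ?q2 ?p3)" by (rule u) auto
  ultimately show False using L by blast
qed

text \<open>Gaps below \<open>1 / d\<close> grow, so every new record minimum is born from a gap
  above \<open>1 / d\<close>. If no time were mostly short, no short gap could contain a set; then
  \<open>d\<close> such births would be pairwise apart, one more than \<open>event_count\<close>
  allows.\<close>

lemma some_mostly_short:
  assumes "0 < \<epsilon>" shows "\<exists>k. mostly_short k \<epsilon>"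
proof (rule ccontr)
  assume no: "\<not> (\<exists>k. mostly_short k \<epsilon>)"
  define Ev where "Ev = {k. \<exists>a\<in>B. 1 / d < gap k a \<and> gap (Suc k) a < \<epsilon>}"
  have "\<exists>k>M. k \<in> Ev" for M
  proof -
    \<comment> \<open>No gap up to time \<open>Suc M\<close> is below \<open>\<eta>\<close>, so the
      first gap below it appears later.\<close>
    define \<eta> where "\<eta> = Min (insert \<epsilon> ((\<lambda>(k, a). gap k a) ` ({..Suc M} \<times> B)))"
    have finS: "finite (insert \<epsilon> ((\<lambda>(k, a). gap k a) ` ({..Suc M} \<times> B)))" using fin by simp
    have "\<eta> > 0" unfolding \<eta>_def using assms gap_pos by (subst Min_gr_iff[OF finS]) auto
    have \<eta>: "\<eta> \<le> \<epsilon>" "\<And>k a. k \<le> Suc M \<Longrightarrow> a \<in> B \<Longrightarrow> \<eta> \<le> gap k a"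
      unfolding \<eta>_def using finS by (auto intro!: Min_le)
    define n where "n = (LEAST n. \<exists>a\<in>B. gap n a < \<eta>)"
    have "\<exists>a\<in>B. gap n a < \<eta>"
      unfolding n_def using gaps_not_bounded_below[OF \<open>\<eta> > 0\<close>] by (rule LeastI_ex)
    then obtain a where a: "a \<in> B" "gap n a < \<eta>" by blast
    have "n > Suc M" using \<eta>(2)[of n a] a by linarith
    then obtain k where k: "n = Suc k" "k > M" by (cases n) auto
    have "gap k a \<ge> \<eta>" using not_less_Least[of k "\<lambda>n. \<exists>a\<in>B. gap n a < \<eta>"] k a(1) n_def by force
    have "\<not> gap k a < 1 / d"
    proof
      assume "gap k a < 1 / d"
      then have "gap n a = d * gap k a" using gap_Suc_small a(1) k by simp
      also have "\<dots> \<ge> 1 * gap k a" using d2 gap_pos[OF a(1), of k] by (intro mult_right_mono) auto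
      finally show False using \<open>gap k a \<ge> \<eta>\<close> a(2) by linarith
    qed
    then have "1 / d < gap k a" using gap_ne[OF a(1), of k] by linarith
    then have "k \<in> Ev" using a k \<eta>(1) unfolding Ev_def by force
    then show ?thesis using k by blast
  qed
  then have "infinite Ev" by (meson infinite_nat_iff_unbounded)
  then obtain I where I: "I \<subseteq> Ev" "finite I" "card I = d" using infinite_arbitrarily_large by blast
  then have "\<forall>k\<in>I. \<exists>a\<in>B. 1 / d < gap k a \<and> gap (Suc k) a < \<epsilon>" by (auto simp: Ev_def)
  then obtain a where a: "\<And>k. k \<in> I \<Longrightarrow> a k \<in> B \<and> 1 / d < gap k (a k) \<and> gap (Suc k) (a k) < \<epsilon>" by metis
  have nocont: "\<not> contains k b l" if "b \<in> B" "gap k b < \<epsilon>" for k b l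
  proof
    have bB: "b \<in> B" using that by blast
    assume "contains k b l"
    from contains_short[OF bB this] obtain e where e: "e \<in> B" "\<forall>c\<in>B. c \<noteq> e \<longrightarrow> gap l c < gap k b" by blast
    have "gap l c < \<epsilon>" if "c \<in> B" "c \<noteq> e" for c
      using e(2) that \<open>gap k b < \<epsilon>\<close> by (meson order.strict_trans)
    then have "mostly_short l \<epsilon>" unfolding mostly_short_def using e(1) by blast
    then show False using no by blast
  qed
  have "card I + (\<Sum>j\<in>({}::nat set). card ((\<lambda>_. {}::real set) j) - 1) < d"
  proof (rule event_count[where k = "\<lambda>k. k" and a = a])
    show "apart (Suc i) (a i) (Suc j) (a j)" if "i \<in> I" "j \<in> I" "i \<noteq> j" for i j
      using contains_or_apart[of "a i" "a j" "Suc i" "Suc j"] a[OF that(1)] a[OF that(2)] that(3) nocont by auto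
  qed (use I a in auto)
  then show False using I by simp
qed

text \<open>The gaps that are short at the first time when all but one of them are short were each born
  from a gap longer than \<open>1 / d\<close>; two of these births cannot be nested, as that
  would contradict either the growth of gaps or the choice of the first time.\<close>

theorem apart_events:
  assumes "0 < \<epsilon>"
  obtains R k where "R \<subseteq> B" "Suc (card R) = card B"
    "\<And>r. r \<in> R \<Longrightarrow> 1 / d < gap (k r) r \<and> gap (Suc (k r)) r < \<epsilon>"
    "\<And>r s. r \<in> R \<Longrightarrow> s \<in> R \<Longrightarrow> r \<noteq> s \<Longrightarrow> apart (Suc (k r)) r (Suc (k s)) s"
proof -
  \<comment> \<open>The initial gaps enter so that a gap below \<open>\<eta>\<close> must have
    exceeded \<open>1 / d\<close> at an earlier time; \<open>1/2\<close> enters so that two gap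
    lengths below \<open>\<eta>\<close> cannot add up to 1.\<close>
  define \<eta> where "\<eta> = Min (insert \<epsilon> (insert (1/2) (gap 0 ` B)))"
  have "\<eta> > 0" unfolding \<eta>_def using assms fin gap_pos by (subst Min_gr_iff) auto
  have \<eta>: "\<eta> \<le> \<epsilon>" "\<eta> \<le> 1/2" "\<And>a. a \<in> B \<Longrightarrow> \<eta> \<le> gap 0 a"
    unfolding \<eta>_def using fin by (intro Min_le; simp)+
  define m where "m = (LEAST m. mostly_short m \<eta>)"
  have m: "mostly_short m \<eta>" unfolding m_def by (rule LeastI_ex[OF some_mostly_short[OF \<open>\<eta> > 0\<close>]])
  have least: "\<not> mostly_short l \<eta>" if "l < m" for l using not_less_Least that unfolding m_def by blast
  obtain e where e: "e \<in> B" "\<And>a. a \<in> B \<Longrightarrow> a \<noteq> e \<Longrightarrow> gap m a < \<eta>" using m by (auto simp: mostly_short_def)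
  define R where "R = B - {e}"
  have R: "R \<subseteq> B" "Suc (card R) = card B" using e fin card3 by (auto simp: R_def card_Diff_singleton)
  have short: "gap m r < \<eta>" if "r \<in> R" for r using e that by (auto simp: R_def)
  have "\<exists>k<m. 1 / d < gap k r \<and> (\<forall>l. k < l \<and> l < m \<longrightarrow> gap l r < 1 / d)" if r: "r \<in> R" for r
  proof -
    have rB: "r \<in> B" using r R by auto
    have "\<exists>k<m. \<not> gap k r < 1 / d"
    proof (rule ccontr)
      assume "\<not> (\<exists>k<m. \<not> gap k r < 1 / d)"
      then have "gap (0 + m) r = d ^ m * gap 0 r" by (intro gap_iterate[OF rB]) auto
      moreover have "d ^ m * gap 0 r \<ge> 1 * gap 0 r" using d2 gap_pos[OF rB, of 0] 
        by (intro mult_right_mono) auto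
      ultimately show False using short[OF r] \<eta>(3)[OF rB] by simp
    qed
    then have ex: "{k. k < m \<and> \<not> gap k r < 1 / d} \<noteq> {}" by blast
    \<comment> \<open>At the last time before \<open>m\<close> with a long gap the final growth
      starts: afterwards the gap is multiplied by \<open>d\<close> in each step up to
      \<open>m\<close>.\<close>
    define k where "k = Max {k. k < m \<and> \<not> gap k r < 1 / d}"
    have k: "k < m" "\<not> gap k r < 1 / d" using Max_in[OF _ ex] by (auto simp: k_def)
    have "gap l r < 1 / d" if "k < l" "l < m" for l
    proof (rule ccontr)
      assume "\<not> gap l r < 1 / d"
      then have "l \<le> k" unfolding k_def using that by (intro Max_ge) auto
      then show False using that by simp
    qed
    moreover have "1 / d < gap k r" using k gap_ne[OF rB, of k] by linarith
    ultimately show ?thesis using k by blast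
  qed
  then obtain k where k: "\<And>r. r \<in> R \<Longrightarrow> k r < m \<and> 1 / d < gap (k r) r \<and> (\<forall>l. k r < l \<and> l < m \<longrightarrow> gap l r < 1 / d)"
    by metis
  have grow: "gap m r = d ^ (m - l) * gap l r" if "r \<in> R" "k r < l" "l \<le> m" for r l
  proof -
    have "gap (l + (m - l)) r = d ^ (m - l) * gap l r"
      using k[OF that(1)] that R by (intro gap_iterate) auto
    then show ?thesis using that by simp
  qed
  have strict: "gap l r < gap m r" if "r \<in> R" "k r < l" "l < m" for r l
  proof -
    have "1 < real d ^ (m - l)" using d2 that by (intro one_less_power) auto
    then have "1 * gap l r < d ^ (m - l) * gap l r"
      using gap_pos[of r l] that R by (intro mult_strict_right_mono) auto
    then show ?thesis using grow[of r l] that by simp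
  qed
  have mono: "gap l r < \<eta>" if "r \<in> R" "k r < l" "l \<le> m" for r l
    using strict[of r l] short[of r] that by (cases "l = m") auto
  \<comment> \<open>Gap \<open>r\<close> is followed until the set inside it reaches time
    \<open>m\<close>; gap \<open>r\<close> is then still at the time \<open>?l < m\<close>. It
    exceeds all gaps at time \<open>m\<close> but one, against its own growth. If the exceptional
    gap is that of \<open>r\<close>, two lengths below \<open>1/2\<close> would add up to more than
    1.\<close>
  have later: "\<not> contains (Suc (k r)) r (Suc (k s))" if "r \<in> R" "s \<in> R" "k r < k s" for r s
  proof
    assume c: "contains (Suc (k r)) r (Suc (k s))"
    let ?n = "m - Suc (k s)" and ?l = "Suc (k r) + (m - Suc (k s))"
    have lt: "?l < m" "k r < ?l" using that k[OF that(2)] by auto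
    have "contains ?l r (Suc (k s) + ?n)"
      using c k[OF that(1)] that R lt by (intro contains_iterate) auto
    then have cm: "contains ?l r m" using k[OF that(2)] by simp
    have rB: "r \<in> B" using that R by blast
    from contains_short[OF rB cm] obtain e' where e': "e' \<in> B" "1 - gap ?l r < gap m e'"
      "\<And>c. c \<in> B \<Longrightarrow> c \<noteq> e' \<Longrightarrow> gap m c < gap ?l r" by blast
    show False
    proof (cases "r = e'")
      case True
      then show False using e'(2) mono[OF that(1) lt(2)] lt(1) short[OF that(1)] \<eta>(2) by simp
    next
      case False
      then show False using e'(3)[OF rB] strict[OF that(1) lt(2,1)] by simp
    qed
  qed
  \<comment> \<open>Gap \<open>s\<close> is followed to time \<open>m\<close>, while the set inside
    it only reaches \<open>?l < m\<close>. That set would already be mostly short before the first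
    such time.\<close>
  have earlier: "\<not> contains (Suc (k s)) s (Suc (k r))" if "r \<in> R" "s \<in> R" "k r < k s" for r s
  proof
    assume c: "contains (Suc (k s)) s (Suc (k r))"
    let ?n = "m - Suc (k s)" and ?l = "Suc (k r) + (m - Suc (k s))"
    have lt: "?l < m" using that k[OF that(2)] by auto
    have "contains (Suc (k s) + ?n) s ?l"
      using c k[OF that(2)] that R by (intro contains_iterate) auto
    then have cm: "contains m s ?l" using k[OF that(2)] by simp
    have sB: "s \<in> B" using that R by blast
    from contains_short[OF sB cm] obtain e' where
      e': "e' \<in> B" "\<forall>c\<in>B. c \<noteq> e' \<longrightarrow> gap ?l c < gap m s" by blast
    have "gap ?l c < \<eta>" if "c \<in> B" "c \<noteq> e'" for c
      using e'(2) that short[OF \<open>s \<in> R\<close>] by (meson order.strict_trans)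
    then have "mostly_short ?l \<eta>" unfolding mostly_short_def using e'(1) by blast
    then show False using least[OF lt] by blast
  qed
  show thesis
  proof (rule that[OF R])
    show "1 / d < gap (k r) r \<and> gap (Suc (k r)) r < \<epsilon>" if "r \<in> R" for r
      using k[OF that] mono[OF that, of "Suc (k r)"] \<eta>(1) by auto
    show "apart (Suc (k r)) r (Suc (k s)) s" if "r \<in> R" "s \<in> R" "r \<noteq> s" for r s
    proof -
      have "r \<in> B" "s \<in> B" using that R by auto
      then have *: "apart (Suc (k r)) r (Suc (k s)) s \<or> k r \<noteq> k s \<and>
          (contains (Suc (k r)) r (Suc (k s)) \<or> contains (Suc (k s)) s (Suc (k r)))"
        using contains_or_apart[of r s "Suc (k r)" "Suc (k s)"] that(3) by auto
      then show ?thesis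
        using later[OF that(1,2)] later[OF that(2,1)] earlier[OF that(1,2)] earlier[OF that(2,1)]
        by (cases "k r" "k s" rule: linorder_cases) auto
    qed
  qed
qed

end


section \<open>Landing patterns\<close>

lemma exists_next_point:
  assumes "finite B" "B \<subseteq> {0..<1}" "2 \<le> card B" "a \<in> B"
  shows "\<exists>b\<in>B. b \<noteq> a \<and> (\<forall>c\<in>B. \<not> in_arc a c b)"
proof -
  let ?f = "\<lambda>c. frac (c - a)"
  have ne: "B - {a} \<noteq> {}" using assms card_mono[of "{a}" B] by auto
  have "Min (?f ` (B - {a})) \<in> ?f ` (B - {a})" using assms ne by (intro Min_in) auto
  then obtain b where b: "b \<in> B" "b \<noteq> a" "Min (?f ` (B - {a})) = ?f b" by auto
  have "?f b \<le> ?f c" if "c \<in> B" "c \<noteq> a" for c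
    unfolding b(3)[symmetric] using assms that by (intro Min_le) auto
  then have "\<not> in_arc a c b" if "c \<in> B" for c
    using that by (cases "c = a") (force simp: in_arc_def)+
  then show ?thesis using b by blast
qed

lemma card_le_max_fibre:
  assumes "finite X" "X \<noteq> {}"
  obtains y where "y \<in> g ` X" "card X \<le> card {x\<in>X. g x = y} * card (g ` X)"
proof -
  let ?f = "\<lambda>y. card {x\<in>X. g x = y}"
  have "Max (?f ` (g ` X)) \<in> ?f ` (g ` X)" using assms by (intro Max_in) auto
  then obtain y where y: "y \<in> g ` X" "Max (?f ` (g ` X)) = ?f y" by blast
  have "card X = (\<Sum>v\<in>g ` X. ?f v)" using sum.image_gen[OF assms(1), of "\<lambda>_. 1::nat" g] by simp
  also have "\<dots> \<le> of_nat (card (g ` X)) * ?f y"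
    unfolding y(2)[symmetric] using assms by (intro sum_bounded_above Max_ge) auto
  finally show thesis using y(1) that by (simp add: mult.commute)
qed

section \<open>Rays along an orbit, axiomatically\<close>

locale landing_rays =
  fixes d :: nat and F :: "'a \<Rightarrow> 'a" and lands :: "real \<Rightarrow> 'a \<Rightarrow> bool"
  assumes d2: "d \<ge> 2"
    and lands_unique: "\<And>t z w. lands t z \<Longrightarrow> lands t w \<Longrightarrow> z = w"
    and lands_frac: "\<And>t z. lands (frac t) z \<longleftrightarrow> lands t z"
    and lands_image: "\<And>t z. lands t z \<Longrightarrow> lands (real d * t) (F z)"
    and lands_lift: "\<And>t z. lands (real d * t) z \<Longrightarrow> \<exists>w. F w = z \<and> lands t w"
    and lands_unlinked: "\<And>a a' b b' z w. \<lbrakk>lands a z; lands a' z; lands b w; lands b' w; z \<noteq> w;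
          in_arc a b a'; in_arc a' b' a\<rbrakk> \<Longrightarrow> False"
    and fibre: "\<And>z. finite {w. F w = z} \<and> card {w. F w = z} \<le> d"
begin

abbreviation m :: "real \<Rightarrow> real" where "m t \<equiv> frac (real d * t)"

text \<open>Regularity is phrased by rays alone: different rays at a common preimage keep different
  images. Away from critical values local injectivity provides this.\<close>

definition regular_value :: "'a \<Rightarrow> bool" where
  "regular_value z \<longleftrightarrow> (\<forall>w t t'. F w = z \<and> lands t w \<and> lands t' w \<and> m t = m t' \<longrightarrow> frac t = frac t')"

text \<open>The \<open>d\<close> lifts of the angle \<open>c\<close> land at preimages of
  \<open>z\<close>, pairwise different ones by regularity. As there are at most \<open>d\<close>
  preimages, each of them receives a lift.\<close>

lemma regular_lift:
  assumes "regular_value z" "F w = z" "lands c z"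
  shows "\<exists>t\<in>{0..<1}. lands t w \<and> m t = frac c"
proof -
  let ?g = "\<lambda>j::nat. (c + j) / d"
  have dg: "real d * ?g j = c + j" for j using d2 by simp
  have "lands (c + j) z" for j :: nat
  proof -
    have "frac (c + j) = frac c" by (simp add: frac_def)
    then show ?thesis using assms(3) lands_frac by metis
  qed
  then have "\<exists>w. F w = z \<and> lands (?g j) w" for j using lands_lift[of "?g j" z] dg by simp
  then obtain h where h: "\<And>j. F (h j) = z \<and> lands (?g j) (h j)" by metis
  have inj: "inj_on h {..<d}"
  proof (rule inj_onI)
    fix i j assume ij: "i \<in> {..<d}" "j \<in> {..<d}" "h i = h j"
    have "m (?g i) = m (?g j)" unfolding dg by (simp add: frac_eq_iff_diff_Ints)
    then have "frac (?g i) = frac (?g j)" using assms(1) h ij(3) unfolding regular_value_def by metis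
    then have "(real i - real j) / d \<in> \<int>" by (simp add: frac_eq_iff_diff_Ints diff_divide_distrib add_divide_distrib)
    then obtain k where "(real i - real j) / d = of_int k" by (auto elim: Ints_cases)
    then have "of_int (int i - int j) = (of_int (k * int d) :: real)" using d2 by (simp add: field_simps)
    then have "int i - int j = k * int d" by linarith
    moreover have "\<bar>int i - int j\<bar> < int d" using ij by auto
    ultimately have "\<bar>k\<bar> * int d < int d" by (simp add: abs_mult)
    then have "k = 0" using d2 by simp
    then show "i = j" using \<open>int i - int j = k * int d\<close> by simp
  qed
  have "h ` {..<d} = {w. F w = z}"
  proof (rule card_subset_eq)
    show "card (h ` {..<d}) = card {w. F w = z}"
      using fibre[of z] card_image[OF inj] card_mono[of "{w. F w = z}" "h ` {..<d}"] h by fastforce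
  qed (use fibre h in auto)
  then obtain j where "w = h j" using assms(2) by blast
  then have "lands (frac (?g j)) w" "m (frac (?g j)) = frac c"
    using h lands_frac dg[of j] by (simp_all add: frac_mult_frac) (simp add: frac_eq_iff_diff_Ints)
  then show ?thesis by (intro bexI[of _ "frac (?g j)"]) (auto simp: frac_lt_1)
qed

lemma m_diff: "frac (m y - m x) = frac (real d * frac (y - x))"
  by (simp add: frac_diff_frac frac_mult_frac right_diff_distrib)

text \<open>The lifts to the other preimages that lie in the arc from \<open>x\<close> to \<open>y\<close> form complete sets of
  representatives of the fibres, as the rays at distinct points are unlinked. Hence each element
  of \<open>m ` A\<close> has equally many lifts inside the arc, which forces \<open>m x\<close> and \<open>m y\<close> to be consecutive.\<close>

lemma consecutive_image:
  assumes "A \<subseteq> {0..<1}" "\<And>t. t \<in> A \<Longrightarrow> lands t z" "regular_value (F z)"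
    and xy: "x \<in> A" "y \<in> A" "x \<noteq> y" and gap: "\<And>c. c \<in> A \<Longrightarrow> \<not> in_arc x c y"
    and c: "c \<in> m ` A"
  shows "\<not> in_arc (m x) c (m y)"
proof
  assume arc: "in_arc (m x) c (m y)"
  \<comment> \<open>This keeps \<open>z\<close> itself out of the set \<open>W'\<close> below, since
    no element of \<open>A\<close> lies in the arc.\<close>
  have inA: "t \<in> A" if t: "t \<in> {0..<1}" "lands t z" "m t \<in> m ` A" for t
  proof -
    obtain t' where t': "t' \<in> A" "m t = m t'" using t(3) by auto
    then have "frac t = frac t'" using assms(2,3) t unfolding regular_value_def by blast
    then show ?thesis using t t' assms(1) by (auto simp: frac_eq)
  qed
  define W' where "W' = {w. F w = F z \<and> (\<exists>t\<in>{0..<1}. lands t w \<and> m t \<in> m ` A \<and> in_arc x t y)}"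
  have finW: "finite W'" using fibre[of "F z"] unfolding W'_def by (rule finite_subset[rotated, OF conjunct1]) auto
  have all: "in_arc x t' y" if w: "w \<in> W'" and t': "t' \<in> {0..<1}" "lands t' w" for w t'
  proof -
    obtain t where t: "t \<in> {0..<1}" "lands t w" "m t \<in> m ` A" "in_arc x t y" using w unfolding W'_def by blast
    have "w \<noteq> z" using inA[of t] gap t by auto
    then have "t' \<noteq> x" "t' \<noteq> y" using lands_unique t' assms(2) xy by metis+
    then have "in_arc x t' y \<or> in_arc y t' x"
      using t' xy assms(1) by (intro in_arc_total) auto
    moreover have "\<not> in_arc y t' x"
      using lands_unlinked[of x z y t w t'] t t' assms(2) xy \<open>w \<noteq> z\<close> by auto
    ultimately show ?thesis by blast
  qed
  define l where "l = frac (y - x)"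
  define p where "p = nat \<lfloor>d * l\<rfloor>"
  have l: "0 \<le> l" "l < 1" by (auto simp: l_def frac_lt_1)
  have p: "real p \<le> d * l" "d * l < real p + 1" using l by (auto simp: p_def)
  have my: "frac (m y - m x) = d * l - p" unfolding m_diff l_def[symmetric] using l by (simp add: frac_def p_def)
  define \<eta> where "\<eta> = frac (c - m x)"
  have \<eta>: "0 < \<eta>" "\<eta> < d * l - p" using arc my unfolding in_arc_def \<eta>_def by auto
  have c01: "c \<in> {0..<1}" using c by (auto simp: frac_lt_1)
  have "lands c (F z)" using c assms(2) lands_image lands_frac by auto
  \<comment> \<open>The lifts of \<open>c\<close> have offsets \<open>(\<eta> + j) / d\<close> from
    \<open>x\<close>. Since \<open>\<eta> < d * l - p\<close>, those with
    \<open>j = 0, ..., p\<close> all lie inside the arc, and by regularity they land at different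
    points.\<close>
  have lower: "p + 1 \<le> card W'"
  proof -
    let ?t = "\<lambda>j::nat. frac (x + (\<eta> + j) / d)"
    have tx: "frac (?t j - x) = (\<eta> + j) / d" if "j \<le> p" for j
    proof -
      have "(\<eta> + j) / d < l" using \<eta> that d2 by (simp add: field_simps)
      then show ?thesis using \<eta> l by (simp add: frac_diff_frac frac_eq)
    qed
    have mt: "m (?t j) = c" for j
    proof -
      have "real d * (x + (\<eta> + j) / d) = real d * x + \<eta> + j" using d2 by (simp add: field_simps)
      then have "m (?t j) = frac (real d * x + \<eta> + j)" by (simp add: frac_mult_frac)
      also have "\<dots> = frac c"
      proof -
        have "real d * x + \<eta> + j - c = real d * x - m x - of_int \<lfloor>c - m x\<rfloor> + j" by (simp add: \<eta>_def frac_def)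
        also have "\<dots> = of_int (\<lfloor>real d * x\<rfloor> - \<lfloor>c - m x\<rfloor> + int j)" by (simp add: frac_def)
        finally show ?thesis unfolding frac_eq_iff_diff_Ints by (metis Ints_of_int)
      qed
      finally show ?thesis using c01 by (simp add: frac_eq)
    qed
    have "\<exists>w. F w = F z \<and> lands (?t j) w" for j
    proof -
      have "lands (real d * ?t j) (F z)" using \<open>lands c (F z)\<close> mt[of j] lands_frac by metis
      then show ?thesis using lands_lift by blast
    qed
    then obtain h where h: "\<And>j. F (h j) = F z \<and> lands (?t j) (h j)" by metis
    have "h j \<in> W'" if "j \<le> p" for j
    proof -
      have "in_arc x (?t j) y" unfolding in_arc_def tx[OF that] l_def[symmetric]
        using \<eta> that d2 by (simp add: field_simps)
      then show ?thesis unfolding W'_def using h mt c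
        by (auto intro!: bexI[of _ "?t j"] simp: frac_lt_1)
    qed
    moreover have "inj_on h {..p}"
    proof (rule inj_onI)
      fix i j assume ij: "i \<in> {..p}" "j \<in> {..p}" "h i = h j"
      have "m (?t i) = m (?t j)" using mt by simp
      then have "frac (?t i) = frac (?t j)" using h[of i] h[of j] ij(3) assms(3) unfolding regular_value_def by metis
      then have "?t i = ?t j" by simp
      then have "frac (?t i - x) = frac (?t j - x)" by simp
      then have "(\<eta> + i) / d = (\<eta> + j) / d" using tx ij by (metis atMost_iff)
      then show "i = j" using d2 by simp
    qed
    ultimately have "card {..p} \<le> card W'" using finW by (intro card_inj_on_le[of h]) auto
    then show ?thesis by simp
  qed
  \<comment> \<open>Each of these preimages also carries a lift of \<open>m x\<close>, which must
    lie inside the arc. Its offset is \<open>i / d\<close> with \<open>1 \<le> i \<le> p\<close>,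
    offset 0 being \<open>x\<close> itself; so there is room for one fewer than with
    \<open>c\<close>.\<close>
  have upper: "card W' \<le> p"
  proof -
    have "\<exists>t\<in>{0..<1}. lands t w \<and> m t = m x \<and> in_arc x t y" if "w \<in> W'" for w
    proof -
      have "F w = F z" using that by (simp add: W'_def)
      moreover have "lands (real d * x) (F z)" using assms(2) xy lands_image by blast
      ultimately show ?thesis using regular_lift[OF assms(3), of w "real d * x"] all[OF that] by blast
    qed
    then obtain g where g: "\<And>w. w \<in> W' \<Longrightarrow> g w \<in> {0..<1} \<and> lands (g w) w \<and> m (g w) = m x \<and> in_arc x (g w) y"
      by metis
    define i where "i = (\<lambda>w. nat \<lfloor>d * frac (g w - x)\<rfloor>)"
    have i: "d * frac (g w - x) = i w" "i w \<in> {1..p}" if "w \<in> W'" for w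
    proof -
      have "frac (real d * frac (g w - x)) = 0" using g[OF that] m_diff[of "g w" x] by simp
      then have e: "d * frac (g w - x) = \<lfloor>d * frac (g w - x)\<rfloor>" by (simp add: frac_def)
      have pos: "0 < frac (g w - x)" "frac (g w - x) < l" using g[OF that] by (auto simp: in_arc_def l_def)
      then show eq: "d * frac (g w - x) = i w" using e d2 by (simp add: i_def)
      have "0 < d * frac (g w - x)" using pos d2 by simp
      moreover have "d * frac (g w - x) < d * l" using pos d2 by simp
      ultimately show "i w \<in> {1..p}" using eq p by auto
    qed
    have "inj_on i W'"
    proof (rule inj_onI)
      fix v w assume vw: "v \<in> W'" "w \<in> W'" "i v = i w"
      then have "d * frac (g v - x) = d * frac (g w - x)" using i(1)[OF vw(1)] i(1)[OF vw(2)] by simp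
      then have "frac (g v - x) = frac (g w - x)" using d2 by simp
      then have "frac (g v) = frac (g w)" by (simp add: frac_eq_iff_diff_Ints)
      then have "g v = g w" using g vw by (simp add: frac_eq)
      then show "v = w" using g[OF vw(1)] g[OF vw(2)] lands_unique by metis
    qed
    then have "card W' \<le> card {1..p}" using i(2) by (intro card_inj_on_le[of i]) auto
    then show ?thesis by simp
  qed
  show False using lower upper by simp
qed


text \<open>Angles can be identified only before time \<open>n0\<close>, and each step costs at most
  the size of a largest fibre \<open>Q a\<close>. With \<open>n0 = 0\<close> nothing is lost; this
  is the bound for late points of the orbit.\<close>

theorem card_rays_bound:
  assumes orbit: "inj (\<lambda>n. (F ^^ n) z)"
    and regular: "\<And>n. n \<ge> n0 \<Longrightarrow> regular_value ((F ^^ Suc n) z)"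
    and A: "finite A" "A \<subseteq> {0..<1}" "\<And>t. t \<in> A \<Longrightarrow> lands t z"
  shows "card A \<le> 2 ^ d \<and> (n0 = 0 \<longrightarrow> card A \<le> d)"
proof (cases "A = {}")
  case False
  define S where "S n = (m ^^ n) ` A" for n
  define Z where "Z n = (F ^^ n) z" for n
  have S0: "S 0 = A" by (simp add: S_def)
  have S_Suc: "S (Suc n) = m ` S n" for n by (simp add: S_def image_image)
  have S_add: "(m ^^ k) ` S n = S (n + k)" for n k by (simp add: S_def image_image funpow_add add.commute)
  have S_ne: "S n \<noteq> {}" for n using False by (simp add: S_def)
  have S_fin: "finite (S n)" for n using A by (simp add: S_def)
  have Z_Suc: "Z (Suc n) = F (Z n)" for n by (simp add: Z_def)
  have Z_inj: "Z n = Z l \<longleftrightarrow> n = l" for n l using orbit by (auto simp: Z_def inj_def)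
  have S_lands: "lands t (Z n)" if "t \<in> S n" for n t
    using that
  proof (induction n arbitrary: t)
    case 0
    then show ?case using A S0 by (simp add: Z_def)
  next
    case (Suc n)
    then obtain s where "s \<in> S n" "t = m s" using S_Suc by auto
    then show ?case using Suc.IH lands_image lands_frac Z_Suc by simp
  qed
  have S_unit: "S n \<subseteq> {0..<1}" for n
    using A S0 S_Suc by (cases n) (auto simp: frac_lt_1)
  have S_disj: "S n \<inter> S l = {}" if "n \<noteq> l" for n l
    using S_lands lands_unique Z_inj that by blast
  have S_unl: "unlinked (S n) (S l)" if "n \<noteq> l" for n l
    unfolding unlinked_def using lands_unlinked[of _ "Z n" _ _ "Z l"] S_lands Z_inj that by blast
  have reg: "regular_value (F (Z n))" if "n \<ge> n0" for n using regular[OF that] by (simp add: Z_def)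
  have m_inj: "inj_on m (S n)" if "n \<ge> n0" for n
  proof (rule inj_onI)
    fix s t assume st: "s \<in> S n" "t \<in> S n" "m s = m t"
    then have "frac s = frac t" using reg[OF that] S_lands unfolding regular_value_def by blast
    moreover have "frac s = s" "frac t = t" using st S_unit[of n] by (auto simp: frac_eq)
    ultimately show "s = t" by simp
  qed
  have "\<exists>y\<in>S (Suc a). card (S a) \<le> card {t\<in>S a. m t = y} * card (S (Suc a))" for a
    using card_le_max_fibre[OF S_fin S_ne, of m a] unfolding S_Suc by blast
  then obtain Y where Y: "\<And>a. Y a \<in> S (Suc a) \<and> card (S a) \<le> card {t\<in>S a. m t = Y a} * card (S (Suc a))"
    by metis
  define Q where "Q a = {t\<in>S a. m t = Y a}" for a
  have Q: "Q a \<subseteq> S a" "finite (Q a)" "Q a \<noteq> {}" for a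
    using S_fin Y[of a] by (auto simp: Q_def S_Suc)
  have S_card: "card A \<le> 2 ^ (\<Sum>a<n. card (Q a) - 1) * card (S n)" for n
  proof (induction n)
    case 0
    then show ?case by (simp add: S0)
  next
    case (Suc n)
    obtain q where q: "card (Q n) = Suc q" using Q[of n] by (metis card_0_eq not0_implies_Suc)
    have "Suc q \<le> 2 ^ q" by (simp add: Suc_leI)
    then have "card (S n) \<le> 2 ^ (card (Q n) - 1) * card (S (Suc n))"
      using Y[of n] q unfolding Q_def[symmetric] by (metis diff_Suc_1 le_trans mult_le_mono1)
    then have "card A \<le> 2 ^ (\<Sum>a<n. card (Q a) - 1) * (2 ^ (card (Q n) - 1) * card (S (Suc n)))"
      using Suc.IH by (meson le_trans mult_le_mono2)
    then show ?case by (simp add: power_add mult.assoc)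
  qed
  define \<kappa> where "\<kappa> = (\<Sum>a<n0. card (Q a) - 1)"
  have cardA: "card A \<le> 2 ^ \<kappa> * card (S n0)" using S_card unfolding \<kappa>_def .
  have \<kappa>0: "\<kappa> = 0" if "n0 = 0" using that by (simp add: \<kappa>_def)
  have Q_fib: "m p = m q" if "p \<in> Q a" "q \<in> Q a" for a p q using that by (simp add: Q_def)
  have Q_dis: "Q a \<inter> Q b = {} \<and> unlinked (Q a) (Q b)" if "a \<noteq> b" for a b
    using S_disj[OF that] unlinked_mono[OF S_unl[OF that] Q(1) Q(1)] Q(1)[of a] Q(1)[of b] by blast
  have Q_unit: "finite (Q a) \<and> Q a \<subseteq> {0..<1}" for a using Q S_unit by blast
  show ?thesis
  proof (cases "card (S n0) \<ge> 3")
    case False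
    \<comment> \<open>With at most two angles left, \<open>fibre_count\<close> alone suffices:
      \<open>\<kappa> \<le> d - 1\<close>, and the remaining factor 2 completes
      \<open>2 ^ d\<close>.\<close>
    have "\<kappa> < d" unfolding \<kappa>_def
    proof (rule fibre_count)
      show "frac (real d * p) = frac (real d * q)" if "p \<in> Q i" "q \<in> Q i" for i p q
        using Q_fib that .
    qed (use d2 Q_unit Q_dis in auto)
    then have "\<kappa> \<le> d - 1" by simp
    have "card (S n0) \<le> 2" using False by simp
    then have "2 ^ \<kappa> * card (S n0) \<le> 2 ^ \<kappa> * 2" by (intro mult_left_mono) auto
    then have "card A \<le> 2 ^ \<kappa> * 2" using cardA by linarith
    also have "\<dots> \<le> 2 ^ (d - 1) * (2::nat)" using \<open>\<kappa> \<le> d - 1\<close> by (intro mult_right_mono power_increasing) auto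
    also have "\<dots> = 2 ^ d" using d2 by (cases d) auto
    finally have "card A \<le> 2 ^ d" .
    moreover have "card A \<le> d" if "n0 = 0" using cardA \<kappa>0[OF that] False d2 by simp
    ultimately show ?thesis by blast
  next
    case True
    define B where "B = S n0"
    define P where "P k = (m ^^ k)" for k
    have PB: "P k ` B = S (n0 + k)" for k by (simp add: P_def B_def S_add)
    have "\<exists>b\<in>B. b \<noteq> a \<and> (\<forall>c\<in>B. \<not> in_arc a c b)" if "a \<in> B" for a
      using exists_next_point[of B a] that S_fin S_unit True by (simp add: B_def)
    then obtain nx where nx: "\<And>a. a \<in> B \<Longrightarrow> nx a \<in> B \<and> nx a \<noteq> a \<and> (\<forall>c\<in>B. \<not> in_arc a c (nx a))"
      by metis
    have P_Suc: "P (Suc k) a = m (P k a)" for k a by (simp add: P_def)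
    have P_inj: "inj_on (P k) B" for k
    proof (induction k)
      case (Suc k)
      have "inj_on (m \<circ> P k) B" using Suc PB[of k] m_inj[of "n0 + k"] by (intro comp_inj_on) auto
      then show ?case by (simp add: P_def o_def)
    qed (simp add: P_def)
    have P_gap: "\<not> in_arc (P k a) (P k c) (P k (nx a))" if "a \<in> B" "c \<in> B" for k a c
      using that(2)
    proof (induction k arbitrary: c)
      case 0
      then show ?case using nx[OF that(1)] by (simp add: P_def)
    next
      case (Suc k)
      have "P k (nx a) \<noteq> P k a" using nx[OF that(1)] P_inj[of k] that(1) by (auto dest: inj_onD)
      moreover have "P k a \<in> S (n0 + k)" "P k (nx a) \<in> S (n0 + k)" using PB[of k] nx[OF that(1)] that(1) by blast+
      moreover have "\<not> in_arc (P k a) x (P k (nx a))" if "x \<in> S (n0 + k)" for x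
        using that Suc.IH unfolding PB[symmetric] by blast
      moreover have "m (P k c) \<in> m ` S (n0 + k)" using PB[of k] Suc.prems by blast
      ultimately show ?case unfolding P_Suc
        using reg[of "n0 + k"] S_lands
        by (intro consecutive_image[OF S_unit, of "n0 + k" "Z (n0 + k)"]) auto
    qed
    interpret W: wandering_gaps d P B nx
    proof
      show "finite B" "3 \<le> card B" using S_fin True by (auto simp: B_def)
      show "P k ` B \<inter> P l ` B = {}" "unlinked (P k ` B) (P l ` B)" if "k \<noteq> l" for k l
        unfolding PB using S_disj S_unl that by auto
    qed (use d2 PB S_unit P_Suc P_inj nx P_gap in auto)
    \<comment> \<open>\<open>\<epsilon>\<close> is at most every distance between two points of one
      set up to time \<open>n0\<close>. A gap shorter than \<open>\<epsilon>\<close> therefore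
      cannot contain such a set; each has at least two points, as it is mapped onto
      \<open>S n0\<close>.\<close>
    let ?T = "(\<Union>a\<le>n0. S a \<times> S a) - Id"
    define \<epsilon> where "\<epsilon> = Min (insert 1 ((\<lambda>(u, v). frac (u - v)) ` ?T))"
    have finT: "finite (insert 1 ((\<lambda>(u, v). frac (u - v)) ` ?T))" using S_fin by auto
    have pos: "0 < frac (u - v)" if "u \<in> S a" "v \<in> S a" "u \<noteq> v" for a u v
    proof -
      have "u \<in> {0..<1}" "v \<in> {0..<1}" using that S_unit by blast+
      then show ?thesis using that(3) by (auto simp: frac_diff_unit simp del: frac_gt_0_iff)
    qed
    have "\<epsilon> > 0" unfolding \<epsilon>_def using pos by (subst Min_gr_iff[OF finT]) (auto simp del: frac_gt_0_iff)
    have \<epsilon>: "\<epsilon> \<le> frac (u - v)" if "u \<in> S a" "v \<in> S a" "u \<noteq> v" "a \<le> n0" for a u v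
      unfolding \<epsilon>_def using that by (intro Min_le[OF finT]) force
    obtain R k where R: "R \<subseteq> B" "Suc (card R) = card B"
      "\<And>r. r \<in> R \<Longrightarrow> 1 / d < W.gap (k r) r \<and> W.gap (Suc (k r)) r < \<epsilon>"
      "\<And>r s. r \<in> R \<Longrightarrow> s \<in> R \<Longrightarrow> r \<noteq> s \<Longrightarrow> W.apart (Suc (k r)) r (Suc (k s)) s"
      using W.apart_events[OF \<open>\<epsilon> > 0\<close>] by blast
    have outside: "in_arc (P (Suc (k r)) (nx r)) (m s) (P (Suc (k r)) r)"
      if r: "r \<in> R" and a: "a < n0" and s: "s \<in> Q a" for r a s
    proof -
      let ?x = "P (Suc (k r)) r" and ?y = "P (Suc (k r)) (nx r)"
      have rB: "r \<in> B" "nx r \<in> B" "nx r \<noteq> r" using r R nx by auto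
      have xy: "?x \<in> S (n0 + Suc (k r))" "?y \<in> S (n0 + Suc (k r))" using PB[of "Suc (k r)"] rB by blast+
      have "?x \<noteq> ?y" using P_inj[of "Suc (k r)"] rB by (auto dest: inj_onD)
      then consider "\<forall>t\<in>S (Suc a). in_arc ?x t ?y" | "\<forall>t\<in>S (Suc a). in_arc ?y t ?x"
        using unlinked_one_side[OF S_unit S_unit S_disj S_unl xy, of "Suc a"] a by auto
      then show ?thesis
      proof cases
        case 1
        have "S n0 = (m ^^ (n0 - Suc a)) ` S (Suc a)" using S_add[of "n0 - Suc a" "Suc a"] a by simp
        then have "card (S n0) \<le> card (S (Suc a))" using S_fin by (metis card_image_le)
        then have "\<not> card (S (Suc a)) \<le> Suc 0" using True by simp
        then obtain u v where uv: "u \<in> S (Suc a)" "v \<in> S (Suc a)" "u \<noteq> v"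
          using S_fin[of "Suc a"] by (auto simp: card_le_Suc0_iff_eq)
        have "frac (?y - ?x) < \<epsilon>" using R(3)[OF r] by (simp add: W.gap_def)
        then have "frac (u - ?x) < \<epsilon>" "frac (v - ?x) < \<epsilon>" using 1 uv by (auto simp: in_arc_def)
        then have "frac (u - v) < \<epsilon> \<or> frac (v - u) < \<epsilon>"
          using frac_ge_0[of "u - ?x"] frac_ge_0[of "v - ?x"]
          unfolding frac_diff_base[of u v ?x] frac_diff_base[of v u ?x] by (smt (verit))
        then show ?thesis using \<epsilon>[of u "Suc a" v] \<epsilon>[of v "Suc a" u] uv a by auto
      next
        case 2
        then show ?thesis using s Q[of a] S_Suc[of a] by blast
      qed
    qed
    have "card R + (\<Sum>j\<in>{..<n0}. card (Q j) - 1) < d"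
    proof (rule W.event_count[where k = k and a = "\<lambda>r. r"])
      show "finite R" using R(1) S_fin[of n0] B_def finite_subset by blast
      show "unlinked (P (k i) ` B) (Q j)" if "j \<in> {..<n0}" for i j
        unfolding PB using that by (intro unlinked_mono[OF S_unl order_refl Q(1)]) auto
      show "frac (real d * p) = frac (real d * q)" if "p \<in> Q i" "q \<in> Q i" for i p q
        using Q_fib that .
    qed (use R Q_unit Q_dis outside in auto)
    then have Nk: "card (S n0) + \<kappa> \<le> d" using R(2) by (simp add: \<kappa>_def B_def)
    have "card (S n0) \<le> d - \<kappa>" using Nk by simp
    then have "2 ^ \<kappa> * card (S n0) \<le> 2 ^ \<kappa> * (d - \<kappa>)" by (intro mult_left_mono) auto
    then have "card A \<le> 2 ^ \<kappa> * (d - \<kappa>)" using cardA by linarith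
    also have "\<dots> \<le> 2 ^ \<kappa> * 2 ^ (d - \<kappa>)" by (intro mult_left_mono less_imp_le) auto
    also have "\<dots> = 2 ^ d" using Nk by (simp flip: power_add)
    finally have "card A \<le> 2 ^ d" .
    moreover have "card A \<le> d" if "n0 = 0" using cardA \<kappa>0[OF that] Nk by simp
    ultimately show ?thesis by blast
  qed
qed simp

end


section \<open>Dynamics of monic polynomials\<close>

locale monic_dynamics =
  fixes f :: "complex poly" and d :: nat
  assumes monic: "lead_coeff f = 1" and deg: "degree f = d" and d2: "d \<ge> 2"
begin

abbreviation F :: "complex \<Rightarrow> complex" where "F \<equiv> poly f"
abbreviation K :: "complex set" where "K \<equiv> filled_julia f"
abbreviation \<Omega> :: "complex set" where "\<Omega> \<equiv> basin_infinity f"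

text \<open>In \<open>F z = a + z * g z\<close> the factor \<open>g\<close> is not constant as
  \<open>d \<ge> 2\<close>, so its modulus is at least 3 far out; a factor 2 remains after absorbing
  \<open>a\<close>.\<close>

lemma escape_radius_exists: "\<exists>R\<ge>1. \<forall>z. R < norm z \<longrightarrow> 2 * norm z \<le> norm (F z)"
proof -
  obtain a g where g: "f = pCons a g" by (cases f)
  obtain b h where h: "g = pCons b h" by (cases g)
  have "h \<noteq> 0" using deg d2 g h by (auto split: if_splits)
  then obtain r where r: "\<And>z::complex. r \<le> norm z \<Longrightarrow> 3 \<le> norm (poly g z)"
    using poly_infinity[of h 3 b] h by auto
  show ?thesis
  proof (intro exI[of _ "max 1 (max r (norm a))"] conjI allI impI)
    fix z :: complex assume z: "max 1 (max r (norm a)) < norm z"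
    have "norm z * 3 \<le> norm z * norm (poly g z)" using r[of z] z by (intro mult_left_mono) auto
    also have "\<dots> = norm (F z - a)" using g by (simp add: norm_mult)
    also have "\<dots> \<le> norm (F z) + norm a" by (rule norm_triangle_ineq4)
    finally show "2 * norm z \<le> norm (F z)" using z by simp
  qed simp
qed

definition R where "R = (SOME R. R \<ge> 1 \<and> (\<forall>z. R < norm z \<longrightarrow> 2 * norm z \<le> norm (F z)))"

lemma R: "R \<ge> 1" "R < norm z \<Longrightarrow> 2 * norm z \<le> norm (F z)"
  using someI_ex[OF escape_radius_exists] unfolding R_def[symmetric] by auto

lemma iterate_growth: "R < norm z \<Longrightarrow> 2 ^ n * norm z \<le> norm ((F ^^ n) z)"
proof (induction n)
  case (Suc n)
  have "norm z \<le> 2 ^ n * norm z" by (simp add: mult_le_cancel_right1)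
  then have "R < norm ((F ^^ n) z)" using Suc by linarith
  then show ?case using R(2)[of "(F ^^ n) z"] Suc by simp
qed simp

lemma basin_iff: "z \<in> \<Omega> \<longleftrightarrow> (\<exists>n. R < norm ((F ^^ n) z))"
proof
  assume "z \<in> \<Omega>"
  then have "\<not> bounded (range (\<lambda>n. (F ^^ n) z))" by (simp add: basin_infinity_def filled_julia_def)
  then have "\<not> (\<forall>n. norm ((F ^^ n) z) \<le> R)" by (auto simp: bounded_iff)
  then show "\<exists>n. R < norm ((F ^^ n) z)" by (meson not_le)
next
  assume "\<exists>n. R < norm ((F ^^ n) z)"
  then obtain n where n: "R < norm ((F ^^ n) z)" by blast
  have "\<not> bounded (range (\<lambda>n. (F ^^ n) z))"
  proof
    assume "bounded (range (\<lambda>n. (F ^^ n) z))"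
    then obtain M where M: "\<And>n. norm ((F ^^ n) z) \<le> M" unfolding bounded_iff by blast
    obtain k :: nat where k: "M < 2 ^ k" using real_arch_pow[of 2 M] by auto
    have "M < 2 ^ k * 1" using k by simp
    also have "\<dots> \<le> 2 ^ k * norm ((F ^^ n) z)" using n R(1) by (intro mult_left_mono) auto
    also have "\<dots> \<le> norm ((F ^^ (k + n)) z)" using iterate_growth[OF n, of k] by (simp add: funpow_add)
    finally show False using M[of "k + n"] by simp
  qed
  then show "z \<in> \<Omega>" by (simp add: basin_infinity_def filled_julia_def)
qed

lemma filled_iff: "z \<in> K \<longleftrightarrow> (\<forall>n. norm ((F ^^ n) z) \<le> R)"
  using basin_iff[of z] unfolding basin_infinity_def by (meson ComplD ComplI not_le)

lemma basin_far: "R < norm z \<Longrightarrow> z \<in> \<Omega>"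
  using basin_iff[of z] by (metis funpow_0)

lemma filled_image_iff: "F z \<in> K \<longleftrightarrow> z \<in> K"
proof -
  have "range (\<lambda>n. (F ^^ n) z) = insert z (range (\<lambda>n. (F ^^ n) (F z)))"
    by (subst UNIV_nat_eq) (simp add: image_image funpow_swap1)
  then show ?thesis by (simp add: filled_julia_def)
qed

lemma basin_image_iff: "F z \<in> \<Omega> \<longleftrightarrow> z \<in> \<Omega>"
  using filled_image_iff by (simp add: basin_infinity_def)

lemma holomorphic_iterate: "(F ^^ n) holomorphic_on S"
proof (induction n)
  case (Suc n)
  have "(\<lambda>z. F ((F ^^ n) z)) holomorphic_on S"
    by (intro holomorphic_intros Suc)
  then show ?case by (simp add: o_def)
qed (simp add: id_def)

lemma open_basin: "open \<Omega>"
proof -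
  have "\<Omega> = (\<Union>n. (F ^^ n) -` (- cball 0 R))" using basin_iff by (auto simp: not_le)
  moreover have "open ((F ^^ n) -` (- cball 0 R))" for n
    using holomorphic_on_imp_continuous_on[OF holomorphic_iterate[of n UNIV]]
    by (intro open_vimage) auto
  ultimately show ?thesis by auto
qed

lemma filled_eq: "K = - \<Omega>" by (simp add: basin_infinity_def)

lemma closed_filled: "closed K" using open_basin by (simp add: filled_eq closed_Compl)

lemma julia_subset: "julia f \<subseteq> K"
  unfolding julia_def using closed_filled frontier_subset_closed by blast

lemma julia_iff: "z \<in> julia f \<longleftrightarrow> z \<in> K \<and> z \<in> closure \<Omega>"
  unfolding julia_def frontier_closures using closed_filled by (simp add: closure_closed basin_infinity_def)

lemma julia_image: assumes "z \<in> julia f" shows "F z \<in> julia f"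
proof -
  have "F ` closure \<Omega> \<subseteq> closure (F ` \<Omega>)"
    by (intro continuous_image_closure_subset[of UNIV]) (auto intro!: continuous_intros)
  moreover have "closure (F ` \<Omega>) \<subseteq> closure \<Omega>" using basin_image_iff by (intro closure_mono) auto
  ultimately show ?thesis using assms filled_image_iff unfolding julia_iff by blast
qed

text \<open>A component inside the disk of radius \<open>R\<close> would have its frontier in
  \<open>K\<close>, where all iterates are bounded by \<open>R\<close>; the maximum principle for an
  iterate then contradicts escape. So every component contains the connected region outside the
  disk.\<close>

lemma connected_basin: "connected \<Omega>"
proof -
  have far: "connected (- cball (0::complex) R)"
    by (intro connected_complement_bounded_convex) auto
  have ex: "\<exists>y\<in>connected_component_set \<Omega> z. R < norm y" if z: "z \<in> \<Omega>" for z
  proof (rule ccontr)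
    let ?V = "connected_component_set \<Omega> z"
    assume n: "\<not> (\<exists>y\<in>?V. R < norm y)"
    have op: "open ?V" by (rule open_connected_component[OF open_basin])
    have "?V \<subseteq> cball 0 R" using n by (auto simp: not_less)
    then have bd: "bounded ?V" using bounded_subset bounded_cball by blast
    have fr: "frontier ?V \<subseteq> K"
      using frontier_of_connected_component_subset[of \<Omega> z] frontier_subset_closed[OF closed_filled]
      by (simp add: basin_infinity_def frontier_complement)
    obtain n where n: "R < norm ((F ^^ n) z)" using z basin_iff by blast
    have "norm ((F ^^ n) z) \<le> R"
    proof (rule maximum_modulus_frontier[of "F ^^ n" ?V])
      show "continuous_on (closure ?V) (F ^^ n)"
        by (rule holomorphic_on_imp_continuous_on[OF holomorphic_iterate])
      show "\<And>y. y \<in> frontier ?V \<Longrightarrow> norm ((F ^^ n) y) \<le> R" using fr filled_iff by blast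
      show "z \<in> ?V" using z by simp
    qed (use holomorphic_iterate bd in auto)
    then show False using n by simp
  qed
  have sub: "- cball 0 R \<subseteq> connected_component_set \<Omega> z" if z: "z \<in> \<Omega>" for z
  proof -
    obtain y where y: "y \<in> connected_component_set \<Omega> z" "R < norm y" using ex[OF z] by blast
    have "- cball 0 R \<subseteq> connected_component_set \<Omega> y"
      using y(2) basin_far by (intro connected_component_maximal far) (auto simp: not_le)
    then show ?thesis using y(1) connected_component_eq by blast
  qed
  have "norm (of_real (R + 1) :: complex) > R" using R(1) by (simp only: norm_of_real)
  then have "complex_of_real (R + 1) \<in> - cball 0 R" by (simp add: not_le)
  then have "complex_of_real (R + 1) \<in> connected_component_set \<Omega> z" if "z \<in> \<Omega>" for z using sub[OF that] by blast
  then show ?thesis unfolding connected_iff_connected_component_eq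
    using connected_component_eq by metis
qed

text \<open>A clopen part of \<open>K\<close> meets the Julia set, as its frontier lies there.\<close>

lemma clopen_part_of_filled:
  assumes con: "connected (julia f)" and a: "a \<in> julia f"
    and T: "compact T" "T \<noteq> {}" "T \<subseteq> K" "a \<notin> T" "closed (K - T)"
  shows False
proof -
  have "frontier T \<noteq> {}" using T(1,2,4) by (intro frontier_not_empty) auto
  then obtain x where x: "x \<in> frontier T" by blast
  have xT: "x \<in> T" using x T(1) compact_imp_closed frontier_subset_closed by blast
  then have "x \<in> - (K - T)" by blast
  have "x \<in> closure (- T)" using x by (simp add: frontier_closures)
  have "x \<in> closure \<Omega>"
  proof -
    have "x \<in> closure (- (K - T) \<inter> - T)"
      using open_Int_closure_subset[OF open_Compl[OF T(5)], of "- T"] \<open>x \<in> - (K - T)\<close> \<open>x \<in> closure (- T)\<close>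
      by blast
    moreover have "- (K - T) \<inter> - T \<subseteq> \<Omega>" by (auto simp: filled_eq)
    ultimately show ?thesis using closure_mono by blast
  qed
  then have xJ: "x \<in> julia f" using xT T(3) julia_iff by blast
  have "closed T" using T(1) compact_imp_closed by blast
  then show False using con xJ xT a T julia_subset unfolding connected_closed by blast
qed

end

section \<open>The Boettcher map\<close>

text \<open>The point \<open>a\<close> is the centre of the inversion below, and
  \<open>K_more\<close> ensures that the inverted basin is not the whole plane, as the Riemann
  mapping theorem demands.\<close>

locale connected_dynamics = monic_dynamics +
  fixes a :: complex
  assumes connJ: "connected (julia f)" and aJ: "a \<in> julia f" and K_more: "K \<noteq> {a}"
begin

lemma aK: "a \<in> K" using aJ julia_subset by blast

text \<open>The basin in the coordinate \<open>w = 1 / (z - a)\<close>, with the point at infinity added as \<open>w = 0\<close>.\<close>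

definition U :: "complex set" where "U = {w. w \<noteq> 0 \<longrightarrow> a + 1 / w \<in> \<Omega>}"

lemma zero_U: "0 \<in> U" by (simp add: U_def)

lemma open_U: "open U"
proof -
  have op: "open (- {0} \<inter> (\<lambda>w. a + 1 / w) -` \<Omega>)"
    using open_basin by (intro continuous_open_preimage continuous_intros) auto
  define \<rho> where "\<rho> = 1 / (R + norm a)"
  have \<rho>: "\<rho> > 0" using R(1) by (simp add: \<rho>_def add_pos_nonneg)
  have "U = (- {0} \<inter> (\<lambda>w. a + 1 / w) -` \<Omega>) \<union> ball 0 \<rho>"
  proof safe
    fix w :: complex assume w: "w \<in> ball 0 \<rho>"
    show "w \<in> U"
    proof (cases "w = 0")
      case False
      then have "R + norm a < norm (1 / w)"
        using w \<rho> R(1) by (simp add: \<rho>_def norm_divide field_simps add_pos_nonneg)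
      also have "\<dots> \<le> norm (a + 1 / w) + norm a" using norm_triangle_ineq4[of "a + 1 / w" a] by simp
      finally show ?thesis using basin_far False by (simp add: U_def)
    qed (simp add: zero_U)
  qed (use \<rho> in \<open>auto simp: U_def\<close>)
  then show ?thesis using op by (simp only: open_Un open_ball)
qed

lemma U_minus_0: "U - {0} = (\<lambda>z. 1 / (z - a)) ` \<Omega>"
proof (intro equalityI subsetI)
  fix w assume "w \<in> U - {0}"
  then show "w \<in> (\<lambda>z. 1 / (z - a)) ` \<Omega>" by (intro image_eqI[of _ _ "a + 1 / w"]) (auto simp: U_def)
qed (use aK in \<open>auto simp: U_def filled_eq\<close>)

lemma connected_U: "connected U"
proof (rule connected_intermediate_closure[of "U - {0}"])
  show "connected (U - {0})" unfolding U_minus_0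
    using aK by (intro connected_continuous_image connected_basin continuous_intros) (auto simp: filled_eq)
  have "0 islimpt U" using open_U zero_U interior_limit_point interior_open by metis
  then have "0 \<in> closure (U - {0})" by (simp add: islimpt_in_closure)
  moreover have "U - {0} \<subseteq> closure (U - {0})" by (rule closure_subset)
  ultimately show "U \<subseteq> closure (U - {0})" by blast
qed auto

text \<open>The inversion sends \<open>a\<close> to infinity, so a bounded component of the
  complement corresponds to a part of \<open>K\<close> away from \<open>a\<close>. The Sura-Bura
  theorem enlarges it to a compact, relatively open set, whose image is a clopen part of
  \<open>K\<close> missing \<open>a\<close>.\<close>

lemma simply_connected_U: "simply_connected U"
proof -
  have "\<not> bounded C" if C: "C \<in> components (- U)" for C
  proof
    assume "bounded C"
    have clU: "closed (- U)" using open_U by auto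
    then have "closed C" using C closed_components by blast
    then have "compact C" using \<open>bounded C\<close> compact_eq_bounded_closed by blast
    obtain T where T: "openin (top_of_set (- U)) T" "compact T" "C \<subseteq> T"
      "T \<subseteq> UNIV"
      by (rule Sura_Bura_clopen_subset[OF closed_imp_locally_compact[OF clU] C \<open>compact C\<close> open_UNIV subset_UNIV])
    have Tne: "T \<noteq> {}" using T(3) C in_components_nonempty by blast
    obtain V where V: "open V" "T = - U \<inter> V" using T(1) by (auto simp: openin_open)
    have T0: "0 \<notin> T" using V zero_U by auto
    let ?T = "(\<lambda>w. a + 1 / w) ` T"
    show False
    proof (rule clopen_part_of_filled[OF connJ aJ, of ?T])
      show "compact ?T" using T(2) T0 by (intro compact_continuous_image continuous_intros) auto
      show "?T \<noteq> {}" using Tne by simp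
      show "?T \<subseteq> K" using V by (auto simp: U_def filled_eq)
      show "a \<notin> ?T" using T0 by auto
      have "K - ?T = K - (- {a} \<inter> (\<lambda>z. 1 / (z - a)) -` V)"
      proof (intro equalityI subsetI)
        fix z assume z: "z \<in> K - ?T"
        have False if "1 / (z - a) \<in> V" "z \<noteq> a"
        proof -
          have "1 / (z - a) \<in> T" using V z that by (auto simp: U_def filled_eq)
          then have "z \<in> ?T" using that by (intro image_eqI[of _ _ "1 / (z - a)"]) auto
          then show False using z by blast
        qed
        then show "z \<in> K - (- {a} \<inter> (\<lambda>z. 1 / (z - a)) -` V)" using z by auto
      qed (use V T0 in auto)
      moreover have "open (- {a} \<inter> (\<lambda>z. 1 / (z - a)) -` V)"
        using V(1) by (intro continuous_open_preimage continuous_intros) auto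
      ultimately show "closed (K - ?T)" using closed_filled by (simp only: closed_Diff)
    qed
  qed
  then show ?thesis using simply_connected_eq_unbounded_complement_components[OF open_U] connected_U by blast
qed

lemma U_ne_UNIV: "U \<noteq> UNIV"
proof -
  obtain b where "b \<in> K" "b \<noteq> a" using K_more aK by blast
  then have "1 / (b - a) \<notin> U" by (simp add: U_def filled_eq)
  then show ?thesis by blast
qed


section \<open>The polynomial near infinity\<close>

definition h :: "complex poly" where "h = reflect_poly (pcompose f [:a, 1:] - [:a:])"

text \<open>This is \<open>f\<close> in the coordinate \<open>w\<close>. The form with
  \<open>h\<close> shows the zero of order \<open>d\<close> at 0, where \<open>h\<close> has the
  value 1 because \<open>f\<close> is monic.\<close>

definition Fhat :: "complex \<Rightarrow> complex" where "Fhat w = w ^ d / poly h w"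

lemma poly_h: "w \<noteq> 0 \<Longrightarrow> poly h w = w ^ d * (F (a + 1 / w) - a)" and poly_h_0: "poly h 0 = 1"
proof -
  let ?p = "pcompose f [:a, 1:] - [:a:]"
  have dg: "degree (pcompose f [:a, 1:]) = d" by (simp add: degree_pcompose deg)
  have "lead_coeff (pcompose f [:a, 1:]) = 1" by (subst lead_coeff_comp) (use monic in auto)
  then have c: "coeff ?p d = 1" using dg d2 by (simp add: coeff_pCons split: nat.split)
  have le: "degree ?p \<le> d" using degree_diff_le[of "pcompose f [:a, 1:]" d "[:a:]"] dg by simp
  then have dp: "degree ?p = d" using c le_degree[of ?p d] by simp
  show "poly h w = w ^ d * (F (a + 1 / w) - a)" if "w \<noteq> 0"
    unfolding h_def poly_reflect_poly_nz[OF that] dp by (simp add: poly_pcompose inverse_eq_divide)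
  show "poly h 0 = 1" using c dp by (simp add: h_def poly_0_coeff_0)
qed

lemma h_nz: "w \<in> U \<Longrightarrow> poly h w \<noteq> 0"
proof (cases "w = 0")
  case False
  assume "w \<in> U"
  then have "F (a + 1 / w) \<in> \<Omega>" using False basin_image_iff by (simp add: U_def)
  then have "F (a + 1 / w) \<noteq> a" using aK by (auto simp: filled_eq)
  then show ?thesis using poly_h[OF False] False by simp
qed (simp add: poly_h_0)

lemma Fhat_0: "Fhat 0 = 0" using d2 by (simp add: Fhat_def)

lemma Fhat_eq: "w \<noteq> 0 \<Longrightarrow> Fhat w = 1 / (F (a + 1 / w) - a)"
  by (simp add: Fhat_def poly_h)

lemma Fhat_U_iff:
  assumes "poly h w \<noteq> 0" shows "Fhat w \<in> U \<longleftrightarrow> w \<in> U"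
proof (cases "w = 0")
  case False
  then have "Fhat w \<noteq> 0" using assms by (simp add: Fhat_def)
  then have "Fhat w \<in> U \<longleftrightarrow> F (a + 1 / w) \<in> \<Omega>" using Fhat_eq[OF False] by (simp add: U_def)
  then show ?thesis using basin_image_iff False by (simp add: U_def)
qed (simp add: Fhat_0 zero_U)

lemma Fhat_U: "w \<in> U \<Longrightarrow> Fhat w \<in> U" using Fhat_U_iff h_nz by blast

lemma Fhat_holomorphic: "Fhat holomorphic_on U"
  unfolding Fhat_def by (intro holomorphic_intros) (use h_nz in auto)

text \<open>For boundedness, large \<open>w\<close> means \<open>z\<close> near \<open>a\<close>,
  where \<open>1 / (F z - a)\<close> is either large or close to \<open>1 / (F a - a)\<close>, a
  point outside \<open>U\<close>. For closedness, a limit cannot leave \<open>U\<close> because its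
  image lies in \<open>C\<close>.\<close>

lemma Fhat_proper:
  assumes C: "compact C" "C \<subseteq> U"
  shows "compact {w\<in>U. Fhat w \<in> C}"
proof -
  let ?T = "{w\<in>U. Fhat w \<in> C}"
  have "\<exists>\<delta>>0. \<forall>z. dist z a < \<delta> \<and> F z \<noteq> a \<longrightarrow> 1 / (F z - a) \<notin> C"
  proof (cases "F a = a")
    case True
    obtain M where M: "M > 0" "\<And>c. c \<in> C \<Longrightarrow> norm c \<le> M"
      using compact_imp_bounded[OF C(1)] by (auto simp: bounded_pos)
    have "continuous (at a) F" by (intro continuous_intros)
    then obtain \<delta> where \<delta>: "\<delta> > 0" "\<And>z. dist z a < \<delta> \<Longrightarrow> dist (F z) (F a) < 1 / M"
      using M(1) unfolding continuous_at_eps_delta by (metis divide_pos_pos zero_less_one)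
    have "1 / (F z - a) \<notin> C" if "dist z a < \<delta>" "F z \<noteq> a" for z
    proof
      assume "1 / (F z - a) \<in> C"
      then have "1 / norm (F z - a) \<le> M" using M(2) by (metis norm_divide norm_one)
      moreover have "norm (F z - a) < 1 / M" using \<delta>(2)[OF that(1)] True by (simp add: dist_norm)
      moreover have "norm (F z - a) > 0" using that(2) by simp
      ultimately show False using M(1) by (simp add: field_simps)
    qed
    then show ?thesis using \<delta>(1) by blast
  next
    case False
    have "F a \<in> K" using filled_image_iff aK by blast
    then have "1 / (F a - a) \<notin> C" using False C(2) by (auto simp: U_def filled_eq)
    moreover have "open (- C)" using C(1) compact_imp_closed by blast
    moreover have "continuous (at a) (\<lambda>z. 1 / (F z - a))" using False by (intro continuous_intros) auto
    ultimately obtain \<delta> where "\<delta> > 0" "\<And>z. dist z a < \<delta> \<Longrightarrow> 1 / (F z - a) \<in> - C"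
      unfolding continuous_at_open by (metis (no_types, lifting) ComplI open_dist)
    then show ?thesis by auto
  qed
  then obtain \<delta> where \<delta>: "\<delta> > 0" "\<And>z. dist z a < \<delta> \<Longrightarrow> F z \<noteq> a \<Longrightarrow> 1 / (F z - a) \<notin> C" by blast
  have "norm w \<le> 1 / \<delta>" if w: "w \<in> ?T" for w
  proof (cases "w = 0")
    case False
    have "F (a + 1 / w) \<noteq> a" using h_nz[of w] w poly_h[OF False] by auto
    then have "\<not> dist (a + 1 / w) a < \<delta>" using \<delta>(2) w Fhat_eq[OF False] by auto
    then have "\<delta> \<le> 1 / norm w" by (simp add: dist_norm norm_divide)
    then show ?thesis using \<delta>(1) False by (simp add: field_simps)
  qed (use \<delta> in auto)
  then have "bounded ?T" by (intro boundedI)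
  moreover have "closed ?T"
    unfolding closed_sequential_limits
  proof (intro allI impI, elim conjE)
    fix w l assume w: "\<forall>n. w n \<in> ?T" "w \<longlonglongrightarrow> l"
    then have "\<forall>n. Fhat (w n) \<in> C" by blast
    then obtain c r where c: "c \<in> C" "strict_mono (r :: nat \<Rightarrow> nat)" "(\<lambda>n. Fhat (w (r n))) \<longlonglongrightarrow> c"
      using C(1) unfolding compact_def by (force simp: o_def)
    have wl: "(\<lambda>n. w (r n)) \<longlonglongrightarrow> l" using LIMSEQ_subseq_LIMSEQ[OF w(2) c(2)] by (simp add: o_def)
    have "(\<lambda>n. w (r n) ^ d) \<longlonglongrightarrow> l ^ d" by (intro tendsto_intros wl)
    moreover have "(\<lambda>n. Fhat (w (r n)) * poly h (w (r n))) \<longlonglongrightarrow> c * poly h l" by (intro tendsto_intros wl c)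
    moreover have "Fhat (w (r n)) * poly h (w (r n)) = w (r n) ^ d" for n
      using h_nz w(1) by (simp add: Fhat_def)
    ultimately have eq: "l ^ d = c * poly h l" using LIMSEQ_unique by force
    have "poly h l \<noteq> 0"
    proof
      assume "poly h l = 0"
      then show False using eq poly_h_0 d2 by auto
    qed
    then have "Fhat l = c" using eq by (simp add: Fhat_def)
    then show "l \<in> ?T" using Fhat_U_iff \<open>poly h l \<noteq> 0\<close> c(1) C(2) by auto
  qed
  ultimately show ?thesis by (simp add: compact_eq_bounded_closed)
qed

text \<open>The Riemann map of \<open>U\<close> conjugates \<open>Fhat\<close> to a proper self-map of the disk whose only zero is \<open>0\<close>,
  of order \<open>d\<close>. Its quotient \<open>q\<close> by \<open>s\<^sup>d\<close> has modulus 1 by the maximum principle for \<open>q\<close> and \<open>1 / q\<close>.\<close>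

theorem boettcher_exists: "\<exists>\<phi>. is_boettcher_map f \<phi>"
proof -
  obtain \<psi>1 g1 where r1: "\<psi>1 holomorphic_on U" "g1 holomorphic_on ball 0 1"
    "\<And>w. w \<in> U \<Longrightarrow> \<psi>1 w \<in> ball 0 1 \<and> g1 (\<psi>1 w) = w"
    "\<And>s. s \<in> ball 0 1 \<Longrightarrow> g1 s \<in> U \<and> \<psi>1 (g1 s) = s"
  proof -
    have "\<exists>f g. f holomorphic_on U \<and> g holomorphic_on ball 0 1 \<and>
        (\<forall>w\<in>U. f w \<in> ball 0 1 \<and> g (f w) = w) \<and> (\<forall>s\<in>ball 0 1. g s \<in> U \<and> f (g s) = s)"
      using Riemann_mapping_theorem[of U] open_U simply_connected_U U_ne_UNIV zero_U by blast
    then show ?thesis using that by metis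
  qed
  have b: "\<psi>1 0 \<in> ball 0 1" using r1(3) zero_U by blast
  obtain fM gM where M: "fM (\<psi>1 0) = 0" "fM holomorphic_on ball 0 1" "fM ` ball 0 1 \<subseteq> ball 0 1"
    "gM holomorphic_on ball 0 1" "gM ` ball 0 1 \<subseteq> ball 0 1"
    "\<And>z. z \<in> ball 0 1 \<Longrightarrow> fM (gM z) = z" "\<And>z. z \<in> ball 0 1 \<Longrightarrow> gM (fM z) = z"
  proof (rule ball_biholomorphism_exists[OF b])
    fix u v assume "u (\<psi>1 0) = 0" "u holomorphic_on ball 0 1" "u ` ball 0 1 \<subseteq> ball 0 1"
      "v holomorphic_on ball 0 1" "v ` ball 0 1 \<subseteq> ball 0 1"
      "\<And>z. z \<in> ball 0 1 \<Longrightarrow> u (v z) = z" "\<And>z. z \<in> ball 0 1 \<Longrightarrow> v (u z) = z"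
    then show thesis by (rule that)
  qed
  define \<psi> where "\<psi> = fM \<circ> \<psi>1"
  define g where "g = g1 \<circ> gM"
  have hol\<psi>: "\<psi> holomorphic_on U" unfolding \<psi>_def
    using r1(3) by (intro holomorphic_on_compose_gen[OF r1(1) M(2)]) auto
  have holg: "g holomorphic_on ball 0 1" unfolding g_def
    by (intro holomorphic_on_compose_gen[OF M(4) r1(2)] M(5))
  have \<psi>U: "\<psi> w \<in> ball 0 1" "g (\<psi> w) = w" if "w \<in> U" for w
  proof -
    have "\<psi>1 w \<in> ball 0 1" "g1 (\<psi>1 w) = w" using r1(3)[OF that] by auto
    then show "\<psi> w \<in> ball 0 1" "g (\<psi> w) = w" using M(3) M(7)[of "\<psi>1 w"] by (auto simp only: \<psi>_def g_def o_def)
  qed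
  have gD: "g s \<in> U" "\<psi> (g s) = s" if "s \<in> ball 0 1" for s
  proof -
    have "gM s \<in> ball 0 1" using M(5) that by blast
    then show "g s \<in> U" "\<psi> (g s) = s" using r1(4)[of "gM s"] M(6)[OF that] by (auto simp only: \<psi>_def g_def o_def)
  qed
  have \<psi>0: "\<psi> 0 = 0" using M(1) by (simp add: \<psi>_def)
  have g0: "g 0 = 0" using \<psi>U(2)[OF zero_U] \<psi>0 by simp
  have inj\<psi>: "inj_on \<psi> U" using \<psi>U(2) by (metis inj_onI)
  \<comment> \<open>\<open>k\<close> is \<open>\<psi> w / w\<close> with the removable singularity
    filled. Dividing out the zero at 0 makes \<open>Q\<close> below holomorphic and free of zeros on
    all of \<open>U\<close>.\<close>
  define k where "k w = (if w = 0 then deriv \<psi> 0 else \<psi> w / w)" for w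
  have holk: "k holomorphic_on U"
  proof -
    have "(\<lambda>z. if z = 0 then deriv \<psi> 0 else (\<psi> z - \<psi> 0) / (z - 0)) holomorphic_on U"
      using zero_U open_U by (intro pole_lemma[OF hol\<psi>]) (simp add: interior_open)
    then show ?thesis by (simp only: k_def[abs_def] \<psi>0 diff_zero)
  qed
  have \<psi>k: "\<psi> w = w * k w" for w by (simp add: k_def \<psi>0)
  have k_nz: "k w \<noteq> 0" if "w \<in> U" for w
  proof (cases "w = 0")
    case True
    then show ?thesis using holomorphic_injective_imp_regular[OF hol\<psi> open_U inj\<psi> zero_U] by (simp add: k_def)
  next
    case False
    then have "\<psi> w \<noteq> 0" using inj_onD[OF inj\<psi>, of w 0] that zero_U \<psi>0 by auto
    then show ?thesis using \<psi>k by auto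
  qed
  define Q where "Q w = k (Fhat w) / (poly h w * k w ^ d)" for w
  have holQ: "Q holomorphic_on U"
  proof -
    have "(k \<circ> Fhat) holomorphic_on U"
      by (rule holomorphic_on_compose_gen[OF Fhat_holomorphic holk]) (use Fhat_U in auto)
    then show ?thesis unfolding Q_def[abs_def] o_def
      by (intro holomorphic_intros holk) (use k_nz h_nz in auto)
  qed
  have Q_nz: "Q w \<noteq> 0" if "w \<in> U" for w using k_nz h_nz Fhat_U that by (simp add: Q_def)
  have \<psi>F: "\<psi> (Fhat w) = \<psi> w ^ d * Q w" if "w \<in> U" for w
    using k_nz[OF that] h_nz[OF that] unfolding \<psi>k[of "Fhat w"] \<psi>k[of w]
    by (simp add: Q_def Fhat_def[of w] power_mult_distrib)
  define q where "q s = Q (g s)" for s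
  have holq: "q holomorphic_on ball 0 1"
    using holomorphic_on_compose_gen[OF holg holQ] gD(1) by (auto simp: q_def[abs_def] o_def image_subset_iff)
  have q_nz: "q s \<noteq> 0" if "norm s < 1" for s using Q_nz gD(1)[of s] that by (simp add: q_def)
  have B: "\<psi> (Fhat (g s)) = s ^ d * q s" if "norm s < 1" for s
    using \<psi>F[of "g s"] gD[of s] that by (simp add: q_def)
  have B1: "norm (s ^ d * q s) < 1" if "norm s < 1" for s
    using B[OF that] \<psi>U(1)[OF Fhat_U[OF gD(1)[of s]]] that by simp
  have maxmod: "norm (u s) \<le> M"
    if hol: "u holomorphic_on ball 0 1" and r: "norm s < r" "r < 1"
      and M: "\<And>t. norm t = r \<Longrightarrow> norm (u t) \<le> M" for u :: "complex \<Rightarrow> complex" and s r M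
  proof (rule maximum_modulus_frontier[of u "ball 0 r"])
    have sub: "cball 0 r \<subseteq> ball (0::complex) 1" using r by auto
    have r0: "0 < r" using r(1) norm_ge_zero[of s] by linarith
    show "u holomorphic_on interior (ball 0 r)"
      using holomorphic_on_subset[OF hol] sub ball_subset_cball by (metis interior_ball subset_trans)
    show "continuous_on (closure (ball 0 r)) u"
      using r0 holomorphic_on_imp_continuous_on[OF holomorphic_on_subset[OF hol sub]] by simp
    show "norm (u t) \<le> M" if "t \<in> frontier (ball 0 r)" for t using that M r0 by simp
    show "s \<in> ball 0 r" using r by simp
  qed simp
  \<comment> \<open>As in the Schwarz lemma: the bound on the circle of radius \<open>r\<close> is
    \<open>1 / r ^ d\<close>, and \<open>r\<close> tends to 1.\<close>
  have upper: "norm (q s) \<le> 1" if s: "norm s < 1" for s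
  proof (rule tendsto_upperbound[where F = "at_left 1"])
    show "((\<lambda>r::real. norm (q s) * r ^ d) \<longlongrightarrow> norm (q s)) (at_left 1)"
      by (auto intro!: tendsto_eq_intros)
    have "norm (q s) * r ^ d \<le> 1" if r: "norm s < r" "r < 1" for r
    proof -
      have "norm (q s) \<le> 1 / r ^ d"
      proof (rule maxmod[OF holq r])
        fix t :: complex assume t: "norm t = r"
        have "0 < r ^ d" using r norm_ge_zero[of s] by (intro zero_less_power) linarith
        then show "norm (q t) \<le> 1 / r ^ d"
          using B1[of t] t r by (simp add: norm_mult norm_power pos_le_divide_eq mult.commute)
      qed
      then show ?thesis using r norm_ge_zero[of s] by (simp add: field_simps)
    qed
    then show "\<forall>\<^sub>F r in at_left 1. norm (q s) * r ^ d \<le> 1"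
      using eventually_at_left_real[OF s] by (auto elim!: eventually_mono)
  qed simp
  \<comment> \<open>By properness, points mapped into the disk of radius \<open>\<rho>\<close> stay
    in a smaller disk. On a circle beyond it \<open>s ^ d * q s\<close> has modulus above
    \<open>\<rho>\<close>, hence so has \<open>q\<close>, and the maximum principle applies to
    \<open>1 / q\<close>.\<close>
  have lower: "\<rho> \<le> norm (q s)" if s: "norm s < 1" and \<rho>: "0 < \<rho>" "\<rho> < 1" for s \<rho>
  proof -
    let ?T = "{w\<in>U. Fhat w \<in> g ` cball 0 \<rho>}"
    have sub: "cball 0 \<rho> \<subseteq> ball (0::complex) 1" using \<rho> by auto
    have "compact (g ` cball 0 \<rho>)"
      using holomorphic_on_imp_continuous_on[OF holomorphic_on_subset[OF holg sub]]
      by (intro compact_continuous_image) auto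
    moreover have "g ` cball 0 \<rho> \<subseteq> U" using gD(1) sub by blast
    ultimately have "compact ?T" by (rule Fhat_proper)
    then have cT: "compact ((norm \<circ> \<psi>) ` ?T)"
      using holomorphic_on_imp_continuous_on[OF holomorphic_on_subset[OF hol\<psi>]]
      by (intro compact_continuous_image continuous_on_compose continuous_intros) auto
    have "\<exists>r0<1. \<forall>w\<in>?T. norm (\<psi> w) \<le> r0"
    proof (cases "?T = {}")
      case True
      then show ?thesis by (intro exI[of _ 0]) auto
    next
      case False
      then have "(norm \<circ> \<psi>) ` ?T \<noteq> {}" by blast
      from compact_attains_sup[OF cT this]
      obtain y where y: "y \<in> (norm \<circ> \<psi>) ` ?T" "\<forall>t\<in>(norm \<circ> \<psi>) ` ?T. t \<le> y" by blast
      have "y < 1" using y(1) \<psi>U(1) by auto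
      moreover have "\<forall>w\<in>?T. norm (\<psi> w) \<le> y" using y(2) unfolding ball_simps o_def .
      ultimately show ?thesis by blast
    qed
    then obtain r0 where r0: "r0 < 1" "\<And>w. w \<in> ?T \<Longrightarrow> norm (\<psi> w) \<le> r0" by blast
    define r where "r = (max r0 (norm s) + 1) / 2"
    have r: "norm s < r" "r < 1" "r0 < r" using r0 s by (auto simp: r_def)
    have "norm (inverse (q s)) \<le> 1 / \<rho>"
    proof (rule maxmod[OF _ r(1,2)])
      show "(\<lambda>s. inverse (q s)) holomorphic_on ball 0 1"
        using q_nz by (intro holomorphic_intros holq) auto
      fix t :: complex assume t: "norm t = r"
      have t1: "norm t < 1" using t r by simp
      have "g t \<notin> ?T" using r0(2)[of "g t"] gD[of t] t r by auto
      then have nin: "Fhat (g t) \<notin> g ` cball 0 \<rho>" using gD(1)[of t] t1 by simp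
      have "Fhat (g t) = g (t ^ d * q t)"
        using \<psi>U(2)[OF Fhat_U[OF gD(1)[of t]]] B[OF t1] t1 by simp
      then have "\<rho> < norm (t ^ d * q t)" using nin by (auto simp: not_le[symmetric])
      also have "\<dots> \<le> norm (q t)"
        using t r norm_ge_zero[of s] unfolding norm_mult norm_power
        by (intro mult_left_le_one_le power_le_one zero_le_power) auto
      finally show "norm (inverse (q t)) \<le> 1 / \<rho>" 
        using le_imp_inverse_le[of \<rho> "norm (q t)"] \<rho> by (simp add: inverse_eq_divide norm_divide)
    qed
    then have "1 / norm (q s) \<le> 1 / \<rho>" by (simp add: inverse_eq_divide norm_divide)
    then show ?thesis using \<rho> q_nz[OF s] by (simp add: divide_simps split: if_splits)
  qed
  have q1: "norm (q s) = 1" if "norm s < 1" for s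
  proof (rule antisym[OF upper[OF that]])
    show "1 \<le> norm (q s)" by (rule dense_le_bounded[of 0]) (use lower[OF that] in auto)
  qed
  have "q constant_on ball 0 1"
    by (rule maximum_modulus_principle[OF holq, where U = "ball 0 1" and \<xi> = 0]) (use q1 in auto)
  then have qc: "q s = q 0" if "norm s < 1" for s using that by (auto simp: constant_on_def)
  define l where "l = k 0"
  have l_nz: "l \<noteq> 0" using k_nz zero_U by (simp add: l_def)
  have q0: "q 0 = l / l ^ d" by (simp add: q_def g0 Q_def Fhat_0 poly_h_0 l_def)
  have l1: "norm l = 1"
  proof -
    have "norm l = norm l ^ d" using q1[of 0] l_nz by (simp add: q0 norm_divide norm_power field_simps)
    also have "\<dots> = norm l * norm l ^ (d - 1)" using d2 by (metis One_nat_def Suc_le_D diff_Suc_Suc minus_nat.diff_0 numeral_2_eq_2 power_Suc)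
    finally have "norm l ^ (d - 1) = 1" using l_nz by simp
    then show ?thesis using d2 power_eq_1_iff by fastforce
  qed
  have Qc: "Q w = l / l ^ d" if "w \<in> U" for w
    using qc[of "\<psi> w"] \<psi>U[OF that] q0 by (simp add: q_def)
  \<comment> \<open>The constant \<open>l\<close> serves twice: it absorbs the factor
    \<open>l / l ^ d\<close> in the functional equation, and being \<open>k 0\<close> it makes
    \<open>\<phi> z / z\<close> tend to 1. As \<open>norm l = 1\<close>, the image is still the
    exterior of the disk.\<close>
  define \<phi> where "\<phi> z = l / \<psi> (1 / (z - a))" for z
  have zU: "1 / (z - a) \<in> U" "1 / (z - a) \<noteq> 0" if "z \<in> \<Omega>" for z
    using that aK by (auto simp: U_def filled_eq)
  have \<psi>_nz: "\<psi> (1 / (z - a)) \<noteq> 0" if "z \<in> \<Omega>" for z using \<psi>k k_nz zU[OF that] by auto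
  have "is_boettcher_map f \<phi>" unfolding is_boettcher_map_def
  proof (intro conjI ballI)
    have "(\<psi> \<circ> (\<lambda>z. 1 / (z - a))) holomorphic_on \<Omega>"
      by (rule holomorphic_on_compose_gen[OF _ hol\<psi>])
        (use zU aK in \<open>auto intro!: holomorphic_intros simp: filled_eq\<close>)
    then show "\<phi> holomorphic_on \<Omega>" unfolding \<phi>_def[abs_def] o_def
      by (intro holomorphic_intros) (use \<psi>_nz in auto)
    show "bij_betw \<phi> \<Omega> (- cball 0 1)"
    proof (rule bij_betw_byWitness[where f' = "\<lambda>s. a + 1 / g (l / s)"])
      have ls: "l / s \<in> ball 0 1" "l / s \<noteq> 0" if "s \<in> - cball 0 1" for s
      proof -
        have "1 < norm s" using that by (simp add: not_le)
        moreover from this have "s \<noteq> 0" by auto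
        ultimately show "l / s \<in> ball 0 1" "l / s \<noteq> 0" using l1 l_nz by (auto simp: norm_divide divide_less_eq_1_pos)
      qed
      have g_nz: "g (l / s) \<noteq> 0" if "s \<in> - cball 0 1" for s
        using gD(2)[OF ls(1)[OF that]] \<psi>0 ls(2)[OF that] by metis
      show "\<forall>z\<in>\<Omega>. a + 1 / g (l / \<phi> z) = z"
        using \<psi>_nz l_nz \<psi>U(2) zU by (simp add: \<phi>_def)
      show "\<forall>s\<in>- cball 0 1. \<phi> (a + 1 / g (l / s)) = s"
      proof
        fix s :: complex assume s: "s \<in> - cball 0 1"
        have "\<phi> (a + 1 / g (l / s)) = l / (l / s)" using g_nz[OF s] gD(2)[OF ls(1)[OF s]] by (simp add: \<phi>_def)
        then show "\<phi> (a + 1 / g (l / s)) = s" using ls(2)[OF s] l_nz by simp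
      qed
      show "\<phi> ` \<Omega> \<subseteq> - cball 0 1"
      proof (rule image_subsetI)
        fix z assume z: "z \<in> \<Omega>"
        have "norm (\<psi> (1 / (z - a))) < 1" "norm (\<psi> (1 / (z - a))) > 0" using \<psi>U(1)[OF zU(1)[OF z]] \<psi>_nz[OF z] by auto
        then show "\<phi> z \<in> - cball 0 1" using l1 by (simp add: \<phi>_def norm_divide field_simps)
      qed
      show "(\<lambda>s. a + 1 / g (l / s)) ` (- cball 0 1) \<subseteq> \<Omega>"
        using gD(1)[OF ls(1)] g_nz by (auto simp: U_def)
    qed
    fix z assume z: "z \<in> \<Omega>"
    let ?w = "1 / (z - a)"
    have "Fhat ?w = 1 / (F z - a)" using Fhat_eq[OF zU(2)[OF z]] by simp
    then have "\<phi> (F z) = l / (\<psi> ?w ^ d * (l / l ^ d))"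
      using \<psi>F[OF zU(1)[OF z]] Qc[OF zU(1)[OF z]] by (simp add: \<phi>_def)
    then show "\<phi> (F z) = \<phi> z ^ degree f" using l_nz deg by (simp add: \<phi>_def power_divide)
  next
    have inf: "((\<lambda>z. 1 / (z - a)) \<longlongrightarrow> 0) at_infinity"
      by (intro tendsto_divide_0[OF tendsto_const]) 
        (use tendsto_add_filterlim_at_infinity'[OF filterlim_ident tendsto_const[of "-a"]] in simp)
    have "isCont k 0" using holk open_U zero_U holomorphic_on_imp_continuous_on continuous_on_eq_continuous_at by blast
    then have A: "((\<lambda>z. k (1 / (z - a))) \<longlongrightarrow> k 0) at_infinity" using isCont_tendsto_compose inf by blast
    have B: "((\<lambda>z. 1 - a * inverse z) \<longlongrightarrow> 1 - a * 0) at_infinity"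
      by (intro tendsto_intros tendsto_inverse_0)
    have lim: "((\<lambda>z. l * (1 - a * inverse z) / k (1 / (z - a))) \<longlongrightarrow> l * (1 - a * 0) / k 0) at_infinity"
      using tendsto_divide[OF tendsto_mult[OF tendsto_const B] A] l_nz unfolding l_def by blast
    have "\<phi> z / z = l * (1 - a * inverse z) / k (1 / (z - a))" if "z \<noteq> 0" for z
    proof (cases "z = a \<or> k (1 / (z - a)) = 0")
      case True
      then show ?thesis using that by (auto simp: \<phi>_def \<psi>k[of "1 / (z - a)"] \<psi>0)
    next
      case False
      then show ?thesis using that by (simp add: \<phi>_def \<psi>k[of "1 / (z - a)"] field_simps)
    qed
    then have "\<forall>\<^sub>F z in at_infinity. l * (1 - a * inverse z) / k (1 / (z - a)) = \<phi> z / z"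
      by (intro eventually_mono[OF eventually_not_equal_at_infinity[of 0]]) auto
    then show "((\<lambda>z. \<phi> z / z) \<longlongrightarrow> 1) at_infinity"
      using Lim_transform_eventually[OF lim] l_nz by (simp add: l_def)
  qed
  then show ?thesis by blast
qed

end


section \<open>External rays\<close>

lemma finite_separated:
  fixes W :: "'a::metric_space set"
  assumes "finite W"
  obtains \<delta> where "\<delta> > 0" "\<And>v w. v \<in> W \<Longrightarrow> w \<in> W \<Longrightarrow> v \<noteq> w \<Longrightarrow> \<delta> \<le> dist v w"
proof -
  let ?D = "insert 1 ((\<lambda>(v, w). dist v w) ` (W \<times> W - Id))"
  have fin: "finite ?D" using assms by simp
  show thesis
  proof (rule that[of "Min ?D"])
    show "Min ?D > 0" by (subst Min_gr_iff[OF fin]) auto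
    show "Min ?D \<le> dist v w" if "v \<in> W" "w \<in> W" "v \<noteq> w" for v w
      using that by (intro Min_le[OF fin]) force
  qed
qed


context connected_dynamics begin

abbreviation \<phi> :: "complex \<Rightarrow> complex" where "\<phi> \<equiv> boettcher_map f"
abbreviation G :: "complex \<Rightarrow> complex" where "G \<equiv> boettcher_inv f"

lemma boettcher: "is_boettcher_map f \<phi>"
  unfolding boettcher_map_def using boettcher_exists by (rule someI_ex)

lemma \<phi>_holomorphic: "\<phi> holomorphic_on \<Omega>"
  and \<phi>_bij: "bij_betw \<phi> \<Omega> (- cball 0 1)"
  and \<phi>_F: "\<And>z. z \<in> \<Omega> \<Longrightarrow> \<phi> (F z) = \<phi> z ^ d"
  and \<phi>_inf: "((\<lambda>z. \<phi> z / z) \<longlongrightarrow> 1) at_infinity"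
  using boettcher deg unfolding is_boettcher_map_def by auto

lemma G_in: "1 < norm s \<Longrightarrow> G s \<in> \<Omega>" and \<phi>_G: "1 < norm s \<Longrightarrow> \<phi> (G s) = s"
proof -
  assume s: "1 < norm s"
  then have "s \<in> \<phi> ` \<Omega>" using \<phi>_bij by (auto simp: bij_betw_def)
  then show "G s \<in> \<Omega>" "\<phi> (G s) = s" unfolding boettcher_inv_def
    by (rule inv_into_into, rule f_inv_into_f)
qed

lemma G_\<phi>: "z \<in> \<Omega> \<Longrightarrow> G (\<phi> z) = z"
  unfolding boettcher_inv_def using \<phi>_bij by (intro inv_into_f_f) (auto simp: bij_betw_def)

lemma F_G: assumes "1 < norm s" shows "F (G s) = G (s ^ d)"
proof -
  have "F (G s) \<in> \<Omega>" using G_in[OF assms] basin_image_iff by blast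
  then have "G (\<phi> (F (G s))) = F (G s)" by (rule G_\<phi>)
  then show ?thesis using \<phi>_F[OF G_in[OF assms]] \<phi>_G[OF assms] by simp
qed

lemma continuous_on_G: "continuous_on {s. 1 < norm s} G"
proof -
  have inj: "inj_on \<phi> \<Omega>" and im: "\<phi> ` \<Omega> = - cball 0 1" using \<phi>_bij by (auto simp: bij_betw_def)
  obtain g where g: "g holomorphic_on (\<phi> ` \<Omega>)" "\<And>z. z \<in> \<Omega> \<Longrightarrow> deriv \<phi> z * deriv g (\<phi> z) = 1"
    "\<And>z. z \<in> \<Omega> \<Longrightarrow> g (\<phi> z) = z"
    using holomorphic_has_inverse[OF \<phi>_holomorphic open_basin inj] by metis
  have "continuous_on {s. 1 < norm s} g"
    using holomorphic_on_imp_continuous_on[OF g(1)] unfolding im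
    by (rule continuous_on_subset) (auto simp: not_le)
  moreover have "g s = G s" if "s \<in> {s. 1 < norm s}" for s
    using g(3)[OF G_in[of s]] \<phi>_G[of s] that by simp
  ultimately show ?thesis using continuous_on_eq by blast
qed

section \<open>Images, lifts and local injectivity of rays\<close>

definition pt :: "real \<Rightarrow> real \<Rightarrow> complex" where "pt t r = of_real r * cis (2 * pi * t)"

definition ray :: "real \<Rightarrow> real \<Rightarrow> complex" where "ray t r = G (pt t r)"

abbreviation lands :: "real \<Rightarrow> complex \<Rightarrow> bool" where "lands \<equiv> external_ray_lands f"

lemma lands_iff: "lands t z \<longleftrightarrow> z \<in> julia f \<and> (ray t \<longlongrightarrow> z) (at_right 1)"
  unfolding external_ray_lands_def ray_def[abs_def] pt_def by simp

lemma norm_pt: "0 \<le> r \<Longrightarrow> norm (pt t r) = r" by (simp add: pt_def norm_mult)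

lemma continuous_on_ray:
  assumes "continuous_on S t" "continuous_on S r" "\<And>x. x \<in> S \<Longrightarrow> 1 < r x"
  shows "continuous_on S (\<lambda>x. ray (t x) (r x))"
proof -
  have "continuous_on S (\<lambda>x. pt (t x) (r x))" unfolding pt_def cis_conv_exp
    by (intro continuous_intros assms)
  then show ?thesis unfolding ray_def
    by (rule continuous_on_compose2[OF continuous_on_G]) (use assms(3) norm_pt in \<open>force simp: less_imp_le\<close>)
qed

lemma ray_in: "1 < r \<Longrightarrow> ray t r \<in> \<Omega>" unfolding ray_def using G_in norm_pt by simp

lemma cis_2pi_eq_iff: "cis (2 * pi * s) = cis (2 * pi * t) \<longleftrightarrow> frac s = frac t"
proof
  assume "cis (2 * pi * s) = cis (2 * pi * t)"
  then have "sin (2 * pi * s) = sin (2 * pi * t)" "cos (2 * pi * s) = cos (2 * pi * t)"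
    by (auto simp: complex_eq_iff)
  then obtain n :: int where "2 * pi * s = 2 * pi * t + 2 * pi * n" using sin_cos_eq_iff by blast
  then have "2 * pi * (s - t - n) = 0" by (simp add: algebra_simps)
  then have "s - t = of_int n" by simp
  then show "frac s = frac t" unfolding frac_eq_iff_diff_Ints by (metis Ints_of_int)
next
  assume "frac s = frac t"
  then have "s - t \<in> \<int>" by (simp add: frac_eq_iff_diff_Ints)
  then have "cis (2 * pi * (s - t)) = 1" by (rule cis_multiple_2pi)
  moreover have "cis (2 * pi * s) = cis (2 * pi * (s - t)) * cis (2 * pi * t)"
    by (simp add: cis_mult algebra_simps)
  ultimately show "cis (2 * pi * s) = cis (2 * pi * t)" by simp
qed

lemma pt_eq_iff: "0 < r \<Longrightarrow> 0 < r' \<Longrightarrow> pt s r = pt t r' \<longleftrightarrow> r = r' \<and> frac s = frac t"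
proof
  assume r: "0 < r" "0 < r'" and eq: "pt s r = pt t r'"
  then have "norm (pt s r) = norm (pt t r')" by simp
  then have "r = r'" using r by (simp add: norm_pt)
  then show "r = r' \<and> frac s = frac t" using eq r by (simp add: pt_def cis_2pi_eq_iff)
qed (auto simp: pt_def cis_2pi_eq_iff)

lemma ray_eq_iff: "1 < r \<Longrightarrow> 1 < r' \<Longrightarrow> ray s r = ray t r' \<longleftrightarrow> r = r' \<and> frac s = frac t"
proof -
  assume r: "1 < r" "1 < r'"
  have "ray s r = ray t r' \<longleftrightarrow> pt s r = pt t r'"
    unfolding ray_def using \<phi>_G[of "pt s r"] \<phi>_G[of "pt t r'"] r norm_pt by (metis less_imp_le less_trans zero_less_one)
  then show ?thesis using pt_eq_iff r by simp
qed

lemma ray_cong: "frac s = frac t \<Longrightarrow> ray s = ray t"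
  unfolding ray_def pt_def using cis_2pi_eq_iff[of s t] by (auto simp: fun_eq_iff)

lemma F_ray: "1 < r \<Longrightarrow> F (ray t r) = ray (real d * t) (r ^ d)"
proof -
  assume r: "1 < r"
  have "pt t r ^ d = pt (real d * t) (r ^ d)"
    by (simp add: pt_def power_mult_distrib Complex.DeMoivre algebra_simps)
  then show ?thesis unfolding ray_def using F_G[of "pt t r"] r norm_pt by simp
qed

lemma lands_unique: "lands t z \<Longrightarrow> lands t w \<Longrightarrow> z = w"
  unfolding lands_iff using tendsto_unique[OF trivial_limit_at_right_real] by blast

lemma lands_cong: "frac s = frac t \<Longrightarrow> lands s z \<longleftrightarrow> lands t z"
  unfolding lands_iff using ray_cong by metis

lemma filterlim_power_right: "filterlim (\<lambda>r::real. r ^ d) (at_right 1) (at_right 1)"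
proof (rule filterlim_at[THEN iffD2], intro conjI)
  show "\<forall>\<^sub>F r in at_right 1. (r::real) ^ d \<in> {1<..} \<and> r ^ d \<noteq> 1"
  proof (rule eventually_mono[OF eventually_at_right_less[of 1]])
    fix r :: real assume "1 < r"
    then have "1 < r ^ d" using d2 by (intro one_less_power) auto
    then show "r ^ d \<in> {1<..} \<and> r ^ d \<noteq> 1" by simp
  qed
  show "((\<lambda>r::real. r ^ d) \<longlongrightarrow> 1) (at_right 1)" by (auto intro!: tendsto_eq_intros)
qed

lemma filterlim_root_right: "filterlim (\<lambda>r::real. root d r) (at_right 1) (at_right 1)"
proof (rule filterlim_at[THEN iffD2], intro conjI)
  show "\<forall>\<^sub>F r in at_right 1. root d r \<in> {1<..} \<and> root d r \<noteq> 1"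
    using d2 by (auto intro!: eventually_mono[OF eventually_at_right_less[of 1]])
  show "((\<lambda>r::real. root d r) \<longlongrightarrow> 1) (at_right 1)" using d2 by (auto intro!: tendsto_eq_intros)
qed

lemma lands_image: assumes "lands t z" shows "lands (real d * t) (F z)"
proof -
  have z: "z \<in> julia f" "(ray t \<longlongrightarrow> z) (at_right 1)" using assms by (auto simp: lands_iff)
  have "isCont F z" by simp
  then have "((\<lambda>r. F (ray t r)) \<longlongrightarrow> F z) (at_right 1)" using z(2) isCont_tendsto_compose by blast
  then have lim: "((\<lambda>r. F (ray t (root d r))) \<longlongrightarrow> F z) (at_right 1)"
    using filterlim_compose[OF _ filterlim_root_right] by blast
  have "\<forall>\<^sub>F r in at_right 1. F (ray t (root d r)) = ray (real d * t) r"
  proof (rule eventually_mono[OF eventually_at_right_less[of 1]])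
    fix r :: real assume "1 < r"
    then show "F (ray t (root d r)) = ray (real d * t) r" using F_ray[of "root d r" t] d2 by simp
  qed
  then have "(ray (real d * t) \<longlongrightarrow> F z) (at_right 1)" using Lim_transform_eventually[OF lim] by blast
  then show ?thesis using julia_image[OF z(1)] by (simp add: lands_iff)
qed

lemma fibre: "finite {w. F w = z} \<and> card {w. F w = z} \<le> d"
proof -
  let ?p = "f - [:z:]"
  have "coeff ?p d = 1" using monic deg d2 by (simp add: coeff_pCons split: nat.split)
  then have "?p \<noteq> 0" by auto
  have dp: "degree ?p \<le> d" using degree_diff_le[of f d "[:z:]"] deg by simp
  have eq: "{w. F w = z} = {w. poly ?p w = 0}" by auto
  show "finite {w. F w = z} \<and> card {w. F w = z} \<le> d" unfolding eq
    using poly_roots_finite[OF \<open>?p \<noteq> 0\<close>] card_poly_roots_bound[OF \<open>?p \<noteq> 0\<close>] dp by linarith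
qed

text \<open>By escape, the points away from the fibre with bounded image form a compact set, on
  which the distance of \<open>F x\<close> from \<open>z\<close> has a positive minimum.\<close>

lemma near_fibre:
  assumes "\<epsilon> > 0"
  shows "\<exists>\<eta>>0. \<forall>x. dist (F x) z < \<eta> \<longrightarrow> (\<exists>w. F w = z \<and> dist x w < \<epsilon>)"
proof -
  let ?W = "{w. F w = z}"
  define N where "N = (\<Inter>w\<in>?W. - ball w \<epsilon>) \<inter> {x. norm (F x) \<le> norm z + 1}"
  have "closed N" unfolding N_def
    by (intro closed_Int closed_INT ballI closed_Compl open_ball closed_Collect_le continuous_intros)
  have "norm x \<le> max R (norm z + 1)" if "x \<in> N" for x
  proof -
    have "norm (F x) \<le> norm z + 1" using that by (simp add: N_def)
    then have "norm x \<le> norm z + 1" if "R < norm x" using R(2)[OF that] norm_ge_zero[of x] by linarith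
    then show ?thesis by (cases "R < norm x") auto
  qed
  then have "bounded N" by (auto simp: bounded_iff)
  then have cN: "compact N" using \<open>closed N\<close> by (simp add: compact_eq_bounded_closed)
  have "\<exists>\<eta>>0. \<forall>x\<in>N. \<eta> \<le> dist (F x) z"
  proof (cases "N = {}")
    case False
    have "continuous_on N (\<lambda>x. dist (F x) z)" by (intro continuous_intros)
    from continuous_attains_inf[OF cN False this]
    obtain x where x: "x \<in> N" "\<forall>y\<in>N. dist (F x) z \<le> dist (F y) z" by blast
    have "F x \<noteq> z" using x(1) assms by (auto simp: N_def)
    then show ?thesis using x by (intro exI[of _ "dist (F x) z"]) auto
  qed (use zero_less_one in blast)
  then obtain \<eta> where \<eta>: "\<eta> > 0" "\<And>x. x \<in> N \<Longrightarrow> \<eta> \<le> dist (F x) z" by blast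
  show ?thesis
  proof (intro exI[of _ "min \<eta> 1"] conjI allI impI)
    fix x assume x: "dist (F x) z < min \<eta> 1"
    have "norm (F x) \<le> norm z + 1"
      using x norm_triangle_sub[of "F x" z] by (simp add: dist_norm)
    moreover have "x \<notin> N" using \<eta>(2)[of x] x by auto
    ultimately show "\<exists>w. F w = z \<and> dist x w < \<epsilon>" by (auto simp: N_def dist_commute)
  qed (use \<eta> in auto)
qed

text \<open>The lift of a landing ray accumulates only at the finitely many preimages of the landing
  point, so by connectedness it stays near a single one of them.\<close>

lemma lands_lift: assumes "lands (real d * t) z" shows "\<exists>w. F w = z \<and> lands t w"
proof -
  let ?W = "{w. F w = z}"
  have z: "z \<in> julia f" "(ray (real d * t) \<longlongrightarrow> z) (at_right 1)" using assms by (auto simp: lands_iff)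
  have lim': "((\<lambda>r. ray (real d * t) (r ^ d)) \<longlongrightarrow> z) (at_right 1)"
    using filterlim_compose[OF z(2) filterlim_power_right] .
  have "\<forall>\<^sub>F r in at_right 1. ray (real d * t) (r ^ d) = F (ray t r)"
    using F_ray by (auto intro: eventually_mono[OF eventually_at_right_less[of 1]])
  then have lim: "((\<lambda>r. F (ray t r)) \<longlongrightarrow> z) (at_right 1)"
    by (rule Lim_transform_eventually[OF lim'])
  have near: "\<forall>\<^sub>F r in at_right 1. \<exists>w\<in>?W. dist (ray t r) w < \<epsilon>" if pos: "\<epsilon> > 0" for \<epsilon>
  proof -
    obtain \<eta> where \<eta>: "\<eta> > 0" "\<forall>x. dist (F x) z < \<eta> \<longrightarrow> (\<exists>w. F w = z \<and> dist x w < \<epsilon>)"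
      using near_fibre[OF pos, of z] by blast
    show ?thesis
    proof (rule eventually_mono[OF tendstoD[OF lim \<eta>(1)]])
      fix r assume "dist (F (ray t r)) z < \<eta>"
      then obtain w where "F w = z" "dist (ray t r) w < \<epsilon>" using \<eta>(2) by blast
      then show "\<exists>w\<in>?W. dist (ray t r) w < \<epsilon>" by (intro bexI[of _ w]) simp_all
    qed
  qed
  obtain \<delta> where \<open>\<delta> > 0\<close> and \<delta>: "\<And>v w. v \<in> ?W \<Longrightarrow> w \<in> ?W \<Longrightarrow> v \<noteq> w \<Longrightarrow> \<delta> \<le> dist v w"
    using finite_separated fibre by blast
  define e where "e = \<delta> / 3"
  have e: "e > 0" using \<open>\<delta> > 0\<close> by (simp add: e_def)
  have uniq: "v = w" if "v \<in> ?W" "w \<in> ?W" "dist x v < e" "dist x w < e" for v w x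
  proof (rule ccontr)
    assume "v \<noteq> w"
    then have "\<delta> \<le> dist v w" using \<delta> that by blast
    also have "\<dots> \<le> dist x v + dist x w" by (rule dist_triangle3)
    finally show False using that \<open>\<delta> > 0\<close> by (simp add: e_def)
  qed
  obtain b where b: "b > 1" "\<And>r. 1 < r \<Longrightarrow> r < b \<Longrightarrow> \<exists>w\<in>?W. dist (ray t r) w < e"
    using near[OF e] unfolding eventually_at_right_field by blast
  define r0 where "r0 = (1 + b) / 2"
  have r0: "1 < r0" "r0 < b" using b(1) by (auto simp: r0_def)
  obtain w where w: "w \<in> ?W" "dist (ray t r0) w < e" using b(2)[OF r0] by blast
  let ?I = "ray t ` {1<..<b}"
  have "connected ?I"
    by (intro connected_continuous_image continuous_on_ray continuous_intros) auto
  have "?I \<subseteq> ball w e"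
  proof (rule ccontr)
    assume "\<not> ?I \<subseteq> ball w e"
    then have "\<Union>((\<lambda>v. ball v e) ` (?W - {w})) \<inter> ?I \<noteq> {}"
      using b(2) by (fastforce simp: dist_commute)
    moreover have "ball w e \<inter> ?I \<noteq> {}" using w(2) r0 by (force simp: dist_commute)
    moreover have "?I \<subseteq> ball w e \<union> \<Union>((\<lambda>v. ball v e) ` (?W - {w}))"
      using b(2) by (fastforce simp: dist_commute)
    moreover have "ball w e \<inter> \<Union>((\<lambda>v. ball v e) ` (?W - {w})) \<inter> ?I = {}"
      using uniq w(1) by (force simp: dist_commute)
    ultimately show False
      using connectedD[OF \<open>connected ?I\<close> open_ball, of "\<Union>((\<lambda>v. ball v e) ` (?W - {w}))" w e] by blast
  qed
  then have close: "dist (ray t r) w < e" if "1 < r" "r < b" for r using that by (force simp: dist_commute)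
  have "(ray t \<longlongrightarrow> w) (at_right 1)"
  proof (rule tendstoI)
    fix \<epsilon> :: real assume "\<epsilon> > 0"
    then have "\<forall>\<^sub>F r in at_right 1. \<exists>v\<in>?W. dist (ray t r) v < min \<epsilon> e" using e by (intro near) simp
    moreover have "\<forall>\<^sub>F r in at_right 1. r < b" using b(1) eventually_at_right_field by blast
    ultimately show "\<forall>\<^sub>F r in at_right 1. dist (ray t r) w < \<epsilon>"
      using eventually_at_right_less[of 1]
    proof eventually_elim
      case (elim r)
      then obtain v where v: "v \<in> ?W" "dist (ray t r) v < min \<epsilon> e" by blast
      then have "v = w" using uniq[of v w "ray t r"] w(1) close elim by simp
      then show ?case using v by simp
    qed
  qed
  moreover have "w \<in> closure \<Omega>"
    using calculation
    by (rule Lim_in_closed_set[OF closed_closure, rotated 2])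
      (auto intro!: eventually_mono[OF eventually_at_right_less[of 1]] subsetD[OF closure_subset] ray_in)
  moreover have "w \<in> K" using w(1) z(1) julia_subset filled_image_iff by blast
  ultimately show ?thesis using w(1) by (auto simp: lands_iff julia_iff)
qed

text \<open>\<open>F\<close> is injective near a noncritical point. Rays landing there with the same
  image angle have the same image at each level \<open>r\<close>, so they coincide close to
  \<open>w\<close>.\<close>

lemma regular_ray:
  assumes "poly (pderiv f) w \<noteq> 0" "lands t w" "lands t' w" "frac (real d * t) = frac (real d * t')"
  shows "frac t = frac t'"
proof -
  have "deriv F w \<noteq> 0" using assms(1) DERIV_imp_deriv[OF poly_DERIV] by metis
  moreover have "F holomorphic_on UNIV" by (intro holomorphic_intros)
  ultimately obtain \<rho> where \<rho>: "\<rho> > 0" "ball w \<rho> \<subseteq> UNIV" "inj_on F (ball w \<rho>)"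
    using has_complex_derivative_locally_injective[of F UNIV w] by (metis UNIV_I open_UNIV)
  have ev: "\<forall>\<^sub>F r in at_right 1. ray s r \<in> ball w \<rho>" if "lands s w" for s
    using that tendstoD[of "ray s" w "at_right 1" \<rho>] \<rho>(1) by (auto simp: lands_iff dist_commute)
  have "\<forall>\<^sub>F r in at_right (1::real). 1 < r \<and> ray t r \<in> ball w \<rho> \<and> ray t' r \<in> ball w \<rho>"
    using ev[OF assms(2)] ev[OF assms(3)] eventually_at_right_less[of 1] by eventually_elim auto
  then obtain r where r: "1 < r" "ray t r \<in> ball w \<rho>" "ray t' r \<in> ball w \<rho>"
    using eventually_happens'[OF trivial_limit_at_right_real] by blast
  have "F (ray t r) = F (ray t' r)" using F_ray[OF r(1)] ray_cong[OF assms(4)] by simp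
  then have "ray t r = ray t' r" using \<rho>(3) r by (auto dest: inj_onD)
  then show ?thesis using ray_eq_iff r by blast
qed


section \<open>Jordan curves formed by rays\<close>

text \<open>Cutting at level 2 lets a shift by 1 parametrize the ray over the unit interval. The
  landing point keeps the path injective because it is outside the basin.\<close>

lemma ray_path:
  assumes "lands t z"
  defines "g \<equiv> \<lambda>s. if s = 0 then z else ray t (s + 1)"
  shows "arc g" "path_image g = insert z (ray t ` {1<..2})"
proof -
  have z: "z \<notin> \<Omega>" "(ray t \<longlongrightarrow> z) (at_right 1)"
    using assms(1) julia_subset by (auto simp: lands_iff filled_eq)
  have cont: "continuous_on {0<..} (\<lambda>s. ray t (s + 1))" by (intro continuous_on_ray continuous_intros) auto
  have "continuous (at s within {0..1}) g" if "s \<in> {0..1}" for s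
  proof (cases "s = 0")
    case True
    have "((\<lambda>s. ray t (s + 1)) \<longlongrightarrow> z) (at_right 0)"
      using z(2) by (subst (asm) at_right_to_0) (simp add: filterlim_filtermap)
    then have "(g \<longlongrightarrow> z) (at_right 0)"
    proof (rule Lim_transform_eventually)
      show "\<forall>\<^sub>F s in at_right 0. ray t (s + 1) = g s"
        by (rule eventually_mono[OF eventually_at_right_less]) (auto simp: g_def)
    qed
    then show ?thesis unfolding True continuous_within at_within_Icc_at_right[OF zero_less_one]
      by (simp add: g_def)
  next
    case False
    then have s: "s \<in> {0<..}" using that by auto
    have "continuous_on {0<..} g" using cont by (rule continuous_on_eq) (auto simp: g_def)
    then have "isCont g s" using s continuous_on_eq_continuous_at open_greaterThan by blast
    then show ?thesis by (rule continuous_at_imp_continuous_at_within)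
  qed
  then have "path g" by (simp add: path_def continuous_on_eq_continuous_within)
  moreover have "inj_on g {0..1}"
  proof (rule inj_onI)
    fix x y :: real assume xy: "x \<in> {0..1}" "y \<in> {0..1}" "g x = g y"
    show "x = y"
    proof (cases "x = 0 \<or> y = 0")
      case True
      then show ?thesis using xy z(1) ray_in[of "x + 1" t] ray_in[of "y + 1" t]
        by (auto simp: g_def split: if_splits)
    next
      case False
      then show ?thesis using xy ray_eq_iff[of "x + 1" "y + 1" t t] by (auto simp: g_def)
    qed
  qed
  ultimately show "arc g" by (simp add: arc_def)
  show "path_image g = insert z (ray t ` {1<..2})"
  proof (intro equalityI subsetI)
    fix y assume "y \<in> path_image g"
    then obtain s where "s \<in> {0..1}" "y = g s" by (auto simp: path_image_def)
    then show "y \<in> insert z (ray t ` {1<..2})" by (auto simp: g_def)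
  next
    fix y assume "y \<in> insert z (ray t ` {1<..2})"
    then consider "y = z" | r where "y = ray t r" "1 < r" "r \<le> 2" by auto
    then show "y \<in> path_image g" unfolding path_image_def
    proof cases
      case 1
      then show "y \<in> g ` {0..1}" by (intro image_eqI[of _ _ 0]) (auto simp: g_def)
    next
      case 2
      then show "y \<in> g ` {0..1}" by (intro image_eqI[of _ _ "r - 1"]) (auto simp: g_def)
    qed
  qed
qed

text \<open>This puts everything beyond the equipotential on the outer side of the curve.
  Unboundedness uses the normalization at infinity: at a large real number \<open>B \<ge> 5\<close>
  the modulus of \<open>\<phi>\<close> exceeds \<open>B / 2 > 2\<close>.\<close>

lemma far_part:
  shows "connected (G ` {s. 2 < norm s})" "\<not> bounded (G ` {s. 2 < norm s})"
proof -
  have "{s::complex. 2 < norm s} = - cball 0 2" by (auto simp: not_le)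
  then have "connected {s::complex. 2 < norm s}" by (simp add: connected_complement_bounded_convex)
  then show "connected (G ` {s. 2 < norm s})"
    by (intro connected_continuous_image continuous_on_subset[OF continuous_on_G]) auto
  show "\<not> bounded (G ` {s. 2 < norm s})"
  proof
    assume "bounded (G ` {s. 2 < norm s})"
    then obtain M where M: "\<And>s. 2 < norm s \<Longrightarrow> norm (G s) \<le> M" by (auto simp: bounded_iff)
    have "\<forall>\<^sub>F z in at_infinity. dist (\<phi> z / z) 1 < 1 / 2" by (rule tendstoD[OF \<phi>_inf]) simp
    then obtain b where b: "\<And>z. b \<le> norm z \<Longrightarrow> dist (\<phi> z / z) 1 < 1 / 2"
      by (auto simp: eventually_at_infinity)
    define B where "B = max (max b (R + 1)) (max (M + 1) 5)"
    let ?z = "of_real B :: complex"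
    have nz: "norm ?z = B" by (simp add: B_def)
    have z: "?z \<in> \<Omega>" using basin_far[of ?z] nz by (simp add: B_def)
    have "1 - norm (\<phi> ?z / ?z) \<le> norm (\<phi> ?z / ?z - 1)"
      using norm_triangle_ineq2[of 1 "\<phi> ?z / ?z"] by (simp add: norm_minus_commute)
    moreover have "b \<le> norm ?z" unfolding nz by (simp add: B_def)
    then have "norm (\<phi> ?z / ?z - 1) < 1 / 2" using b[of ?z] by (simp only: dist_norm)
    ultimately have "1 / 2 < norm (\<phi> ?z / ?z)" by linarith
    then have "B / 2 < norm (\<phi> ?z)" using nz by (simp add: norm_divide B_def field_simps)
    then have "2 < norm (\<phi> ?z)" by (simp add: B_def)
    then show False using M[of "\<phi> ?z"] G_\<phi>[OF z] nz by (simp add: B_def)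
  qed
qed

lemma pt_polar:
  assumes "s \<noteq> 0" obtains x where "0 \<le> x" "x < 1" "s = pt (t + x) (norm s)"
proof -
  define u where "u = Arg s / (2 * pi)"
  have "s = pt u (norm s)" using rcis_cmod_Arg[of s] by (simp add: pt_def u_def rcis_def)
  moreover have "pt u (norm s) = pt (t + frac (u - t)) (norm s)"
    using assms by (subst pt_eq_iff) (auto simp: frac_add_frac_diff)
  ultimately have "s = pt (t + frac (u - t)) (norm s)" by simp
  then show thesis using that[OF frac_ge_0 frac_lt_1] by blast
qed

text \<open>The two rays landing at \<open>z\<close>, cut off at the equipotential \<open>|\<phi>| = 2\<close> and joined by an arc of
  it, form a Jordan curve. Of two rays at another point \<open>w\<close>, the one crossing that arc comes from
  the inside, so \<open>w\<close> is inside; the other one stays outside.\<close>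

lemma rays_not_crossing:
  assumes z: "lands \<alpha> z" "lands (\<alpha> + l) z" and w: "lands (\<alpha> + b) w" "lands (\<alpha> + b') w"
    and zw: "z \<noteq> w" and ord: "0 < b" "b < l" "l < b'" "b' < 1"
  shows False
proof -
  have ray_eq: "ray (\<alpha> + x) r = ray (\<alpha> + y) r' \<longleftrightarrow> r = r' \<and> x = y"
    if "0 \<le> x" "x < 1" "0 \<le> y" "y < 1" "1 < r" "1 < r'" for x y r r'
  proof -
    have "frac (\<alpha> + x) = frac (\<alpha> + y) \<longleftrightarrow> x = y"
    proof
      assume "frac (\<alpha> + x) = frac (\<alpha> + y)"
      then have "frac x = frac y" by (simp add: frac_eq_iff_diff_Ints)
      then show "x = y" using that by (simp add: frac_eq)
    qed simp
    then show ?thesis using ray_eq_iff that by simp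
  qed
  have z\<Omega>: "z \<notin> \<Omega>" "w \<notin> \<Omega>" using z w julia_subset by (auto simp: lands_iff filled_eq)
  define g1 where "g1 = (\<lambda>s. if s = 0 then z else ray \<alpha> (s + 1))"
  define g2 where "g2 = (\<lambda>s. if s = 0 then z else ray (\<alpha> + l) (s + 1))"
  define g3 where "g3 = (\<lambda>s. ray (\<alpha> + s * l) 2)"
  note g1 = ray_path[OF z(1), folded g1_def] and g2 = ray_path[OF z(2), folded g2_def]
  have g3: "arc g3" "path_image g3 = (\<lambda>x. ray (\<alpha> + x) 2) ` {0..l}"
  proof -
    have "path g3" unfolding path_def g3_def by (intro continuous_on_ray continuous_intros) auto
    moreover have "inj_on g3 {0..1}"
    proof (rule inj_onI)
      fix x y assume xy: "x \<in> {0..1}" "y \<in> {0..1}" "g3 x = g3 y"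
      have "x * l \<le> 1 * l" "y * l \<le> 1 * l" using xy ord by (intro mult_right_mono; auto)+
      then have "x * l < 1" "y * l < 1" using ord by (linarith+)
      moreover have "0 \<le> x * l" "0 \<le> y * l" using xy ord by auto
      ultimately have "x * l = y * l" using ray_eq[of "x * l" "y * l" 2 2] xy ord by (simp add: g3_def)
      then show "x = y" using ord by simp
    qed
    ultimately show "arc g3" by (simp add: arc_def)
    have sc: "(\<lambda>s. s * l) ` {0..1} = {0..l}"
    proof (intro equalityI subsetI)
      fix x assume "x \<in> {0..l}"
      then show "x \<in> (\<lambda>s. s * l) ` {0..1}" using ord by (intro image_eqI[of _ _ "x / l"]) auto
    next
      fix x assume "x \<in> (\<lambda>s. s * l) ` {0..1}"
      then obtain s where "s \<in> {0..1}" "x = s * l" by blast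
      then show "x \<in> {0..l}" using ord mult_left_le_one_le[of l s] by auto
    qed
    have "path_image g3 = (\<lambda>x. ray (\<alpha> + x) 2) ` ((\<lambda>s. s * l) ` {0..1})"
      by (simp only: path_image_def g3_def image_image)
    then show "path_image g3 = (\<lambda>x. ray (\<alpha> + x) 2) ` {0..l}" unfolding sc .
  qed
  have ends: "pathstart g1 = z" "pathfinish g1 = ray \<alpha> 2" "pathstart g2 = z" "pathfinish g2 = ray (\<alpha> + l) 2"
    "pathstart g3 = ray \<alpha> 2" "pathfinish g3 = ray (\<alpha> + l) 2"
    by (auto simp: g1_def g2_def g3_def pathstart_def pathfinish_def)
  define c where "c = (reversepath g2 +++ g1) +++ g3"
  have arc12: "arc (reversepath g2 +++ g1)"
  proof (rule arc_join)
    have "ray \<alpha> r \<noteq> ray (\<alpha> + l) r'" if "1 < r" "1 < r'" for r r'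
      using ray_eq[of 0 l r r'] that ord by simp
    moreover have "ray \<alpha> r \<noteq> z" if "1 < r" for r using ray_in[OF that] z\<Omega> by metis
    moreover have "ray (\<alpha> + l) r \<noteq> z" if "1 < r" for r using ray_in[OF that] z\<Omega> by metis
    ultimately show "path_image (reversepath g2) \<inter> path_image g1 \<subseteq> {pathstart g1}"
      unfolding path_image_reversepath g1(2) g2(2) ends by fastforce
  qed (use g1 g2 ends arc_reversepath in auto)
  have im12: "path_image (reversepath g2 +++ g1) = insert z (ray \<alpha> ` {1<..2} \<union> ray (\<alpha> + l) ` {1<..2})"
    by (subst path_image_join) (use ends in \<open>auto simp: g1(2) g2(2)\<close>)
  have simple: "simple_path c" unfolding c_def
  proof (rule simple_path_join_loop[OF arc12 g3(1)])
    have r1: "r = 2" if "1 < r" "ray \<alpha> r = ray (\<alpha> + x) 2" "0 \<le> x" "x \<le> l" for r x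
      using ray_eq[of 0 x r 2] that ord by simp
    have r2: "r = 2" if "1 < r" "ray (\<alpha> + l) r = ray (\<alpha> + x) 2" "0 \<le> x" "x \<le> l" for r x
      using ray_eq[of l x r 2] that ord by simp
    show "path_image (reversepath g2 +++ g1) \<inter> path_image g3
        \<subseteq> {pathstart (reversepath g2 +++ g1), pathstart g3}"
    proof (rule subsetI, elim IntE)
      fix y assume y: "y \<in> path_image (reversepath g2 +++ g1)" "y \<in> path_image g3"
      from y(2) obtain x where x: "y = ray (\<alpha> + x) 2" "0 \<le> x" "x \<le> l" unfolding g3(2) by auto
      have "y \<noteq> z" using ray_in[of 2 "\<alpha> + x"] z\<Omega>(1) x(1) by auto
      then consider r where "1 < r" "y = ray \<alpha> r" | r where "1 < r" "y = ray (\<alpha> + l) r"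
        using y(1) unfolding im12 by auto
      then have "y = ray \<alpha> 2 \<or> y = ray (\<alpha> + l) 2"
      proof cases
        case 1
        then show ?thesis using r1[OF 1(1) _ x(2,3)] x(1) by simp
      next
        case 2
        then show ?thesis using r2[OF 2(1) _ x(2,3)] x(1) by simp
      qed
      then show "y \<in> {pathstart (reversepath g2 +++ g1), pathstart g3}" by (auto simp: ends)
    qed
  qed (use ends in auto)
  have loop: "pathfinish c = pathstart c" using ends by (simp add: c_def)
  have im: "path_image c = insert z (ray \<alpha> ` {1<..2} \<union> ray (\<alpha> + l) ` {1<..2} \<union> (\<lambda>x. ray (\<alpha> + x) 2) ` {0..l})"
    unfolding c_def by (subst path_image_join) (use ends in \<open>auto simp: im12 g3(2)\<close>)
  have not_im: "ray (\<alpha> + x) r \<notin> path_image c"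
    if "0 < x" "x < 1" "x \<noteq> l" "1 < r" "r \<noteq> 2 \<or> l < x" for x r
  proof -
    have "ray (\<alpha> + x) r \<noteq> z" using ray_in[OF that(4)] z\<Omega> by metis
    moreover have "ray (\<alpha> + x) r \<notin> ray \<alpha> ` {1<..2}"
    proof
      assume "ray (\<alpha> + x) r \<in> ray \<alpha> ` {1<..2}"
      then obtain r' where "ray (\<alpha> + x) r = ray \<alpha> r'" "1 < r'" by auto
      then show False using ray_eq[of x 0 r r'] that by simp
    qed
    moreover have "ray (\<alpha> + x) r \<notin> ray (\<alpha> + l) ` {1<..2}"
    proof
      assume "ray (\<alpha> + x) r \<in> ray (\<alpha> + l) ` {1<..2}"
      then obtain r' where "ray (\<alpha> + x) r = ray (\<alpha> + l) r'" "1 < r'" by auto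
      then show False using ray_eq[of x l r r'] that ord by simp
    qed
    moreover have "ray (\<alpha> + x) r \<notin> (\<lambda>x. ray (\<alpha> + x) 2) ` {0..l}"
    proof
      assume "ray (\<alpha> + x) r \<in> (\<lambda>x. ray (\<alpha> + x) 2) ` {0..l}"
      then obtain y where "ray (\<alpha> + x) r = ray (\<alpha> + y) 2" "0 \<le> y" "y \<le> l" by auto
      then show False using ray_eq[of x y r 2] that ord by auto
    qed
    ultimately show ?thesis unfolding im by simp
  qed
  define inner where "inner = inside (path_image c)"
  define outer where "outer = outside (path_image c)"
  note JJ = Jordan_inside_outside[OF simple loop, folded inner_def outer_def]
  have J: "open inner" "open outer" "bounded inner" "inner \<inter> outer = {}" "inner \<union> outer = - path_image c"
    "frontier inner = path_image c" "frontier outer = path_image c"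
    using JJ by blast+
  have side: "T \<subseteq> inner \<or> T \<subseteq> outer" if "connected T" "T \<inter> path_image c = {}" for T
    using connectedD[OF that(1) J(1,2)] J(4,5) that(2) by blast
  let ?far = "G ` {s. 2 < norm s}"
  have "G s \<notin> path_image c" if "2 < norm s" for s
  proof
    assume "G s \<in> path_image c"
    moreover have "\<phi> (ray t r) = pt t r" if "1 < r" for t r
      using \<phi>_G[of "pt t r"] norm_pt[of r t] that by (simp add: ray_def)
    then have "norm (\<phi> (ray t r)) = r" if "1 < r" for t r using that norm_pt by simp
    moreover have "\<phi> (G s) = s" "G s \<in> \<Omega>" using \<phi>_G G_in that by auto
    ultimately show False using that z\<Omega> unfolding im by (auto simp: image_iff) 
  qed
  then have far: "?far \<subseteq> outer" using side[OF far_part(1)] far_part(2) J(3) bounded_subset by blast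
  \<comment> \<open>The landing point \<open>w\<close> is a limit of points of \<open>S\<close>. It
    is not on the curve, being different from \<open>z\<close> and outside the basin.\<close>
  have lim_side: "w \<in> S" if S: "S = inner \<or> S = outer" and t: "lands t w" "\<And>r. 1 < r \<Longrightarrow> r < 2 \<Longrightarrow> ray t r \<in> S" for S t
  proof -
    have "\<forall>\<^sub>F r in at_right 1. ray t r \<in> S"
      unfolding eventually_at_right_field using t(2) by (intro exI[of _ 2]) auto
    then have "w \<in> closure S" using t(1) closure_subset
      by (intro Lim_in_closed_set[OF closed_closure _ trivial_limit_at_right_real, of "ray t"])
        (auto simp: lands_iff elim!: eventually_mono intro: subsetD[OF closure_subset])
    moreover have "w \<notin> path_image c"
    proof -
      have "w \<notin> ray \<alpha> ` {1<..2}" "w \<notin> ray (\<alpha> + l) ` {1<..2}" "w \<notin> (\<lambda>x. ray (\<alpha> + x) 2) ` {0..l}"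
        using z\<Omega>(2) ray_in by auto
      then show ?thesis using zw unfolding im by simp
    qed
    moreover have "closure S = S \<union> frontier S" by (simp add: closure_Un_frontier)
    ultimately show ?thesis using S J(6,7) by auto
  qed
  have "w \<in> outer"
  proof (rule lim_side[OF _ w(2)])
    let ?T = "ray (\<alpha> + b') ` {1<..}"
    have "connected ?T" by (intro connected_continuous_image continuous_on_ray continuous_intros) auto
    moreover have "?T \<inter> path_image c = {}" using not_im[of b'] ord by auto
    ultimately have "?T \<subseteq> inner \<or> ?T \<subseteq> outer" by (rule side)
    moreover have "ray (\<alpha> + b') 3 \<in> outer" using far norm_pt[of 3] by (auto simp: ray_def)
    moreover have "ray (\<alpha> + b') 3 \<in> ?T" by simp
    ultimately have "?T \<subseteq> outer" using J(4) by blast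
    then show "ray (\<alpha> + b') r \<in> outer" if "1 < r" for r using that by auto
  qed auto
  moreover have "w \<in> inner"
  proof (rule lim_side[OF _ w(1)])
    \<comment> \<open>The directions from \<open>l\<close> to a full turn are removed, 1 standing
      for the direction \<open>\<alpha>\<close> itself. So \<open>V\<close> is a neighbourhood of a
      point of the equipotential arc containing only directions strictly between the two
      rays.\<close>
    define sector where "sector = (\<lambda>(x, r). pt (\<alpha> + x) r) ` ({l..1} \<times> {1..3})"
    have "compact sector" unfolding sector_def pt_def cis_conv_exp case_prod_beta
      by (intro compact_continuous_image compact_Times continuous_intros) auto
    define V where "V = \<Omega> \<inter> \<phi> -` ({s. 1 < norm s} \<inter> {s. norm s < 3} \<inter> - sector)"
    have "open ({s::complex. 1 < norm s} \<inter> {s. norm s < 3} \<inter> - sector)"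
      using compact_imp_closed[OF \<open>compact sector\<close>]
      by (intro open_Int open_Collect_less continuous_intros open_Compl) auto
    then have "open V" unfolding V_def
      by (intro continuous_open_preimage[OF holomorphic_on_imp_continuous_on[OF \<phi>_holomorphic] open_basin])
    have \<phi>_ray: "\<phi> (ray t r) = pt t r" if "1 < r" for t r
      using \<phi>_G[of "pt t r"] norm_pt[of r t] that by (simp add: ray_def)
    have "pt (\<alpha> + b) 2 \<notin> sector"
    proof
      assume "pt (\<alpha> + b) 2 \<in> sector"
      then obtain x r where xr: "x \<in> {l..1}" "r \<in> {1..3}" "pt (\<alpha> + b) 2 = pt (\<alpha> + x) r"
        by (auto simp: sector_def)
      then have "frac (\<alpha> + b) = frac (\<alpha> + x)" using pt_eq_iff[of 2 r "\<alpha> + b" "\<alpha> + x"] by simp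
      then have "x - b \<in> \<int>" by (metis frac_eq_iff_diff_Ints add_diff_cancel_left)
      then show False using xr(1) ord frac_eq_0_iff[of "x - b"] by (simp add: frac_eq)
    qed
    then have "ray (\<alpha> + b) 2 \<in> V" using ray_in[of 2] norm_pt[of 2] by (simp add: V_def \<phi>_ray)
    moreover have "ray (\<alpha> + b) 2 \<in> closure inner"
      using J(6) ord im by (auto simp: frontier_def)
    ultimately have "V \<inter> inner \<noteq> {}"
      using open_Int_closure_eq_empty[OF \<open>open V\<close>, of inner] by blast
    then obtain y where y: "y \<in> V" "y \<in> inner" by blast
    have "y \<in> \<Omega>" using y(1) by (simp add: V_def)
    define r where "r = norm (\<phi> y)"
    have r: "1 < r" "r < 3" using y(1) by (auto simp: V_def r_def)
    have "\<phi> y \<noteq> 0" using r by (auto simp: r_def)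
    then obtain x where x: "0 \<le> x" "x < 1" "\<phi> y = pt (\<alpha> + x) r" using pt_polar[of "\<phi> y" \<alpha>] by (metis r_def)
    have yr: "y = ray (\<alpha> + x) r" using G_\<phi>[OF \<open>y \<in> \<Omega>\<close>] x(3) by (simp add: ray_def)
    have nsec: "pt (\<alpha> + x) r \<notin> sector" using y(1) x(3) by (simp add: V_def)
    have "x < l" using nsec x r by (force simp: sector_def)
    have "x \<noteq> 0"
    proof
      assume "x = 0"
      then have "pt (\<alpha> + x) r = pt (\<alpha> + 1) r" using r by (subst pt_eq_iff) (auto simp: frac_eq_iff_diff_Ints)
      then show False using nsec r ord by (force simp: sector_def)
    qed
    have "r \<noteq> 2" 
    proof
      assume "r = 2"
      then have "y \<in> path_image c" using yr x \<open>x < l\<close> im by auto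
      then show False using y(2) J(5) by blast
    qed
    have "\<not> 2 < r"
    proof
      assume "2 < r"
      then have "y \<in> ?far" using G_\<phi>[OF \<open>y \<in> \<Omega>\<close>] r_def by (metis image_eqI mem_Collect_eq)
      then show False using far y(2) J(4) by blast
    qed
    \<comment> \<open>Since \<open>y\<close> is inside and below level 2, the whole cell between the
      two rays below that level is inside.\<close>
    let ?T = "(\<lambda>(x, r). ray (\<alpha> + x) r) ` ({0<..<l} \<times> {1<..<2})"
    have "connected ?T" unfolding case_prod_beta
      by (intro connected_continuous_image continuous_on_ray connected_Times continuous_intros) auto
    moreover have "?T \<inter> path_image c = {}" using not_im ord by force
    ultimately have "?T \<subseteq> inner \<or> ?T \<subseteq> outer" by (rule side)
    moreover have "y \<in> ?T" using yr x r \<open>x < l\<close> \<open>x \<noteq> 0\<close> \<open>r \<noteq> 2\<close> \<open>\<not> 2 < r\<close> by force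
    ultimately have "?T \<subseteq> inner" using y(2) J(4) by blast
    then show "ray (\<alpha> + b) r \<in> inner" if "1 < r" "r < 2" for r using that ord by force
  qed auto
  ultimately show False using J(4) by blast
qed

lemma lands_unlinked:
  assumes "lands \<alpha> z" "lands \<alpha>' z" "lands b w" "lands b' w" "z \<noteq> w" "in_arc \<alpha> b \<alpha>'" "in_arc \<alpha>' b' \<alpha>"
  shows False
proof -
  define l \<beta> \<beta>' where "l = frac (\<alpha>' - \<alpha>)" and "\<beta> = frac (b - \<alpha>)" and "\<beta>' = frac (b' - \<alpha>)"
  have 1: "0 < \<beta>" "\<beta> < l" using assms(6) by (auto simp: in_arc_def l_def \<beta>_def)
  have 2: "l < \<beta>'" using assms(7) 1 frac_ge_0[of "b' - \<alpha>"] 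
    unfolding in_arc_def frac_diff_base[of b' \<alpha>' \<alpha>] frac_diff_base[of \<alpha> \<alpha>' \<alpha>] l_def \<beta>'_def
    by (auto split: if_splits simp del: frac_gt_0_iff frac_ge_0)
  have "lands (\<alpha> + l) z" "lands (\<alpha> + \<beta>) w" "lands (\<alpha> + \<beta>') w"
    using assms(2-4) by (simp_all only: l_def \<beta>_def \<beta>'_def lands_cong[OF frac_add_frac_diff])
  then show False using rays_not_crossing[OF assms(1) _ _ _ assms(5) 1 2] frac_lt_1 unfolding \<beta>'_def by blast
qed

end


section \<open>From angles to rays\<close>

lemma (in monic_dynamics) inj_orbit:
  assumes "infinite (range (\<lambda>n. (F ^^ n) z))"
  shows "inj (\<lambda>n. (F ^^ n) z)"
proof -
  have False if ij: "i < j" "(F ^^ i) z = (F ^^ j) z" for i j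
  proof -
    have "(F ^^ n) z \<in> (\<lambda>n. (F ^^ n) z) ` {..<j}" for n
    proof (induction n rule: less_induct)
      case (less n)
      show ?case
      proof (cases "n < j")
        case False
        then have "(F ^^ n) z = (F ^^ (n - j)) ((F ^^ j) z)" by (simp flip: funpow_add comp_apply[of "F ^^ (n - j)"])
        also have "\<dots> = (F ^^ (n - j + i)) z" by (simp add: ij(2)[symmetric] funpow_add)
        finally show ?thesis using less.IH[of "n - j + i"] ij(1) False by simp
      qed auto
    qed
    then have "range (\<lambda>n. (F ^^ n) z) \<subseteq> (\<lambda>n. (F ^^ n) z) ` {..<j}" by blast
    then show False using assms finite_subset by blast
  qed
  then have "\<not> i < j" "\<not> j < i" if "(F ^^ i) z = (F ^^ j) z" for i j
    using that by metis+
  then show ?thesis by (intro injI) (meson linorder_neqE_nat)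
qed

lemma (in connected_dynamics) card_landing_rays:
  assumes "\<And>A. finite A \<Longrightarrow> A \<subseteq> {t\<in>{0..<1}. lands t y} \<Longrightarrow> card A \<le> N"
  shows "finite (rays_landing_at f y) \<and> card (rays_landing_at f y) \<le> N"
proof -
  let ?T = "{t\<in>{0..<1}. lands t y}"
  have T: "finite ?T \<and> card ?T \<le> N"
    by (rule finite_if_finite_subsets_card_bdd) (use assms in blast)
  have ray: "external_ray f t = ray t ` {1<..}" for t
    by (simp add: external_ray_def ray_def[abs_def] pt_def)
  have "rays_landing_at f y \<subseteq> external_ray f ` ?T"
  proof
    fix X assume "X \<in> rays_landing_at f y"
    then obtain t where t: "X = external_ray f t" "lands t y" by (auto simp: rays_landing_at_def)
    have "external_ray f (frac t) = external_ray f t" unfolding ray using ray_cong[of "frac t" t] by simp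
    moreover have "frac t \<in> ?T" using t(2) lands_cong[of "frac t" t y] by (simp add: frac_lt_1)
    ultimately show "X \<in> external_ray f ` ?T" using t(1) by (metis image_eqI)
  qed
  then show ?thesis using T
    by (meson card_image_le card_mono finite_imageI finite_subset le_trans)
qed

theorem theorem2:
  fixes f :: "complex poly" and d :: nat and z :: complex
  assumes "lead_coeff f = 1"
    and "degree f = d"
    and "d \<ge> 2"
    and "connected (julia f)"
    and "z \<in> julia f"
    and "infinite (range (\<lambda>n. (poly f ^^ n) z))"
  shows "(finite (rays_landing_at f z) \<and> card (rays_landing_at f z) \<le> 2 ^ d) \<and>
    (\<exists>N. \<forall>n\<ge>N. finite (rays_landing_at f ((poly f ^^ n) z)) \<and>
                card (rays_landing_at f ((poly f ^^ n) z)) \<le> d)"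
proof -
  interpret monic_dynamics f d using assms(1-3) by unfold_locales
  have "(F ^^ n) z \<in> K" for n
  proof (induction n)
    case (Suc n)
    then show ?case using filled_image_iff[of "(F ^^ n) z"] by simp
  qed (use assms(5) julia_subset in auto)
  then have "range (\<lambda>n. (F ^^ n) z) \<subseteq> K" by blast
  then have "infinite K" using assms(6) finite_subset by blast
  then have "K \<noteq> {z}" by auto
  \<comment> \<open>The point \<open>z\<close> itself serves as the centre of the inversion.\<close>
  interpret connected_dynamics f d z using assms(4,5) \<open>K \<noteq> {z}\<close> by unfold_locales
  interpret L: landing_rays d F lands
  proof
    show "lands (frac t) w \<longleftrightarrow> lands t w" for t w by (rule lands_cong) simp
  qed (use d2 lands_unique lands_image lands_lift lands_unlinked fibre in blast)+
  have inj: "inj (\<lambda>n. (F ^^ n) z)" using assms(6) by (rule inj_orbit)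
  \<comment> \<open>An injective orbit meets the finitely many critical values only finitely often;
    afterwards all its points are regular values.\<close>
  define CV where "CV = F ` {c. poly (pderiv f) c = 0}"
  have "pderiv f \<noteq> 0" using deg d2 by (simp add: pderiv_eq_0_iff)
  then have "finite CV" unfolding CV_def by (intro finite_imageI poly_roots_finite)
  then have "finite ((\<lambda>n. (F ^^ n) z) -` CV)" using inj by (rule finite_vimageI)
  then obtain n0 where n0: "\<And>n. (F ^^ n) z \<in> CV \<Longrightarrow> n < n0" by (auto simp: finite_nat_set_iff_bounded)
  have reg: "L.regular_value ((F ^^ Suc n) z)" if "n \<ge> n0" for n
  proof -
    have "(F ^^ Suc n) z \<notin> CV" using n0[of "Suc n"] that by auto
    then have "poly (pderiv f) w \<noteq> 0" if "F w = (F ^^ Suc n) z" for w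
      using that unfolding CV_def by (metis (mono_tags, lifting) image_eqI mem_Collect_eq)
    then show ?thesis unfolding L.regular_value_def using regular_ray by blast
  qed
  have "finite (rays_landing_at f z) \<and> card (rays_landing_at f z) \<le> 2 ^ d"
  proof (rule card_landing_rays)
    fix A assume A: "finite A" "A \<subseteq> {t\<in>{0..<1}. lands t z}"
    show "card A \<le> 2 ^ d" using L.card_rays_bound[OF inj reg A(1)] A(2) by blast
  qed
  moreover have "finite (rays_landing_at f ((F ^^ n) z)) \<and> card (rays_landing_at f ((F ^^ n) z)) \<le> d"
    if n: "n \<ge> n0" for n
  proof (rule card_landing_rays)
    fix A assume A: "finite A" "A \<subseteq> {t\<in>{0..<1}. lands t ((F ^^ n) z)}"
    have shift: "(F ^^ k) ((F ^^ n) z) = (F ^^ (k + n)) z" for k by (simp add: funpow_add)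
    have "inj (\<lambda>k. (F ^^ k) ((F ^^ n) z))" unfolding shift
    proof (rule injI)
      fix i j assume "(F ^^ (i + n)) z = (F ^^ (j + n)) z"
      then have "i + n = j + n" using injD[OF inj] by blast
      then show "i = j" by simp
    qed
    moreover have "L.regular_value ((F ^^ Suc k) ((F ^^ n) z))" for k
      unfolding shift using reg[of "k + n"] n by simp
    \<comment> \<open>From the shifted starting point on, every value is regular, so the bound
      applies with \<open>n0 = 0\<close>.\<close>
    ultimately show "card A \<le> d"
      using L.card_rays_bound[of "(F ^^ n) z" 0 A] A by blast
  qed
  ultimately show ?thesis by blast
qed


end
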